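(* Let $G=(V,E)$ be a finite compact metric graph in which every vertex carries the standard Kirchhoff condition, and let the metric $\ell\in\mathcal G_G$ be generic in the sense of Colin de Verdière. For every measurable $\omega\subset G$, $$C_\infty(\omega;\ell)>0\quad\Longleftrightarrow\quad|\omega\cap P|>0\ \text{ for every primitive support }P.$$ Equivalently, $C_\infty(\omega;\ell)>0$ if and only if the observation set has positive measure on every simple cycle and every simple path joining two exterior vertices.
   Context: The standard Kirchhoff condition means continuity and vanishing sum of outward derivatives at every vertex, including degree-one vertices (where it is Neumann). $-\Delta_{G,\ell}$ is the corresponding Laplacian, acting as $-d^2/dx^2$ on each edge $e\cong[0,\ell_e]$. Exterior vertices are the degree-one vertices. $C_\infty(\omega;\ell):=\lim_{\Lambda\to\infty}\inf\{\int_\omega|u|^2:\ -\Delta_{G,\ell}u=\lambda u,\ \lambda\ge\Lambda,\ \|u\|_{L^2(G)}=1\}$. A primitive support is the support of a minimal (i.e. minimal-support) semiclassical measure; under the present hypotheses the primitive supports are exactly the simple cycles (a loop, or a pair of parallel edges, counts as a simple cycle) and the simple paths joining two exterior vertices. For a primitive support $P$, $|\omega\cap P|=\sum_{e\subset P}|\omega\cap e|$. **Generic class $\mathcal G_G$.** Orient the edges. For $\theta\in(\mathbb R/2\pi\mathbb Z)^E$ let $N(\theta)$ be the space of families $(A_e,B_e)_{e\in E}$ such that the edge functions $A_e\cos t+B_e\sin t$, having value $A_e$ and outward derivative $B_e$ at the initial endpoint, and value $A_e\cos\theta_e+B_e\sin\theta_e$ and outward derivative $A_e\sin\theta_e-B_e\cos\theta_e$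 at the final endpoint, satisfy the Kirchhoff condition at every vertex. The determinant manifold is $Z_G=\{\theta:N(\theta)\neq0\}$, with singular part $\{\theta:\dim N(\theta)\ge2\}$. $\mathcal G_G$ is the set of $\ell\in(0,\infty)^E$ with rationally independent components whose phase line $\{k\ell\bmod2\pi:k>0\}$ does not meet the singular part; equivalently, in that setting, the positive Laplace spectrum is simple. *)

theory Defs
  imports
    "HOL-Analysis.Analysis"
    "HOL-Library.Function_Algebras"
    "Graph_Theory.Digraph"
    "Graph_Theory.Arc_Walk"
begin

section \<open>Metric graphs\<close>

text \<open>
  A finite graph with oriented edges is a \<^locale>\<open>fin_digraph\<close> (loops and parallel edges
  allowed): the edge \<open>e\<close> runs from \<open>tail G e\<close> to \<open>head G e\<close> and is identified with
  \<open>[0, len e]\<close>. The metric graph is the quotient of the disjoint union of these intervals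
  (and of \<open>verts G\<close>) by the identification of edge ends with vertices.
\<close>

datatype ('v, 'e) gpoint = Vertex 'v | Inner 'e real

definition edge_point :: "('v, 'e) pre_digraph \<Rightarrow> ('e \<Rightarrow> real) \<Rightarrow> 'e \<Rightarrow> real \<Rightarrow> ('v, 'e) gpoint" where
  "edge_point G len e x =
    (if x \<le> 0 then Vertex (tail G e) else if len e \<le> x then Vertex (head G e) else Inner e x)"

definition closed_edge :: "('v, 'e) pre_digraph \<Rightarrow> ('e \<Rightarrow> real) \<Rightarrow> 'e \<Rightarrow> ('v, 'e) gpoint set" where
  "closed_edge G len e = edge_point G len e ` {0..len e}"

definition points :: "('v, 'e) pre_digraph \<Rightarrow> ('e \<Rightarrow> real) \<Rightarrow> ('v, 'e) gpoint set" where
  "points G len = Vertex ` verts G \<union> (\<Union>e\<in>arcs G. closed_edge G len e)"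

definition on_edge :: "('v, 'e) pre_digraph \<Rightarrow> ('e \<Rightarrow> real) \<Rightarrow> ('v, 'e) gpoint set \<Rightarrow> 'e \<Rightarrow> real set" where
  "on_edge G len A e = {x \<in> {0..len e}. edge_point G len e x \<in> A}"

definition graph_topology :: "('v, 'e) pre_digraph \<Rightarrow> ('e \<Rightarrow> real) \<Rightarrow> ('v, 'e) gpoint topology" where
  "graph_topology G len = topology (\<lambda>U. U \<subseteq> points G len \<and>
     (\<forall>e\<in>arcs G. openin (top_of_set {0..len e}) (on_edge G len U e)))"

lemma openin_graph_topology:
  "openin (graph_topology G len) U \<longleftrightarrow> U \<subseteq> points G len \<and>
     (\<forall>e\<in>arcs G. openin (top_of_set {0..len e}) (on_edge G len U e))"
proof -
  have "istopology (\<lambda>U. U \<subseteq> points G len \<and>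
     (\<forall>e\<in>arcs G. openin (top_of_set {0..len e}) (on_edge G len U e)))"
    unfolding istopology_def
  proof (intro conjI allI impI ballI; (elim conjE)?)
    fix S T e
    assume "\<forall>e\<in>arcs G. openin (top_of_set {0..len e}) (on_edge G len S e)"
      and "\<forall>e\<in>arcs G. openin (top_of_set {0..len e}) (on_edge G len T e)" and "e \<in> arcs G"
    then have "openin (top_of_set {0..len e}) (on_edge G len S e \<inter> on_edge G len T e)" by auto
    moreover have "on_edge G len S e \<inter> on_edge G len T e = on_edge G len (S \<inter> T) e"
      by (auto simp: on_edge_def)
    ultimately show "openin (top_of_set {0..len e}) (on_edge G len (S \<inter> T) e)" by simp
  next
    fix \<K> e
    assume "\<forall>K\<in>\<K>. K \<subseteq> points G len \<and>
      (\<forall>e\<in>arcs G. openin (top_of_set {0..len e}) (on_edge G len K e))" and "e \<in> arcs G"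
    then have "openin (top_of_set {0..len e}) (\<Union>K\<in>\<K>. on_edge G len K e)" by (intro openin_Union) auto
    moreover have "(\<Union>K\<in>\<K>. on_edge G len K e) = on_edge G len (\<Union>\<K>) e"
      by (auto simp: on_edge_def)
    ultimately show "openin (top_of_set {0..len e}) (on_edge G len (\<Union>\<K>) e)" by simp
  qed auto
  then show ?thesis by (simp add: graph_topology_def topology_inverse')
qed

definition graph_measurable :: "('v, 'e) pre_digraph \<Rightarrow> ('e \<Rightarrow> real) \<Rightarrow> ('v, 'e) gpoint set \<Rightarrow> bool" where
  "graph_measurable G len A \<longleftrightarrow> A \<subseteq> points G len \<and> (\<forall>e\<in>arcs G. on_edge G len A e \<in> sets lebesgue)"

definition graph_integral ::
  "('v, 'e) pre_digraph \<Rightarrow> ('e \<Rightarrow> real) \<Rightarrow> ('v, 'e) gpoint set \<Rightarrow> (('v, 'e) gpoint \<Rightarrow> real) \<Rightarrow> real" where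
  "graph_integral G len A f =
     (\<Sum>e\<in>arcs G. LINT x:on_edge G len A e|lebesgue. f (edge_point G len e x))"

text \<open>\<open>|A \<inter> P|\<close> for a subset \<open>P\<close> that is a union of edges: the sum of \<open>|A \<inter> e|\<close> over the
  edges \<open>e \<subseteq> P\<close>.\<close>

definition length_on ::
  "('v, 'e) pre_digraph \<Rightarrow> ('e \<Rightarrow> real) \<Rightarrow> ('v, 'e) gpoint set \<Rightarrow> ('v, 'e) gpoint set \<Rightarrow> real" where
  "length_on G len A P =
     (\<Sum>e\<in>{e\<in>arcs G. closed_edge G len e \<subseteq> P}. measure lebesgue (on_edge G len A e))"


section \<open>Kirchhoff Laplacian\<close>

text \<open>
  The Kirchhoff condition at \<open>v\<close> for edge data given by the values \<open>a e\<close>, \<open>b e\<close> and the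
  outward derivatives \<open>a' e\<close>, \<open>b' e\<close> at the initial and final endpoint of each edge.
  "Outward" means pointing from the vertex into the edge. Both ends of a loop contribute.
\<close>

definition kirchhoff_at :: "('v, 'e) pre_digraph \<Rightarrow> 'v \<Rightarrow>
    ('e \<Rightarrow> 'a::real_vector) \<Rightarrow> ('e \<Rightarrow> 'a) \<Rightarrow> ('e \<Rightarrow> 'a) \<Rightarrow> ('e \<Rightarrow> 'a) \<Rightarrow> bool" where
  "kirchhoff_at G v a a' b b' \<longleftrightarrow>
     (\<exists>c. (\<forall>e\<in>out_arcs G v. a e = c) \<and> (\<forall>e\<in>in_arcs G v. b e = c)) \<and>
     (\<Sum>e\<in>out_arcs G v. a' e) + (\<Sum>e\<in>in_arcs G v. b' e) = 0"

text \<open>\<open>-\<Delta> u = \<lambda> u\<close>. Elements of the operator domain (edgewise \<open>H\<^sup>2\<close>) solving this equation are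
  smooth on the closed edges, so the equation is stated classically. The zero function is
  not excluded here; the eigenfunctions below are normalised.\<close>

definition laplace_eigen ::
  "('v, 'e) pre_digraph \<Rightarrow> ('e \<Rightarrow> real) \<Rightarrow> real \<Rightarrow> (('v, 'e) gpoint \<Rightarrow> complex) \<Rightarrow> bool" where
  "laplace_eigen G len lam u \<longleftrightarrow> (\<exists>u'.
     (\<forall>e\<in>arcs G. \<forall>x\<in>{0..len e}.
        ((\<lambda>t. u (edge_point G len e t)) has_vector_derivative u' e x) (at x within {0..len e}) \<and>
        (u' e has_vector_derivative - (lam *\<^sub>R u (edge_point G len e x))) (at x within {0..len e})) \<and>
     (\<forall>v\<in>verts G. kirchhoff_at G v
        (\<lambda>e. u (edge_point G len e 0)) (\<lambda>e. u' e 0)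
        (\<lambda>e. u (edge_point G len e (len e))) (\<lambda>e. - u' e (len e))))"

definition normalized_eigenfunction ::
  "('v, 'e) pre_digraph \<Rightarrow> ('e \<Rightarrow> real) \<Rightarrow> real \<Rightarrow> (('v, 'e) gpoint \<Rightarrow> complex) \<Rightarrow> bool" where
  "normalized_eigenfunction G len lam u \<longleftrightarrow>
     laplace_eigen G len lam u \<and> graph_integral G len (points G len) (\<lambda>p. (cmod (u p))\<^sup>2) = 1"


section \<open>The high-frequency observability constant\<close>

definition C_at :: "('v, 'e) pre_digraph \<Rightarrow> ('e \<Rightarrow> real) \<Rightarrow> ('v, 'e) gpoint set \<Rightarrow> real \<Rightarrow> ereal" where
  "C_at G len \<omega> \<Lambda> = Inf {ereal (graph_integral G len \<omega> (\<lambda>p. (cmod (u p))\<^sup>2)) | u lam.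
     \<Lambda> \<le> lam \<and> normalized_eigenfunction G len lam u}"

definition C_infinity :: "('v, 'e) pre_digraph \<Rightarrow> ('e \<Rightarrow> real) \<Rightarrow> ('v, 'e) gpoint set \<Rightarrow> ereal" where
  "C_infinity G len \<omega> = Lim at_top (C_at G len \<omega>)"

lemma C_at_tendsto: "(C_at G len \<omega> \<longlongrightarrow> C_infinity G len \<omega>) at_top"
proof -
  have mono: "mono (C_at G len \<omega>)"
    unfolding C_at_def by (intro monoI Inf_superset_mono) (blast intro: order_trans)
  have "(C_at G len \<omega> \<longlongrightarrow> (SUP \<Lambda>. C_at G len \<omega> \<Lambda>)) at_top"
  proof (rule order_tendstoI)
    fix a assume "a < (SUP \<Lambda>. C_at G len \<omega> \<Lambda>)"
    then obtain \<Lambda> where "a < C_at G len \<omega> \<Lambda>" by (auto simp: less_SUP_iff)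
    then show "eventually (\<lambda>x. a < C_at G len \<omega> x) at_top"
      unfolding eventually_at_top_linorder using monoD[OF mono] less_le_trans by blast
  next
    fix a assume "(SUP \<Lambda>. C_at G len \<omega> \<Lambda>) < a"
    then show "eventually (\<lambda>x. C_at G len \<omega> x < a) at_top"
      by (intro always_eventually allI) (meson SUP_upper UNIV_I le_less_trans)
  qed
  then show ?thesis unfolding C_infinity_def by (metis tendsto_Lim trivial_limit_at_top_linorder)
qed


section \<open>Semiclassical measures and primitive supports\<close>

text \<open>Weak limits of \<open>|u\<^sub>n|\<^sup>2 dx\<close> along normalised eigenfunctions with eigenvalues tending to
  infinity, as finite Borel measures on the metric graph.\<close>

definition semiclassical_measure ::
  "('v, 'e) pre_digraph \<Rightarrow> ('e \<Rightarrow> real) \<Rightarrow> ('v, 'e) gpoint measure \<Rightarrow> bool" where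
  "semiclassical_measure G len \<mu> \<longleftrightarrow>
     space \<mu> = points G len \<and>
     sets \<mu> = sigma_sets (points G len) {U. openin (graph_topology G len) U} \<and>
     finite_measure \<mu> \<and>
     (\<exists>lam u. filterlim lam at_top sequentially \<and>
        (\<forall>n. normalized_eigenfunction G len (lam n) (u n)) \<and>
        (\<forall>\<phi>. continuous_map (graph_topology G len) euclideanreal \<phi> \<longrightarrow>
           (\<lambda>n. graph_integral G len (points G len) (\<lambda>p. \<phi> p * (cmod (u n p))\<^sup>2))
             \<longlonglongrightarrow> (LINT p|\<mu>. \<phi> p)))"

definition measure_support ::
  "('v, 'e) pre_digraph \<Rightarrow> ('e \<Rightarrow> real) \<Rightarrow> ('v, 'e) gpoint measure \<Rightarrow> ('v, 'e) gpoint set" where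
  "measure_support G len \<mu> =
     {p \<in> points G len. \<forall>U. openin (graph_topology G len) U \<and> p \<in> U \<longrightarrow> measure \<mu> U > 0}"

definition primitive_support ::
  "('v, 'e) pre_digraph \<Rightarrow> ('e \<Rightarrow> real) \<Rightarrow> ('v, 'e) gpoint set \<Rightarrow> bool" where
  "primitive_support G len P \<longleftrightarrow>
     (\<exists>\<mu>. semiclassical_measure G len \<mu> \<and> P = measure_support G len \<mu> \<and>
        (\<forall>\<nu>. semiclassical_measure G len \<nu> \<and> measure_support G len \<nu> \<subseteq> P
               \<longrightarrow> measure_support G len \<nu> = P))"


section \<open>Simple cycles and simple paths between exterior vertices\<close>

text \<open>Undirected walks in \<open>G\<close> are directed walks in the digraph having each edge of \<open>G\<close> in both
  directions. A cycle there must not use an edge in both directions, which is why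
  distinctness of the underlying edges is required in addition.\<close>

definition two_way :: "('v, 'e) pre_digraph \<Rightarrow> ('v, 'e \<times> bool) pre_digraph" where
  "two_way G = \<lparr> verts = verts G, arcs = arcs G \<times> UNIV,
     tail = (\<lambda>(e, b). if b then tail G e else head G e),
     head = (\<lambda>(e, b). if b then head G e else tail G e) \<rparr>"

definition carrier_set ::
  "('v, 'e) pre_digraph \<Rightarrow> ('e \<Rightarrow> real) \<Rightarrow> ('e \<times> bool) list \<Rightarrow> ('v, 'e) gpoint set" where
  "carrier_set G len p = (\<Union>e\<in>fst ` set p. closed_edge G len e)"

definition is_simple_cycle ::
  "('v, 'e) pre_digraph \<Rightarrow> ('e \<Rightarrow> real) \<Rightarrow> ('v, 'e) gpoint set \<Rightarrow> bool" where
  "is_simple_cycle G len P \<longleftrightarrow>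
     (\<exists>p. pre_digraph.cycle (two_way G) p \<and> distinct (map fst p) \<and> P = carrier_set G len p)"

definition exterior :: "('v, 'e) pre_digraph \<Rightarrow> 'v \<Rightarrow> bool" where
  "exterior G v \<longleftrightarrow> v \<in> verts G \<and> in_degree G v + out_degree G v = 1"

definition is_exterior_path ::
  "('v, 'e) pre_digraph \<Rightarrow> ('e \<Rightarrow> real) \<Rightarrow> ('v, 'e) gpoint set \<Rightarrow> bool" where
  "is_exterior_path G len P \<longleftrightarrow>
     (\<exists>v p w. exterior G v \<and> exterior G w \<and> v \<noteq> w \<and>
        pre_digraph.apath (two_way G) v p w \<and> P = carrier_set G len p)"


section \<open>The generic class of Colin de Verdiere\<close>

text \<open>Points of the torus \<open>(\<real>/2\<pi>\<int>)\<^sup>E\<close> are given by representatives \<open>\<theta> :: 'e \<Rightarrow> real\<close>; all that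
  follows depends on \<open>\<theta>\<close> only modulo \<open>2\<pi>\<close>. A family \<open>(A\<^sub>e, B\<^sub>e)\<close> indexed by the edges is a
  function on \<open>'e\<close> that vanishes off \<open>arcs G\<close>.\<close>

definition N_space :: "('v, 'e) pre_digraph \<Rightarrow> ('e \<Rightarrow> real) \<Rightarrow> ('e \<Rightarrow> real \<times> real) set" where
  "N_space G \<theta> = {X. (\<forall>e. e \<notin> arcs G \<longrightarrow> X e = 0) \<and>
     (\<forall>v\<in>verts G. kirchhoff_at G v
        (\<lambda>e. fst (X e))
        (\<lambda>e. snd (X e))
        (\<lambda>e. fst (X e) * cos (\<theta> e) + snd (X e) * sin (\<theta> e))
        (\<lambda>e. fst (X e) * sin (\<theta> e) - snd (X e) * cos (\<theta> e)))}"

definition fam_scale :: "real \<Rightarrow> ('e \<Rightarrow> real \<times> real) \<Rightarrow> 'e \<Rightarrow> real \<times> real" where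
  "fam_scale c X = (\<lambda>e. c *\<^sub>R X e)"

lemma vector_space_fam_scale: "vector_space fam_scale"
  by unfold_locales (auto simp: fam_scale_def fun_eq_iff scaleR_add_right scaleR_add_left)

definition determinant_manifold :: "('v, 'e) pre_digraph \<Rightarrow> ('e \<Rightarrow> real) set" where
  "determinant_manifold G = {\<theta>. N_space G \<theta> \<noteq> {0}}"

definition singular_part :: "('v, 'e) pre_digraph \<Rightarrow> ('e \<Rightarrow> real) set" where
  "singular_part G =
     {\<theta> \<in> determinant_manifold G. 2 \<le> vector_space.dim fam_scale (N_space G \<theta>)}"

definition rationally_independent :: "'e set \<Rightarrow> ('e \<Rightarrow> real) \<Rightarrow> bool" where
  "rationally_independent E len \<longleftrightarrow>
     (\<forall>q :: 'e \<Rightarrow> rat. (\<Sum>e\<in>E. of_rat (q e) * len e) = 0 \<longrightarrow> (\<forall>e\<in>E. q e = 0))"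

definition generic_class :: "('v, 'e) pre_digraph \<Rightarrow> ('e \<Rightarrow> real) set" where
  "generic_class G = {len. (\<forall>e\<in>arcs G. 0 < len e) \<and> rationally_independent (arcs G) len \<and>
     (\<forall>k>0. (\<lambda>e. k * len e) \<notin> singular_part G)}"

end

theory Submission
  imports Defs "HOL-Complex_Analysis.Great_Picard" "Jordan_Normal_Form.Determinant"
begin

text \<open>
  On an edge, a solution of \<open>- u'' = k\<^sup>2 u\<close> is a superposition of two waves running in opposite
  directions, so an eigenfunction of frequency \<open>k\<close> is a family of amplitudes \<open>a d\<close>, one for each
  arc \<open>d\<close> of the two-way graph. The vertex conditions become linear equations for \<open>a\<close> that see
  the metric only through the phases \<open>w e = exp (\<i> k len e)\<close> (\<open>kirchhoff_wave\<close>). When \<open>k\<close> tends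
  to infinity the interference term in \<open>|u|\<^sup>2\<close> oscillates away, by the Riemann--Lebesgue lemma, and
  \<open>|u|\<^sup>2 dx\<close> tends weakly to the measure whose density on the edge \<open>e\<close> is the constant
  \<open>|a (e, True)|\<^sup>2 + |a (e, False)|\<^sup>2\<close>. Amplitudes live in a finite-dimensional space, so every
  sequence of eigenfunctions has a convergent subsequence. Hence the supports of semiclassical
  measures are exactly the unions of edges on which some limit of amplitudes does not vanish
  (\<open>limit_edges\<close>), and the observability constant is positive iff \<open>\<omega>\<close> has positive length on
  each of them. There are finitely many such sets of edges, each contains a minimal one, and this
  gives the criterion in terms of primitive supports.

  For the second criterion the limits of amplitudes are compared with cycles and with paths
  between exterior vertices.

  A limit still satisfies the vertex conditions, with phases of modulus one. If it lives on a
  single edge end at a vertex of degree at least two, then the value and the derivative at that end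
  vanish, hence so does the amplitude on the edge. So the edges carrying the limit have no dead end
  other than exterior vertices, and prolonging a path inside them as far as possible yields a
  cycle or a path between exterior vertices (\<open>cycle_or_exterior_path_within\<close>).

  Conversely, a cycle or an exterior path \<open>P\<close> carries an explicit sine wave at suitable phases on
  \<open>P\<close> and arbitrary phases elsewhere, because the wave vanishes at all vertices through which it
  passes. It has to be produced as a limit of true eigenfunctions. Everything rests on one
  identity (\<open>kirchhoff_wave_product\<close>), a form of Green's formula: if \<open>a\<close> solves the vertex
  conditions for \<open>w\<close> and \<open>a'\<close> for \<open>w'\<close>, then \<open>\<Sum>d. (1 - w cnj w') a cnj a' = 0\<close>.

  \<^item> Let \<open>w\<close> be prescribed on \<open>P\<close> and equal to a constant \<open>\<zeta>\<close> of modulus one elsewhere. By the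
    identity, solutions for different \<open>\<zeta>\<close> have orthogonal restrictions to the complement of \<open>P\<close>.
    Since the space of amplitudes is finite-dimensional, for some \<open>\<zeta>\<close> every solution is supported
    in \<open>P\<close> (\<open>exists_phases_confining_waves\<close>).

  \<^item> By rational independence and Kronecker's theorem there are frequencies \<open>t n\<close> tending to
    infinity whose phases converge to this \<open>w\<close> (\<open>kronecker_recurrent_phases\<close>).

  \<^item> The solvability of the vertex conditions at the complex frequency \<open>t n + z\<close> is the vanishing
    of a determinant, which converges locally uniformly in \<open>z\<close> to the determinant with phases
    \<open>w e * exp (\<i> z len e)\<close>. The latter vanishes at \<open>z = 0\<close>, so by Hurwitz's theorem the former has
    zeros near \<open>0\<close>. By the identity with \<open>w = w'\<close> zeros occur only where the phases have modulus
    one, that is at real frequencies: these are frequencies of eigenfunctions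
    (\<open>kirchhoff_wave_near_phases\<close>).

  The limit of the corresponding normalised amplitudes solves the vertex conditions for \<open>w\<close>, so it
  is supported in \<open>P\<close>, and \<open>P\<close> contains the support of a semiclassical measure.
\<close>

section \<open>The Riemann--Lebesgue lemma\<close>

lemma has_vector_derivative_cis_mult:
  "((\<lambda>x. cis (k * x)) has_vector_derivative \<i> * k * cis (k * x)) (at x within S)"
proof -
  have "((\<lambda>z. exp (\<i> * k * z)) has_field_derivative \<i> * k * exp (\<i> * k * of_real x)) (at (of_real x))"
    by (auto intro!: derivative_eq_intros)
  from has_vector_derivative_real_field[OF this] show ?thesis
    by (simp add: cis_conv_exp mult.assoc)
qed

text \<open>
  Integrability is part of the definition so that the class of such functions is closed under the
  steps of an induction over integrable functions.
\<close>

definition oscillation_vanishes :: "(real \<Rightarrow> real) \<Rightarrow> bool" where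
  "oscillation_vanishes f \<longleftrightarrow> integrable lborel f \<and>
     ((\<lambda>k. LINT x|lborel. f x *\<^sub>R cis (k * x)) \<longlongrightarrow> 0) at_top"

lemma integrable_times_cis:
  fixes f :: "real \<Rightarrow> real"
  assumes "integrable lborel f"
  shows "integrable lborel (\<lambda>x. f x *\<^sub>R cis (k * x))"
proof (rule Bochner_Integration.integrable_bound[OF assms])
  have "(\<lambda>x. cis (k * x)) \<in> borel_measurable borel"
    by (intro borel_measurable_continuous_onI continuous_intros)
  then show "(\<lambda>x. f x *\<^sub>R cis (k * x)) \<in> borel_measurable lborel"
    using assms by (auto intro!: borel_measurable_scaleR)
qed (simp add: norm_mult)

lemma oscillation_vanishes_add:
  assumes "oscillation_vanishes f" "oscillation_vanishes g"
  shows "oscillation_vanishes (\<lambda>x. f x + g x)"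
  using assms tendsto_add[of "\<lambda>k. LINT x|lborel. f x *\<^sub>R cis (k * x)" 0 at_top
      "\<lambda>k. LINT x|lborel. g x *\<^sub>R cis (k * x)" 0]
  by (simp add: oscillation_vanishes_def scaleR_add_left integrable_times_cis)

lemma oscillation_vanishes_cmult:
  assumes "oscillation_vanishes f"
  shows "oscillation_vanishes (\<lambda>x. f x * c)"
proof -
  have "(\<lambda>k. LINT x|lborel. (f x * c) *\<^sub>R cis (k * x)) =
        (\<lambda>k. c *\<^sub>R (LINT x|lborel. f x *\<^sub>R cis (k * x)))"
    by (subst integral_scaleR_right[symmetric]) (simp_all add: mult.commute)
  then show ?thesis
    using assms tendsto_scaleR[OF tendsto_const[of c], of "\<lambda>k. LINT x|lborel. f x *\<^sub>R cis (k * x)" 0 at_top]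
    by (simp add: oscillation_vanishes_def)
qed

text \<open>
  The functions with vanishing oscillatory integrals are closed in \<open>L\<^sup>1\<close>, because the integrals are
  bounded by the \<open>L\<^sup>1\<close> norm uniformly in the frequency. The domination hypothesis has the form in
  which both the induction rule for integrable functions and truncations of sets supply it.
\<close>

lemma oscillation_vanishes_limit:
  assumes f: "integrable lborel f"
    and s: "\<And>i. oscillation_vanishes (s i)"
    and lim: "\<And>x. (\<lambda>i. s i x) \<longlonglongrightarrow> f x"
    and bound: "\<And>i x. \<bar>s i x\<bar> \<le> 2 * \<bar>f x\<bar>"
  shows "oscillation_vanishes f"
proof -
  have si: "integrable lborel (s i)" for i using s by (simp add: oscillation_vanishes_def)
  have "(\<lambda>i. LINT x|lborel. \<bar>f x - s i x\<bar>) \<longlonglongrightarrow> (LINT (x::real)|lborel. 0)"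
  proof (rule integral_dominated_convergence[where w = "\<lambda>x. 3 * \<bar>f x\<bar>"])
    show "AE x in lborel. (\<lambda>i. \<bar>f x - s i x\<bar>) \<longlonglongrightarrow> 0"
      using tendsto_rabs_zero[OF tendsto_diff[OF tendsto_const lim, of "f x" x for x, simplified]] by simp
    show "AE x in lborel. norm \<bar>f x - s i x\<bar> \<le> 3 * \<bar>f x\<bar>" for i
    proof (rule AE_I2)
      fix x show "norm \<bar>f x - s i x\<bar> \<le> 3 * \<bar>f x\<bar>" using bound[of i x] by simp
    qed
  qed (use f si in auto)
  then have L1: "(\<lambda>i. LINT x|lborel. \<bar>f x - s i x\<bar>) \<longlonglongrightarrow> 0" by simp
  have "((\<lambda>k. LINT x|lborel. f x *\<^sub>R cis (k * x)) \<longlongrightarrow> 0) at_top"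
  proof (rule tendstoI)
    fix e :: real assume "e > 0"
    then obtain i where i: "\<bar>LINT x|lborel. \<bar>f x - s i x\<bar>\<bar> < e / 2"
      using LIMSEQ_D[OF L1, of "e / 2"] by auto
    have "((\<lambda>k. LINT x|lborel. s i x *\<^sub>R cis (k * x)) \<longlongrightarrow> 0) at_top"
      using s by (simp add: oscillation_vanishes_def)
    from tendstoD[OF this half_gt_zero[OF \<open>e > 0\<close>]]
    show "eventually (\<lambda>k. dist (LINT x|lborel. f x *\<^sub>R cis (k * x)) 0 < e) at_top"
    proof (rule eventually_mono)
      fix k assume "dist (LINT x|lborel. s i x *\<^sub>R cis (k * x)) 0 < e / 2"
      then have k: "cmod (LINT x|lborel. s i x *\<^sub>R cis (k * x)) < e / 2" by simp
      have "(LINT x|lborel. f x *\<^sub>R cis (k * x)) =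
            (LINT x|lborel. (f x - s i x) *\<^sub>R cis (k * x)) + (LINT x|lborel. s i x *\<^sub>R cis (k * x))"
        by (subst Bochner_Integration.integral_add[symmetric])
           (auto intro!: integrable_times_cis f si simp: scaleR_diff_left)
      moreover have "cmod (LINT x|lborel. (f x - s i x) *\<^sub>R cis (k * x)) \<le> (LINT x|lborel. \<bar>f x - s i x\<bar>)"
        by (rule order_trans[OF integral_norm_bound]) (simp add: norm_mult)
      ultimately show "dist (LINT x|lborel. f x *\<^sub>R cis (k * x)) 0 < e"
        using i k norm_triangle_ineq[of "LINT x|lborel. (f x - s i x) *\<^sub>R cis (k * x)"
            "LINT x|lborel. s i x *\<^sub>R cis (k * x)"] by simp
    qed
  qed
  with f show ?thesis by (simp add: oscillation_vanishes_def)
qed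

lemma oscillation_vanishes_interval: "oscillation_vanishes (indicator {a..b})"
proof (cases "a \<le> b")
  case True
  have "((\<lambda>k. LINT x|lborel. (indicator {a..b} x :: real) *\<^sub>R cis (k * x)) \<longlongrightarrow> 0) at_top"
  proof (rule Lim_null_comparison)
    show "eventually (\<lambda>k. norm (LINT x|lborel. (indicator {a..b} x :: real) *\<^sub>R cis (k * x)) \<le> 2 / k) at_top"
      using eventually_gt_at_top[of "0::real"]
    proof eventually_elim
      fix k :: real assume k: "k > 0"
      have "(LINT x|lborel. (indicator {a..b} x :: real) *\<^sub>R cis (k * x)) =
            cis (k * b) / (\<i> * k) - cis (k * a) / (\<i> * k)"
      proof (rule integral_FTC_atLeastAtMost[OF True])
        fix x
        show "((\<lambda>x. cis (k * x) / (\<i> * k)) has_vector_derivative cis (k * x)) (at x within {a..b})"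
          using k has_vector_derivative_divide[OF has_vector_derivative_cis_mult[of k x "{a..b}"], of "\<i> * k"]
          by simp
      qed (intro continuous_intros)
      also have "norm \<dots> \<le> 2 / k"
        using k by (intro order_trans[OF norm_triangle_ineq4]) (simp add: norm_divide norm_mult)
      finally show "norm (LINT x|lborel. (indicator {a..b} x :: real) *\<^sub>R cis (k * x)) \<le> 2 / k" .
    qed
    show "((\<lambda>k::real. 2 / k) \<longlongrightarrow> 0) at_top"
      by (intro tendsto_divide_0[OF tendsto_const] filterlim_at_top_imp_at_infinity filterlim_ident)
  qed
  moreover have "integrable lborel (indicator {a..b} :: real \<Rightarrow> real)"
    using True by (intro integrable_real_indicator) auto
  ultimately show ?thesis by (simp add: oscillation_vanishes_def)
qed (simp add: oscillation_vanishes_def)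

text \<open>
  Half-lines generate the Borel sets and are stable under intersection, so by the theorem of Dynkin
  it suffices to pass from intervals to complements and countable disjoint unions. The window
  \<open>{- N..N}\<close> keeps all indicators integrable.
\<close>

lemma oscillation_vanishes_bounded_set:
  assumes "A \<in> sets borel"
  shows "oscillation_vanishes (indicator (A \<inter> {- real N..real N}))"
proof -
  let ?I = "{- real N..real N}"
  have "Int_stable (range atMost :: real set set)" "(range atMost :: real set set) \<subseteq> Pow UNIV"
    by (auto simp: Int_stable_def)
  moreover have "A \<in> sigma_sets UNIV (range atMost :: real set set)"
    using assms unfolding borel_eq_atMost by simp
  ultimately show ?thesis
  proof (induction A rule: sigma_sets_induct_disjoint)
    case (basic A)
    then obtain c where "A = {..c}" by auto
    then have "A \<inter> ?I = {- real N..min c (real N)}" by auto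
    then show ?case by (simp add: oscillation_vanishes_interval)
  next
    case empty
    show ?case by (simp add: oscillation_vanishes_def)
  next
    case (compl A)
    have "indicator ((UNIV - A) \<inter> ?I) = (\<lambda>x. indicator ?I x + indicator (A \<inter> ?I) x * (-1::real))"
      by (auto simp: indicator_def fun_eq_iff)
    then show ?case
      using oscillation_vanishes_add[OF oscillation_vanishes_interval oscillation_vanishes_cmult[OF compl(2)],
          of "- real N" "real N" "-1"]
      by simp
  next
    case (union A)
    have A: "A i \<in> sets borel" for i
      using union(2) unfolding borel_eq_atMost by auto
    have fin: "oscillation_vanishes (indicator ((\<Union>j<i. A j) \<inter> ?I))" for i
    proof (induction i)
      case 0 show ?case by (simp add: oscillation_vanishes_def)
    next
      case (Suc i)
      have "A i \<inter> A j = {}" if "j < i" for j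
        using union(1) that by (auto simp: disjoint_family_on_def)
      then have "indicator ((\<Union>j<Suc i. A j) \<inter> ?I) =
          (\<lambda>x. indicator ((\<Union>j<i. A j) \<inter> ?I) x + (indicator (A i \<inter> ?I) x :: real))"
        by (auto simp: indicator_def fun_eq_iff less_Suc_eq)
      with oscillation_vanishes_add[OF Suc union(3)[of i]] show ?case by simp
    qed
    show ?case
    proof (rule oscillation_vanishes_limit[OF _ fin])
      have "emeasure lborel ((\<Union>(range A)) \<inter> ?I) \<le> emeasure lborel ?I"
        by (rule emeasure_mono) auto
      also have "\<dots> < \<infinity>" by simp
      finally show "integrable lborel (indicator ((\<Union>(range A)) \<inter> ?I) :: real \<Rightarrow> real)"
        using A by (intro integrable_real_indicator) auto
      show "(\<lambda>i. indicator ((\<Union>j<i. A j) \<inter> ?I) x :: real) \<longlonglongrightarrow> indicator ((\<Union>(range A)) \<inter> ?I) x" for x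
      proof (cases "x \<in> (\<Union>(range A)) \<inter> ?I")
        case True
        then obtain j where "x \<in> A j" "x \<in> ?I" by auto
        then have "eventually (\<lambda>i. indicator ((\<Union>j<i. A j) \<inter> ?I) x = (1::real)) sequentially"
          by (intro eventually_sequentiallyI[of "Suc j"]) (auto simp: indicator_def intro!: bexI[of _ j])
        with True show ?thesis by (simp add: tendsto_eventually)
      next
        case False
        then have "indicator ((\<Union>j<i. A j) \<inter> ?I) x = (0::real)" for i by (auto simp: indicator_def)
        with False show ?thesis by simp
      qed
    qed (auto simp: indicator_def)
  qed
qed

lemma riemann_lebesgue_lborel:
  fixes f :: "real \<Rightarrow> real"
  assumes "integrable lborel f"
  shows "oscillation_vanishes f"
  using assms
proof (induction f rule: integrable_induct)
  case (base A c)
  have "oscillation_vanishes (indicator A :: real \<Rightarrow> real)"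
  proof (rule oscillation_vanishes_limit)
    show "integrable lborel (indicator A :: real \<Rightarrow> real)"
      using base by (intro integrable_real_indicator) auto
    show "oscillation_vanishes (indicator (A \<inter> {- real i..real i}))" for i
      using base by (intro oscillation_vanishes_bounded_set) simp
    show "(\<lambda>i. indicator (A \<inter> {- real i..real i}) x :: real) \<longlonglongrightarrow> indicator A x" for x
    proof -
      obtain n where "\<bar>x\<bar> \<le> real n" using real_arch_simple by blast
      then have "eventually (\<lambda>i. indicator (A \<inter> {- real i..real i}) x = (indicator A x :: real)) sequentially"
        by (intro eventually_sequentiallyI[of n]) (auto simp: indicator_def)
      then show ?thesis by (simp add: tendsto_eventually)
    qed
  qed (auto simp: indicator_def)
  from oscillation_vanishes_cmult[OF this, of c] show ?case by simp
next
  case (add f g)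
  then show ?case by (simp add: oscillation_vanishes_add)
next
  case (lim f s)
  then show ?case by (intro oscillation_vanishes_limit[of f s]) auto
qed

lemma riemann_lebesgue:
  fixes f :: "real \<Rightarrow> real"
  assumes "integrable lebesgue f"
  shows "((\<lambda>k. LINT x|lebesgue. f x *\<^sub>R cis (k * x)) \<longlongrightarrow> 0) at_top"
proof -
  obtain g where g: "g \<in> borel_measurable lborel" "AE x in lborel. f x = g x"
    using completion_ex_borel_measurable_real[of f lborel] assms by auto
  have AE: "AE x in lebesgue. f x = g x" using g(2) by (rule AE_completion)
  have gm: "g \<in> borel_measurable lebesgue" using g(1) by (rule measurable_completion)
  have "integrable lebesgue g"
    using assms AE gm by (subst integrable_cong_AE[symmetric, of f]) auto
  then have gi: "integrable lborel g" using g(1) by (simp add: integrable_completion)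
  have cm: "(\<lambda>x. cis (k * x)) \<in> borel_measurable lebesgue" for k
    by (rule measurable_completion)
       (auto intro!: borel_measurable_continuous_onI continuous_intros)
  have "(LINT x|lebesgue. f x *\<^sub>R cis (k * x)) = (LINT x|lborel. g x *\<^sub>R cis (k * x))" for k
  proof -
    have "(LINT x|lebesgue. f x *\<^sub>R cis (k * x)) = (LINT x|lebesgue. g x *\<^sub>R cis (k * x))"
      using assms gm AE by (intro integral_cong_AE borel_measurable_scaleR cm) auto
    also have "\<dots> = (LINT x|lborel. g x *\<^sub>R cis (k * x))"
      by (rule integral_completion) (use integrable_times_cis[OF gi] in auto)
    finally show ?thesis .
  qed
  with riemann_lebesgue_lborel[OF gi] show ?thesis by (simp add: oscillation_vanishes_def)
qed

section \<open>Zeros of determinants under uniform limits\<close>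

lemma det_mat_eq_sum:
  "Determinant.det (Matrix.mat n n (\<lambda>(i, j). M i j)) =
     (\<Sum>p | p permutes {0..<n}. signof p * (\<Prod>i = 0..<n. (M i (p i) :: complex)))"
proof -
  have "p i < n" if "p permutes {0..<n}" "i < n" for p i
    using permutes_in_image[OF that(1), of i] that(2) by simp
  then show ?thesis
    by (subst det_def'[where n = n]) (auto intro!: sum.cong prod.cong)
qed

lemma holomorphic_on_det:
  assumes "\<And>i j. (\<lambda>z. M z i j) holomorphic_on S"
  shows "(\<lambda>z. Determinant.det (Matrix.mat n n (\<lambda>(i, j). M z i j))) holomorphic_on S"
  unfolding det_mat_eq_sum
  by (intro holomorphic_on_sum holomorphic_on_mult holomorphic_on_const holomorphic_on_prod assms)

text \<open>
  Boundedness of the limit is carried along in the induction, since it is what makes products of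
  uniform limits converge.
\<close>

lemma uniform_limit_prod:
  fixes f :: "'i \<Rightarrow> nat \<Rightarrow> 'a \<Rightarrow> complex"
  assumes "finite I" "\<And>i. i \<in> I \<Longrightarrow> uniform_limit K (f i) (l i) sequentially"
    "\<And>i. i \<in> I \<Longrightarrow> bounded (l i ` K)"
  shows "uniform_limit K (\<lambda>n z. \<Prod>i\<in>I. f i n z) (\<lambda>z. \<Prod>i\<in>I. l i z) sequentially \<and>
    bounded ((\<lambda>z. \<Prod>i\<in>I. l i z) ` K)"
  using assms
proof (induction I rule: finite_induct)
  case empty
  show ?case by (simp add: image_constant_conv uniform_limit_const)
next
  case (insert i I)
  then have IH: "uniform_limit K (\<lambda>n z. \<Prod>i\<in>I. f i n z) (\<lambda>z. \<Prod>i\<in>I. l i z) sequentially"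
    "bounded ((\<lambda>z. \<Prod>i\<in>I. l i z) ` K)" by auto
  obtain B C where "\<And>z. z \<in> K \<Longrightarrow> cmod (l i z) \<le> B" "\<And>z. z \<in> K \<Longrightarrow> cmod (\<Prod>i\<in>I. l i z) \<le> C"
    using IH(2) insert.prems(2)[of i] by (auto simp: bounded_iff)
  then have "cmod (l i z * (\<Prod>i\<in>I. l i z)) \<le> B * C" if "z \<in> K" for z
    unfolding norm_mult using that norm_ge_zero order_trans by (intro mult_mono) blast+
  then have "bounded ((\<lambda>z. l i z * (\<Prod>i\<in>I. l i z)) ` K)" by (auto simp: bounded_iff)
  with insert.hyps show ?case
    using uniform_lim_mult[OF insert.prems(1)[of i] IH(1) insert.prems(2)[of i] IH(2)] by simp
qed

lemma uniform_limit_finite_sum: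
  fixes f :: "'i \<Rightarrow> nat \<Rightarrow> 'a \<Rightarrow> complex"
  assumes "\<And>i. i \<in> I \<Longrightarrow> uniform_limit K (f i) (l i) sequentially"
  shows "uniform_limit K (\<lambda>n z. \<Sum>i\<in>I. f i n z) (\<lambda>z. \<Sum>i\<in>I. l i z) sequentially"
  using assms
  by (induction I rule: infinite_finite_induct) (auto intro!: uniform_limit_add uniform_limit_const)

lemma uniform_limit_det:
  fixes M :: "nat \<Rightarrow> 'a \<Rightarrow> nat \<Rightarrow> nat \<Rightarrow> complex"
  assumes lim: "\<And>i j. uniform_limit K (\<lambda>n z. M n z i j) (\<lambda>z. L z i j) sequentially"
    and bd: "\<And>i j. bounded ((\<lambda>z. L z i j) ` K)"
  shows "uniform_limit K (\<lambda>m z. Determinant.det (Matrix.mat n n (\<lambda>(i, j). M m z i j)))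
     (\<lambda>z. Determinant.det (Matrix.mat n n (\<lambda>(i, j). L z i j))) sequentially"
  unfolding det_mat_eq_sum
proof (rule uniform_limit_finite_sum)
  fix p :: "nat \<Rightarrow> nat"
  have *: "uniform_limit K (\<lambda>m z. \<Prod>i = 0..<n. M m z i (p i)) (\<lambda>z. \<Prod>i = 0..<n. L z i (p i)) sequentially"
    "bounded ((\<lambda>z. \<Prod>i = 0..<n. L z i (p i)) ` K)"
    using uniform_limit_prod[where I = "{0..<n}" and K = K and f = "\<lambda>i m z. M m z i (p i)"
        and l = "\<lambda>i z. L z i (p i)"] lim bd by auto
  show "uniform_limit K (\<lambda>m z. signof p * (\<Prod>i = 0..<n. M m z i (p i)))
      (\<lambda>z. signof p * (\<Prod>i = 0..<n. L z i (p i))) sequentially"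
    by (rule uniform_lim_mult[OF uniform_limit_const *(1) _ *(2)]) (simp add: image_constant_conv)
qed

text \<open>
  Square matrices are indexed by an arbitrary finite set here, namely the arcs of a graph; an
  enumeration is chosen only to speak of the determinant.
\<close>

definition singular_on :: "'d set \<Rightarrow> ('d \<Rightarrow> 'd \<Rightarrow> complex) \<Rightarrow> bool" where
  "singular_on D M \<longleftrightarrow> (\<exists>a. (\<exists>d\<in>D. a d \<noteq> 0) \<and> (\<forall>d\<in>D. (\<Sum>d'\<in>D. M d d' * a d') = 0))"

lemma det_eq_0_iff_singular_on:
  assumes f: "bij_betw f {..<n} D"
  shows "Determinant.det (Matrix.mat n n (\<lambda>(i, j). M (f i) (f j))) = 0 \<longleftrightarrow> singular_on D M"
    (is "Determinant.det ?A = 0 \<longleftrightarrow> _")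
proof -
  have A: "?A \<in> carrier_mat n n" by simp
  have mv: "scalar_prod (row ?A i) v = (\<Sum>j<n. M (f i) (f j) * vec_index v j)"
    if "i < n" "v \<in> carrier_vec n" for i v
    using that by (auto simp: scalar_prod_def lessThan_atLeast0 intro!: sum.cong)
  have reindex: "(\<Sum>d'\<in>D. M d d' * a d') = (\<Sum>j<n. M d (f j) * a (f j))" for a d
    by (rule sum.reindex_bij_betw[OF f, symmetric])
  show ?thesis
  proof
    assume "Determinant.det ?A = 0"
    then obtain v where v: "v \<in> carrier_vec n" "v \<noteq> 0\<^sub>v n" "?A *\<^sub>v v = 0\<^sub>v n"
      using det_0_iff_vec_prod_zero[OF A] by auto
    define a where "a d = vec_index v (inv_into {..<n} f d)" for d
    have a: "a (f j) = vec_index v j" if "j < n" for j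
      using f that by (auto simp: a_def bij_betw_def)
    obtain j where j: "j < n" "vec_index v j \<noteq> 0"
      using v(1,2) by (metis carrier_vecD eq_vecI index_zero_vec(1,2))
    have "a (f j) \<noteq> 0" "f j \<in> D" using a j f by (auto simp: bij_betw_def)
    moreover have "(\<Sum>d'\<in>D. M d d' * a d') = 0" if "d \<in> D" for d
    proof -
      obtain i where i: "i < n" "d = f i" using f \<open>d \<in> D\<close> by (auto simp: bij_betw_def)
      have "(\<Sum>d'\<in>D. M d d' * a d') = scalar_prod (row ?A i) v"
        unfolding reindex mv[OF i(1) v(1)] using i a by (auto intro!: sum.cong)
      also have "\<dots> = 0"
        using arg_cong[OF v(3), of "\<lambda>u. vec_index u i"] i(1) by simp
      finally show ?thesis .
    qed
    ultimately show "singular_on D M" unfolding singular_on_def by blast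
  next
    assume "singular_on D M"
    then obtain a d where a: "d \<in> D" "a d \<noteq> 0" "\<And>d. d \<in> D \<Longrightarrow> (\<Sum>d'\<in>D. M d d' * a d') = 0"
      by (auto simp: singular_on_def)
    define v where "v = Matrix.vec n (\<lambda>j. a (f j))"
    have v: "v \<in> carrier_vec n" by (simp add: v_def)
    obtain j where j: "j < n" "d = f j" using f a(1) by (auto simp: bij_betw_def)
    have "vec_index v j \<noteq> 0" using j a(2) by (simp add: v_def)
    then have "v \<noteq> 0\<^sub>v n" using j(1) by auto
    moreover have "?A *\<^sub>v v = 0\<^sub>v n"
    proof (rule eq_vecI)
      fix i assume "i < dim_vec (0\<^sub>v n :: complex Matrix.vec)"
      then have i: "i < n" by simp
      then have "f i \<in> D" using f by (auto simp: bij_betw_def)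
      have "vec_index (?A *\<^sub>v v) i = scalar_prod (row ?A i) v" using i by simp
      also have "\<dots> = (\<Sum>d'\<in>D. M (f i) d' * a d')"
        unfolding reindex mv[OF i v] by (auto simp: v_def intro!: sum.cong)
      also have "\<dots> = 0" using a(3)[OF \<open>f i \<in> D\<close>] .
      finally show "vec_index (?A *\<^sub>v v) i = vec_index (0\<^sub>v n) i" using i by simp
    qed simp
    ultimately show "Determinant.det ?A = 0"
      using det_0_iff_vec_prod_zero[OF A] v by blast
  qed
qed

text \<open>
  Hurwitz's theorem for the determinant: a singular matrix in the limit family forces singular
  matrices nearby in the approximating families. The regular point \<open>z1\<close> ensures that the limit
  determinant is not identically zero.
\<close>

lemma singular_on_near_limit:
  fixes M :: "nat \<Rightarrow> complex \<Rightarrow> 'd \<Rightarrow> 'd \<Rightarrow> complex"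
  assumes "finite D" "0 < r"
    and holM: "\<And>n d d'. (\<lambda>z. M n z d d') holomorphic_on ball z0 r"
    and holL: "\<And>d d'. (\<lambda>z. L z d d') holomorphic_on ball z0 r"
    and lim: "\<And>K d d'. compact K \<Longrightarrow> K \<subseteq> ball z0 r \<Longrightarrow>
        uniform_limit K (\<lambda>n z. M n z d d') (\<lambda>z. L z d d') sequentially"
    and sing: "singular_on D (L z0)"
    and nonsing: "z1 \<in> ball z0 r" "\<not> singular_on D (L z1)"
  shows "\<exists>n. \<exists>z\<in>ball z0 r. singular_on D (M n z)"
proof (rule ccontr)
  assume none: "\<not> ?thesis"
  obtain f n where "bij_betw f {..<n::nat} D"
    using ex_bij_betw_nat_finite[OF \<open>finite D\<close>] by (auto simp: atLeast0LessThan)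
  note f = this and det_iff = det_eq_0_iff_singular_on[OF this]
  define F where "F m z = Determinant.det (Matrix.mat n n (\<lambda>(i, j). M m z (f i) (f j)))" for m z
  define g where "g z = Determinant.det (Matrix.mat n n (\<lambda>(i, j). L z (f i) (f j)))" for z
  have "g z0 \<noteq> 0"
  proof (rule Hurwitz_no_zeros[where S = "ball z0 r" and \<F> = F and g = g and ?z0.0 = z0])
    show "F m holomorphic_on ball z0 r" for m unfolding F_def by (rule holomorphic_on_det) (rule holM)
    show "g holomorphic_on ball z0 r" unfolding g_def by (rule holomorphic_on_det) (rule holL)
    show "uniform_limit K F g sequentially" if K: "compact K" "K \<subseteq> ball z0 r" for K
      unfolding F_def g_def
    proof (rule uniform_limit_det[where M = "\<lambda>m z i j. M m z (f i) (f j)"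
          and L = "\<lambda>z i j. L z (f i) (f j)"])
      show "bounded ((\<lambda>z. L z (f i) (f j)) ` K)" for i j
        using K holomorphic_on_imp_continuous_on[OF holL]
        by (intro compact_imp_bounded compact_continuous_image) (auto intro: continuous_on_subset)
    qed (rule lim[OF K])
    show "\<not> g constant_on ball z0 r"
    proof
      assume "g constant_on ball z0 r"
      then have "g z1 = g z0" using nonsing(1) \<open>0 < r\<close> by (auto simp: constant_on_def)
      then show False
        using sing nonsing(2) det_iff[of "L z0"] det_iff[of "L z1"] by (simp add: g_def)
    qed
    show "F m z \<noteq> 0" if "z \<in> ball z0 r" for m z
      using none that det_iff by (auto simp: F_def)
  qed (use \<open>0 < r\<close> in auto)
  then show False using sing det_iff[of "L z0"] by (simp add: g_def)
qed

section \<open>Recurrence of phases and compactness of amplitudes\<close>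

text \<open>
  Kronecker's theorem yields a time \<open>t\<close> at which all phases are close to their targets, but \<open>t\<close> may be
  negative or small. Dirichlet's theorem yields a positive multiple \<open>q R\<close> of a large \<open>R\<close> at which all
  phases are close to \<open>1\<close>; then \<open>t + q R\<close> is large and still hits the targets.
\<close>

lemma kronecker_recurrent_phases:
  assumes "finite E" and indep: "rationally_independent E len"
    and w: "\<And>e. e \<in> E \<Longrightarrow> cmod (w e) = 1"
  shows "\<exists>t. filterlim t at_top sequentially \<and>
     (\<forall>e\<in>E. (\<lambda>n. cis (t n * len e)) \<longlonglongrightarrow> w e)"
proof -
  obtain f n where f: "bij_betw f {..<n::nat} E"
    using ex_bij_betw_nat_finite[OF \<open>finite E\<close>] by (auto simp: atLeast0LessThan)
  define \<theta> where "\<theta> i = len (f i) / (2 * pi)" for i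
  define \<alpha> where "\<alpha> i = Arg (w (f i)) / (2 * pi)" for i
  have injlen: "inj_on len E"
  proof (rule inj_onI, rule ccontr)
    fix d e assume de: "d \<in> E" "e \<in> E" "len d = len e" "d \<noteq> e"
    let ?q = "(\<lambda>_. 0 :: rat)(d := 1, e := -1)"
    have "(\<Sum>c\<in>E. of_rat (?q c) * len c) = (\<Sum>c\<in>{d, e}. of_rat (?q c) * len c)"
      using de \<open>finite E\<close> by (intro sum.mono_neutral_right) auto
    also have "\<dots> = 0" using de by simp
    finally have "\<forall>c\<in>E. ?q c = 0" using indep unfolding rationally_independent_def by blast
    with de(2) show False by auto
  qed
  have inj\<theta>: "inj_on \<theta> {..<n}"
    using injlen f by (auto simp: \<theta>_def inj_on_def bij_betw_def)
  interpret Modules.module "(\<lambda>r. (*) (real_of_int r))"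
    by (simp add: Modules.module.intro distrib_left mult.commute)
  have indp: "independent (\<theta> ` {..<n})"
    unfolding independent_explicit_module
  proof (intro allI impI)
    fix S u v assume S: "finite S" "S \<subseteq> \<theta> ` {..<n}" "(\<Sum>v\<in>S. real_of_int (u v) * v) = 0" "v \<in> S"
    define q :: "_ \<Rightarrow> rat" where "q e = (if len e / (2 * pi) \<in> S then of_int (u (len e / (2 * pi))) else 0)" for e
    have "(\<Sum>e\<in>E. of_rat (q e) * len e) = (\<Sum>i<n. of_rat (q (f i)) * len (f i))"
      by (rule sum.reindex_bij_betw[OF f, symmetric])
    also have "\<dots> = (\<Sum>i<n. 2 * pi * (if \<theta> i \<in> S then u (\<theta> i) * \<theta> i else 0))"
      by (intro sum.cong) (auto simp: q_def \<theta>_def)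
    also have "\<dots> = 2 * pi * (\<Sum>v\<in>\<theta> ` {..<n}. if v \<in> S then u v * v else 0)"
      by (simp add: sum_distrib_left[symmetric] sum.reindex[OF inj\<theta>])
    also have "(\<Sum>v\<in>\<theta> ` {..<n}. if v \<in> S then u v * v else 0) = (\<Sum>v\<in>S. u v * v)"
      using S(2) by (intro sum.mono_neutral_cong_right) auto
    finally have "\<forall>e\<in>E. q e = 0" using indep S(3) unfolding rationally_independent_def by simp
    moreover obtain i where "i < n" "v = \<theta> i" using S(2,4) by auto
    moreover have "f i \<in> E" using f \<open>i < n\<close> by (auto simp: bij_betw_def)
    ultimately have "q (f i) = 0" by blast
    then show "u v = 0" using \<open>v = \<theta> i\<close> S(4) by (simp add: q_def \<theta>_def)
  qed
  have "\<exists>t m. t \<ge> real j \<and> (\<forall>i<n. \<bar>t * \<theta> i - of_int (m i) - \<alpha> i\<bar> < 2 / real (Suc j))" for j :: nat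
  proof -
    obtain t h where t: "\<And>i. i < n \<Longrightarrow> \<bar>t * \<theta> i - of_int (h i) - \<alpha> i\<bar> < 1 / real (Suc j)"
      using Kronecker_thm_1[OF indp inj\<theta>, of "1 / real (Suc j)"] by auto
    \<comment> \<open>any multiple \<open>q R\<close> with \<open>q \<ge> 1\<close> moves \<open>t\<close> beyond \<open>j\<close>\<close>
    define R where "R = \<bar>t\<bar> + real j"
    obtain q p where q: "0 < q" "\<And>i. i < n \<Longrightarrow> \<bar>of_int q * (R * \<theta> i) - of_int (p i)\<bar> < 1 / real (Suc j)"
      by (rule Dirichlet_approx_simult[of "Suc j" n "\<lambda>i. R * \<theta> i"]) (simp, blast)
    have "R * 1 \<le> R * of_int q" by (rule mult_left_mono) (use q(1) in \<open>auto simp: R_def\<close>)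
    then have "real j \<le> t + of_int q * R" by (simp add: R_def mult.commute)
    moreover have "\<bar>(t + of_int q * R) * \<theta> i - of_int (h i + p i) - \<alpha> i\<bar> < 2 / real (Suc j)"
      if "i < n" for i
    proof -
      have "(t + of_int q * R) * \<theta> i - of_int (h i + p i) - \<alpha> i =
         (t * \<theta> i - of_int (h i) - \<alpha> i) + (of_int q * (R * \<theta> i) - of_int (p i))"
        by (simp add: algebra_simps)
      moreover have "2 / real (Suc j) = 1 / real (Suc j) + 1 / real (Suc j)" by simp
      ultimately show ?thesis using t[OF that] q(2)[OF that] by linarith
    qed
    ultimately show ?thesis
      by (intro exI[of _ "t + of_int q * R"] exI[of _ "\<lambda>i. h i + p i"] conjI allI impI)
  qed
  then have "\<forall>j. \<exists>t m. t \<ge> real j \<and> (\<forall>i<n. \<bar>t * \<theta> i - of_int (m i) - \<alpha> i\<bar> < 2 / real (Suc j))"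
    by (rule allI)
  then have "\<exists>t m. \<forall>j. t j \<ge> real j \<and> (\<forall>i<n. \<bar>t j * \<theta> i - of_int (m j i) - \<alpha> i\<bar> < 2 / real (Suc j))"
    by (simp only: choice_iff)
  then obtain t m where t: "\<And>j. t j \<ge> real j"
    and m: "\<And>i j. i < n \<Longrightarrow> \<bar>t j * \<theta> i - of_int (m j i) - \<alpha> i\<bar> < 2 / real (Suc j)"
    by blast
  have "filterlim t at_top sequentially"
    by (rule filterlim_at_top_mono[OF filterlim_real_sequentially]) (simp add: t)
  moreover have "(\<lambda>j. cis (t j * len e)) \<longlonglongrightarrow> w e" if "e \<in> E" for e
  proof -
    obtain i where i: "i < n" "e = f i" using f \<open>e \<in> E\<close> by (auto simp: bij_betw_def)
    have lim: "(\<lambda>j. 2 / real (Suc j)) \<longlonglongrightarrow> 0"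
      using LIMSEQ_Suc[OF lim_const_over_n[of "2 :: real"]] by simp
    have "(\<lambda>j. t j * \<theta> i - of_int (m j i) - \<alpha> i) \<longlonglongrightarrow> 0"
      by (rule Lim_null_comparison[OF _ lim], rule always_eventually)
         (use m[OF i(1)] in \<open>simp add: less_imp_le del: of_nat_Suc\<close>)
    from tendsto_add[OF this tendsto_const[of "\<alpha> i"]]
    have "(\<lambda>j. t j * \<theta> i - of_int (m j i)) \<longlonglongrightarrow> \<alpha> i" by simp
    then have "(\<lambda>j. cis (2 * pi * (t j * \<theta> i - of_int (m j i)))) \<longlonglongrightarrow> cis (2 * pi * \<alpha> i)"
      by (intro tendsto_intros)
    moreover have "cis (2 * pi * (t j * \<theta> i - of_int (m j i))) = cis (t j * len e)" for j
    proof -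
      have "2 * pi * (t j * \<theta> i - of_int (m j i)) = t j * len e - 2 * pi * of_int (m j i)"
        by (simp add: i \<theta>_def field_simps)
      then have "cis (2 * pi * (t j * \<theta> i - of_int (m j i))) =
          cis (t j * len e) / cis (2 * pi * of_int (m j i))"
        by (simp only: cis_divide)
      also have "cis (2 * pi * of_int (m j i)) = 1" by (rule cis_multiple_2pi) simp
      finally show ?thesis by simp
    qed
    moreover have "cis (2 * pi * \<alpha> i) = w e"
      using w[OF \<open>e \<in> E\<close>] rcis_cmod_Arg[of "w e"] i by (simp add: \<alpha>_def rcis_def)
    ultimately show ?thesis by simp
  qed
  ultimately show ?thesis by blast
qed

lemma pointwise_convergent_subsequence:
  fixes b :: "nat \<Rightarrow> 'd \<Rightarrow> complex"
  assumes "finite D" "\<And>n d. d \<in> D \<Longrightarrow> cmod (b n d) \<le> B"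
  shows "\<exists>r l. strict_mono (r :: nat \<Rightarrow> nat) \<and> (\<forall>d\<in>D. (\<lambda>n. b (r n) d) \<longlonglongrightarrow> l d)"
  using assms
proof (induction D rule: finite_induct)
  case empty
  show ?case by (intro exI[of _ id]) (simp add: strict_mono_def)
next
  case (insert x D)
  then obtain r l where r: "strict_mono (r :: nat \<Rightarrow> nat)" "\<And>d. d \<in> D \<Longrightarrow> (\<lambda>n. b (r n) d) \<longlonglongrightarrow> l d"
    by (metis insertCI)
  have "\<forall>n. b (r n) x \<in> cball 0 B" using insert.prems by simp
  then obtain y s where s: "strict_mono (s :: nat \<Rightarrow> nat)" "((\<lambda>n. b (r n) x) \<circ> s) \<longlonglongrightarrow> y"
    using compact_cball[of "0 :: complex" B] unfolding compact_def by metis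
  have "(\<lambda>n. b ((r \<circ> s) n) d) \<longlonglongrightarrow> (l(x := y)) d" if "d \<in> insert x D" for d
  proof (cases "d = x")
    case True then show ?thesis using s(2) by (simp add: o_def)
  next
    case False
    then have "((\<lambda>n. b (r n) d) \<circ> s) \<longlonglongrightarrow> l d"
      using that by (intro LIMSEQ_subseq_LIMSEQ s(1) r(2)) auto
    with False show ?thesis by (simp add: o_def)
  qed
  with strict_mono_o[OF r(1) s(1)] show ?case by blast
qed

text \<open>
  The positive factors \<open>c n\<close> normalise the vectors to Euclidean length one, so that the limit cannot
  be zero.
\<close>

lemma normalized_convergent_subsequence:
  fixes a :: "nat \<Rightarrow> 'd \<Rightarrow> complex"
  assumes "finite D" and nz: "\<And>n. \<exists>d\<in>D. a n d \<noteq> 0"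
  shows "\<exists>r (c :: nat \<Rightarrow> real) l. strict_mono (r :: nat \<Rightarrow> nat) \<and> (\<forall>n. 0 < c n) \<and>
     (\<forall>d\<in>D. (\<lambda>n. of_real (c n) * a (r n) d) \<longlonglongrightarrow> l d) \<and> (\<exists>d\<in>D. l d \<noteq> 0)"
proof -
  define N where "N n = sqrt (\<Sum>d\<in>D. (cmod (a n d))\<^sup>2)" for n
  have N2: "(N n)\<^sup>2 = (\<Sum>d\<in>D. (cmod (a n d))\<^sup>2)" for n by (simp add: N_def sum_nonneg)
  have Npos: "N n > 0" for n
  proof -
    obtain d where "d \<in> D" "a n d \<noteq> 0" using nz by blast
    then have "0 < (\<Sum>d\<in>D. (cmod (a n d))\<^sup>2)" by (intro sum_pos2[OF \<open>finite D\<close>]) auto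
    then show ?thesis by (simp add: N_def)
  qed
  define b where "b n d = of_real (1 / N n) * a n d" for n d
  have bound: "cmod (b n d) \<le> 1" if "d \<in> D" for n d
  proof -
    have "(cmod (a n d))\<^sup>2 \<le> (N n)\<^sup>2" unfolding N2 using that \<open>finite D\<close> by (intro member_le_sum) auto
    then have "cmod (a n d) \<le> N n" using Npos[of n] by (simp add: power2_le_iff_abs_le)
    then show ?thesis using Npos[of n] by (simp add: b_def norm_mult norm_divide)
  qed
  from pointwise_convergent_subsequence[where b = b and B = 1, OF \<open>finite D\<close> bound] obtain r l where r: "strict_mono (r :: nat \<Rightarrow> nat)"
    and l: "\<And>d. d \<in> D \<Longrightarrow> (\<lambda>n. b (r n) d) \<longlonglongrightarrow> l d" by blast
  have "(\<Sum>d\<in>D. (cmod (b n d))\<^sup>2) = 1" for n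
  proof -
    have "(\<Sum>d\<in>D. (cmod (b n d))\<^sup>2) = (\<Sum>d\<in>D. (cmod (a n d))\<^sup>2) / (N n)\<^sup>2"
      using Npos[of n] by (simp add: b_def norm_mult norm_divide power_divide sum_divide_distrib)
    then show ?thesis unfolding N2[symmetric] using Npos[of n] by simp
  qed
  moreover have "(\<lambda>n. \<Sum>d\<in>D. (cmod (b (r n) d))\<^sup>2) \<longlonglongrightarrow> (\<Sum>d\<in>D. (cmod (l d))\<^sup>2)"
    by (intro tendsto_intros l)
  ultimately have "(\<Sum>d\<in>D. (cmod (l d))\<^sup>2) = 1" by (simp add: LIMSEQ_const_iff)
  then have "\<exists>d\<in>D. l d \<noteq> 0"
    by (metis (no_types, lifting) norm_zero power_zero_numeral sum.neutral zero_neq_one)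
  then show ?thesis
    using r l Npos unfolding b_def
    by (intro exI[of _ r] exI[of _ "\<lambda>n. 1 / N (r n)"] exI[of _ l]) simp
qed

section \<open>Waves on the two-way graph\<close>

definition flip :: "'e \<times> bool \<Rightarrow> 'e \<times> bool" where
  "flip d = (fst d, \<not> snd d)"

lemma flip_simps [simp]: "flip (flip d) = d" "fst (flip d) = fst d" "snd (flip d) = (\<not> snd d)"
    "flip d \<noteq> d" "flip (e, b) = (e, \<not> b)"
  by (auto simp: flip_def prod_eq_iff)

lemma flip_eq_flip_iff [simp]: "flip d = flip d' \<longleftrightarrow> d = d'"
  by (metis flip_simps(1))

lemma flip_eq_iff: "flip d = d' \<longleftrightarrow> d = flip d'"
  by (metis flip_simps(1))

lemma fst_eq_iff_flip: "fst d = fst d' \<longleftrightarrow> d = d' \<or> d = flip d'"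
  by (auto simp: flip_def prod_eq_iff)

lemma in_arcs_two_way [simp]: "d \<in> arcs (two_way G) \<longleftrightarrow> fst d \<in> arcs G"
  and verts_two_way [simp]: "verts (two_way G) = verts G"
  by (auto simp: two_way_def mem_Times_iff)

lemma tail_flip [simp]: "tail (two_way G) (flip d) = head (two_way G) d"
  and head_flip [simp]: "head (two_way G) (flip d) = tail (two_way G) d"
  by (auto simp: two_way_def flip_def split: prod.splits)

lemma tail_two_way: "tail (two_way G) (e, b) = (if b then tail G e else head G e)"
  by (simp add: two_way_def)

text \<open>
  The amplitude \<open>a d\<close> is that of the wave running along the arc \<open>d\<close>, measured where it starts. The wave
  running in the opposite direction arrives there with amplitude \<open>w (fst d) * a (flip d)\<close>, where \<open>w e\<close>
  is the phase acquired along the edge \<open>e\<close>. So the function has the sum of the two amplitudes as its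
  value at the start of \<open>d\<close>, and their difference as its outward derivative, up to the factor \<open>\<i> k\<close>.
\<close>

definition kirchhoff_wave ::
  "('v, 'e) pre_digraph \<Rightarrow> ('e \<Rightarrow> complex) \<Rightarrow> ('e \<times> bool \<Rightarrow> complex) \<Rightarrow> bool" where
  "kirchhoff_wave G w a \<longleftrightarrow> (\<forall>v\<in>verts G.
     (\<exists>c. \<forall>d\<in>out_arcs (two_way G) v. a d + w (fst d) * a (flip d) = c) \<and>
     (\<Sum>d\<in>out_arcs (two_way G) v. a d - w (fst d) * a (flip d)) = 0)"

context fin_digraph
begin

abbreviation "G2 \<equiv> two_way G"

lemma finite_arcs_two_way: "finite (arcs G2)"
  by (simp add: two_way_def)

lemma finite_out_arcs_two_way: "finite (out_arcs G2 v)"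
  by (rule finite_subset[OF _ finite_arcs_two_way]) auto

lemma tail_two_way_in_verts: "fst d \<in> arcs G \<Longrightarrow> tail G2 d \<in> verts G"
  by (cases d) (auto simp: tail_two_way)

lemma sum_out_arcs_two_way:
  "(\<Sum>v\<in>verts G. \<Sum>d\<in>out_arcs G2 v. f d) = (\<Sum>d\<in>arcs G2. f d)"
  unfolding out_arcs_def
  by (rule sum.group) (auto simp: finite_arcs_two_way intro: tail_two_way_in_verts)

lemma sum_flip: "(\<Sum>d\<in>arcs G2. f (flip d)) = (\<Sum>d\<in>arcs G2. f d)"
  by (rule sum.reindex_bij_witness[of _ flip flip]) auto

lemma out_arcs_two_way_eq:
  "out_arcs G2 v = (\<lambda>e. (e, True)) ` out_arcs G v \<union> (\<lambda>e. (e, False)) ` in_arcs G v"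
  by (auto simp: two_way_def image_iff split: if_splits)

lemma sum_out_arcs_two_way_eq:
  "(\<Sum>d\<in>out_arcs G2 v. f d) = (\<Sum>e\<in>out_arcs G v. f (e, True)) + (\<Sum>e\<in>in_arcs G v. f (e, False))"
  unfolding out_arcs_two_way_eq
  by (subst sum.union_disjoint) (auto simp: sum.reindex inj_on_def)

lemma exterior_iff_card: "exterior G v \<longleftrightarrow> v \<in> verts G \<and> card (out_arcs G2 v) = 1"
  using sum_out_arcs_two_way_eq[of "\<lambda>_. 1 :: nat" v]
  by (simp add: exterior_def in_degree_def out_degree_def add.commute)

text \<open>
  At a vertex, let \<open>p\<close>, \<open>p'\<close> be the outgoing and \<open>q\<close>, \<open>q'\<close> the incoming amplitudes. By polarisation
  \<open>2 (p cnj p' - q cnj q') = (p - q) cnj (p' + q') + (p + q) cnj (p' - q')\<close>. In each product one factor is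
  the same for all arcs leaving the vertex, and the other one has sum zero over them. Every amplitude
  is outgoing at one vertex and, multiplied by a phase, incoming at one vertex.
\<close>

lemma kirchhoff_wave_product:
  assumes "kirchhoff_wave G w a" "kirchhoff_wave G w' a'"
  shows "(\<Sum>d\<in>arcs G2. a d * cnj (a' d)) =
    (\<Sum>d\<in>arcs G2. w (fst d) * cnj (w' (fst d)) * (a d * cnj (a' d)))"
proof -
  let ?q = "\<lambda>d. w (fst d) * a (flip d)" and ?q' = "\<lambda>d. w' (fst d) * a' (flip d)"
  have local: "(\<Sum>d\<in>out_arcs G2 v. a d * cnj (a' d)) =
      (\<Sum>d\<in>out_arcs G2 v. ?q d * cnj (?q' d))" if "v \<in> verts G" for v
  proof -
    let ?O = "out_arcs G2 v"
    obtain c c' where c: "\<And>d. d \<in> ?O \<Longrightarrow> a d + ?q d = c" "\<And>d. d \<in> ?O \<Longrightarrow> a' d + ?q' d = c'"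
      and flux: "(\<Sum>d\<in>?O. a d - ?q d) = 0" "(\<Sum>d\<in>?O. a' d - ?q' d) = 0"
      using assms \<open>v \<in> verts G\<close> unfolding kirchhoff_wave_def by meson
    have "2 * ((\<Sum>d\<in>?O. a d * cnj (a' d)) - (\<Sum>d\<in>?O. ?q d * cnj (?q' d))) =
        (\<Sum>d\<in>?O. (a d - ?q d) * cnj (a' d + ?q' d) + (a d + ?q d) * cnj (a' d - ?q' d))"
      by (simp add: sum_distrib_left sum_subtractf[symmetric] algebra_simps)
    also have "\<dots> = (\<Sum>d\<in>?O. (a d - ?q d) * cnj c' + c * cnj (a' d - ?q' d))"
      by (intro sum.cong refl) (simp only: c)
    also have "\<dots> = (\<Sum>d\<in>?O. a d - ?q d) * cnj c' + c * cnj (\<Sum>d\<in>?O. a' d - ?q' d)"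
      by (simp only: sum.distrib sum_distrib_left sum_distrib_right cnj_sum)
    also have "\<dots> = 0" unfolding flux by simp
    finally show ?thesis by simp
  qed
  have "(\<Sum>d\<in>arcs G2. a d * cnj (a' d)) = (\<Sum>d\<in>arcs G2. ?q d * cnj (?q' d))"
    unfolding sum_out_arcs_two_way[symmetric] by (intro sum.cong refl local)
  also have "\<dots> = (\<Sum>d\<in>arcs G2. w (fst d) * cnj (w' (fst d)) * (a d * cnj (a' d)))"
    by (subst sum_flip[symmetric]) (simp add: mult_ac)
  finally show ?thesis .
qed

text \<open>
  The case of equal phases and amplitudes: vertices scatter waves without loss of energy.
\<close>

lemma kirchhoff_wave_energy:
  assumes "kirchhoff_wave G w a"
  shows "(\<Sum>d\<in>arcs G2. (1 - (cmod (w (fst d)))\<^sup>2) * (cmod (a d))\<^sup>2) = 0"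
proof -
  have "complex_of_real (\<Sum>d\<in>arcs G2. (1 - (cmod (w (fst d)))\<^sup>2) * (cmod (a d))\<^sup>2) =
      (\<Sum>d\<in>arcs G2. a d * cnj (a d)) -
      (\<Sum>d\<in>arcs G2. w (fst d) * cnj (w (fst d)) * (a d * cnj (a d)))"
    by (simp add: complex_norm_square[symmetric] sum_subtractf[symmetric] algebra_simps)
  also have "\<dots> = 0" using kirchhoff_wave_product[OF assms assms] by simp
  finally show ?thesis by (simp only: of_real_eq_0_iff)
qed

text \<open>
  If all edges damp waves, or all amplify them, then conservation of energy at the vertices leaves
  only the zero wave.
\<close>

lemma kirchhoff_wave_eq_0:
  assumes "kirchhoff_wave G w a" "d \<in> arcs G2"
    and "(\<forall>e\<in>arcs G. cmod (w e) < 1) \<or> (\<forall>e\<in>arcs G. 1 < cmod (w e))"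
  shows "a d = 0"
proof -
  let ?t = "\<lambda>d. (1 - (cmod (w (fst d)))\<^sup>2) * (cmod (a d))\<^sup>2"
  show ?thesis
  proof (rule ccontr)
    assume "a d \<noteq> 0"
    from assms(3) show False
    proof
      assume lt: "\<forall>e\<in>arcs G. cmod (w e) < 1"
      then have "0 < 1 - (cmod (w (fst d)))\<^sup>2" if "d \<in> arcs G2" for d
        using that by (simp add: abs_square_less_1)
      then have "0 < ?t d" and "\<And>d. d \<in> arcs G2 \<Longrightarrow> 0 \<le> ?t d"
        using \<open>a d \<noteq> 0\<close> assms(2) by (simp, meson less_imp_le mult_nonneg_nonneg zero_le_power2)
      then have "0 < (\<Sum>d\<in>arcs G2. ?t d)"
        using assms(2) by (intro sum_pos2[OF finite_arcs_two_way])
      then show False using kirchhoff_wave_energy[OF assms(1)] by simp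
    next
      assume gt: "\<forall>e\<in>arcs G. 1 < cmod (w e)"
      then have "1 - (cmod (w (fst d)))\<^sup>2 < 0" if "d \<in> arcs G2" for d
        using that by (simp add: one_less_power)
      then have "0 < - ?t d" and "\<And>d. d \<in> arcs G2 \<Longrightarrow> 0 \<le> - ?t d"
        using \<open>a d \<noteq> 0\<close> assms(2)
        by (simp add: mult_neg_pos, meson less_imp_le mult_nonpos_nonneg neg_0_le_iff_le zero_le_power2)
      then have "0 < (\<Sum>d\<in>arcs G2. - ?t d)"
        using assms(2) by (intro sum_pos2[OF finite_arcs_two_way])
      then show False using kirchhoff_wave_energy[OF assms(1)] by (simp add: sum_negf)
    qed
  qed
qed

lemma kirchhoff_wave_limit:
  assumes "\<And>n. kirchhoff_wave G (w n) (a n)"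
    and w: "\<And>e. e \<in> arcs G \<Longrightarrow> (\<lambda>n. w n e) \<longlonglongrightarrow> w' e"
    and a: "\<And>d. d \<in> arcs G2 \<Longrightarrow> (\<lambda>n. a n d) \<longlonglongrightarrow> a' d"
  shows "kirchhoff_wave G w' a'"
  unfolding kirchhoff_wave_def
proof (intro ballI conjI)
  fix v assume v: "v \<in> verts G"
  let ?O = "out_arcs G2 v"
  have q: "(\<lambda>n. w n (fst d) * a n (flip d)) \<longlonglongrightarrow> w' (fst d) * a' (flip d)"
    and p: "(\<lambda>n. a n d) \<longlonglongrightarrow> a' d" if "d \<in> ?O" for d
    using that by (auto intro!: tendsto_mult w a)
  have val: "a' d + w' (fst d) * a' (flip d) = a' d' + w' (fst d') * a' (flip d')"
    if "d \<in> ?O" "d' \<in> ?O" for d d'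
  proof (rule LIMSEQ_unique)
    show "(\<lambda>n. a n d + w n (fst d) * a n (flip d)) \<longlonglongrightarrow> a' d + w' (fst d) * a' (flip d)"
      by (intro tendsto_add p q that)
    have "a n d + w n (fst d) * a n (flip d) = a n d' + w n (fst d') * a n (flip d')" for n
      using assms(1)[of n] v that unfolding kirchhoff_wave_def by metis
    then show "(\<lambda>n. a n d + w n (fst d) * a n (flip d)) \<longlonglongrightarrow> a' d' + w' (fst d') * a' (flip d')"
      using tendsto_add[OF p[OF that(2)] q[OF that(2)]] by simp
  qed
  then show "\<exists>c. \<forall>d\<in>?O. a' d + w' (fst d) * a' (flip d) = c" by blast
  show "(\<Sum>d\<in>?O. a' d - w' (fst d) * a' (flip d)) = 0"
  proof (rule LIMSEQ_unique)
    show "(\<lambda>n. \<Sum>d\<in>?O. a n d - w n (fst d) * a n (flip d)) \<longlonglongrightarrow> (\<Sum>d\<in>?O. a' d - w' (fst d) * a' (flip d))"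
      by (intro tendsto_sum tendsto_diff p q)
    show "(\<lambda>n. \<Sum>d\<in>?O. a n d - w n (fst d) * a n (flip d)) \<longlonglongrightarrow> 0"
      using assms(1) v by (simp add: kirchhoff_wave_def)
  qed
qed

text \<open>
  Suppose that only one arc \<open>d\<close> leaving a vertex carries amplitude, and that some further arc leaves it.
  The value at the vertex is zero because of the further arc, and the derivative along \<open>d\<close> is zero
  because it is the only summand of the flux. Value and derivative together determine the amplitudes.
\<close>

lemma kirchhoff_wave_no_dead_end:
  assumes wave: "kirchhoff_wave G w a" and w: "\<And>e. e \<in> arcs G \<Longrightarrow> w e \<noteq> 0"
    and d: "d \<in> arcs G2" "a d \<noteq> 0 \<or> a (flip d) \<noteq> 0"
    and v: "tail G2 d = v" "\<not> exterior G v"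
  obtains d' where "d' \<in> out_arcs G2 v" "d' \<noteq> d" "a d' \<noteq> 0 \<or> a (flip d') \<noteq> 0"
proof (rule ccontr)
  let ?O = "out_arcs G2 v"
  assume no: "\<not> thesis"
  note found = that
  have zero: "a d' = 0" "a (flip d') = 0" if "d' \<in> ?O" "d' \<noteq> d" for d'
    using no found[OF that] by blast+
  have vG: "v \<in> verts G" using d(1) v(1) tail_two_way_in_verts[of d] by simp
  have dO: "d \<in> ?O" using d(1) v(1) by simp
  have "card ?O \<noteq> 1" using v(2) vG exterior_iff_card by simp
  then obtain d' where d': "d' \<in> ?O" "d' \<noteq> d"
    using dO by (metis is_singletonI' is_singleton_altdef empty_iff)
  have "a d + w (fst d) * a (flip d) = a d' + w (fst d') * a (flip d')"
    using wave vG dO d'(1) unfolding kirchhoff_wave_def by metis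
  then have val: "a d + w (fst d) * a (flip d) = 0" using zero[OF d'] by simp
  have "0 = (\<Sum>d\<in>?O. a d - w (fst d) * a (flip d))"
    using wave vG by (simp add: kirchhoff_wave_def)
  also have "\<dots> = a d - w (fst d) * a (flip d)"
    using zero by (subst sum.remove[OF finite_out_arcs_two_way dO]) (simp add: sum.neutral)
  finally have "a d = w (fst d) * a (flip d)" by simp
  with val have "a d = 0" "w (fst d) * a (flip d) = 0" by auto
  with w[of "fst d"] d show False by simp
qed

text \<open>
  Choose the same phase \<open>\<zeta>\<close> on all edges outside \<open>P\<close>. Solutions for different \<open>\<zeta>\<close> have orthogonal
  restrictions to the complement of \<open>P\<close>, so there cannot be infinitely many \<open>\<zeta>\<close> with a solution that
  does not vanish there: normalised, these restrictions would form an infinite orthonormal system,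
  whereas a limit along a subsequence would be nonzero and orthogonal to itself.
\<close>

lemma exists_phases_confining_waves:
  assumes "\<And>e. e \<in> P \<Longrightarrow> cmod (w0 e) = 1"
  shows "\<exists>w. (\<forall>e. cmod (w e) = 1) \<and> (\<forall>e\<in>P. w e = w0 e) \<and>
     (\<forall>a. kirchhoff_wave G w a \<longrightarrow> (\<forall>d\<in>arcs G2. fst d \<notin> P \<longrightarrow> a d = 0))"
proof (rule ccontr)
  assume none: "\<not> ?thesis"
  \<comment> \<open>a sequence of pairwise different values of \<open>\<zeta>\<close>; the angles stay in an interval shorter than \<open>2 \<pi>\<close>\<close>
  define W where "W n e = (if e \<in> P then w0 e else cis (1 / real (Suc n)))" for n :: nat and e
  define D where "D = {d \<in> arcs G2. fst d \<notin> P}"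
  have finD: "finite D"
    by (rule finite_subset[OF _ finite_arcs_two_way]) (auto simp: D_def)
  have W1: "(\<forall>e. cmod (W n e) = 1) \<and> (\<forall>e\<in>P. W n e = w0 e)" for n
    using assms by (simp add: W_def)
  have "\<forall>n. \<exists>a. kirchhoff_wave G (W n) a \<and> (\<exists>d\<in>D. a d \<noteq> 0)"
  proof (rule allI, goal_cases)
    case (1 n)
    show ?case using none W1[of n] unfolding D_def mem_Collect_eq by blast
  qed
  from choice[OF this] obtain a
    where a: "\<And>n. kirchhoff_wave G (W n) (a n)" "\<And>n. \<exists>d\<in>D. a n d \<noteq> 0" by blast
  have orth: "(\<Sum>d\<in>D. a m d * cnj (a n d)) = 0" if "m \<noteq> n" for m n
  proof -
    let ?z = "1 - cis (1 / real (Suc m)) * cnj (cis (1 / real (Suc n)))"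
    have "0 = (\<Sum>d\<in>arcs G2. (1 - W m (fst d) * cnj (W n (fst d))) * (a m d * cnj (a n d)))"
      using kirchhoff_wave_product[OF a(1)[of m] a(1)[of n]]
      by (simp add: left_diff_distrib sum_subtractf)
    also have "\<dots> = (\<Sum>d\<in>D. ?z * (a m d * cnj (a n d)))"
      using assms by (intro sum.mono_neutral_cong_right finite_arcs_two_way)
        (auto simp: D_def W_def complex_norm_square[symmetric])
    also have "\<dots> = ?z * (\<Sum>d\<in>D. a m d * cnj (a n d))" by (simp add: sum_distrib_left)
    finally have "?z = 0 \<or> (\<Sum>d\<in>D. a m d * cnj (a n d)) = 0" by simp
    moreover have "?z \<noteq> 0"
    proof
      assume "?z = 0"
      then have "cis (1 / real (Suc m) - 1 / real (Suc n)) = 1"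
        by (simp add: cis_cnj cis_mult del: of_nat_Suc)
      then have "cos (1 / real (Suc m) - 1 / real (Suc n)) = 1" by (simp add: complex_eq_iff del: of_nat_Suc)
      then obtain i :: int where "1 / real (Suc m) - 1 / real (Suc n) = of_int i * 2 * pi"
        by (auto simp: cos_one_2pi_int)
      moreover have "\<bar>1 / real (Suc m) - 1 / real (Suc n)\<bar> < 2"
      proof -
        have "0 < 1 / real (Suc k)" "1 / real (Suc k) \<le> 1" for k by auto
        from this(1)[of m] this(2)[of m] this(1)[of n] this(2)[of n] show ?thesis by linarith
      qed
      moreover have "\<bar>of_int i * 2 * pi\<bar> = \<bar>of_int i\<bar> * (2 * pi)" by (simp add: abs_mult)
      ultimately have "\<bar>of_int i\<bar> * (2 * pi) < 1 * (2 * pi)"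
        using pi_gt3 by linarith
      then have "\<bar>of_int i :: real\<bar> < 1"
        using mult_right_less_imp_less[of "\<bar>of_int i :: real\<bar>" "2 * pi" 1] pi_gt_zero by fastforce
      then have "i = 0" by linarith
      with \<open>1 / real (Suc m) - 1 / real (Suc n) = of_int i * 2 * pi\<close> have "inverse (real (Suc m)) = inverse (real (Suc n))"
        by (simp add: inverse_eq_divide)
      then show False using \<open>m \<noteq> n\<close> by simp
    qed
    ultimately show ?thesis by blast
  qed
  obtain r :: "nat \<Rightarrow> nat" and c :: "nat \<Rightarrow> real" and l where r: "strict_mono r"
    and l: "\<And>d. d \<in> D \<Longrightarrow> (\<lambda>n. of_real (c n) * a (r n) d) \<longlonglongrightarrow> l d" "\<exists>d\<in>D. l d \<noteq> 0"
    using normalized_convergent_subsequence[where a = a, OF finD a(2)] by blast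
  have "(\<lambda>n. \<Sum>d\<in>D. (of_real (c n) * a (r n) d) * cnj (of_real (c (Suc n)) * a (r (Suc n)) d))
      \<longlonglongrightarrow> (\<Sum>d\<in>D. l d * cnj (l d))"
    by (intro tendsto_sum tendsto_mult tendsto_cnj LIMSEQ_Suc[OF l(1)] l(1))
  moreover have "(\<Sum>d\<in>D. (of_real (c n) * a (r n) d) * cnj (of_real (c (Suc n)) * a (r (Suc n)) d)) = 0" for n
  proof -
    have "(\<Sum>d\<in>D. (of_real (c n) * a (r n) d) * cnj (of_real (c (Suc n)) * a (r (Suc n)) d)) =
        of_real (c n * c (Suc n)) * (\<Sum>d\<in>D. a (r n) d * cnj (a (r (Suc n)) d))"
      by (simp add: sum_distrib_left mult_ac)
    also have "\<dots> = 0" using r orth[of "r n" "r (Suc n)"] by (simp add: strict_mono_eq)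
    finally show ?thesis .
  qed
  ultimately have "(\<Sum>d\<in>D. l d * cnj (l d)) = 0" by (simp add: LIMSEQ_const_iff)
  then have "of_real (\<Sum>d\<in>D. (cmod (l d))\<^sup>2) = (0 :: complex)"
    by (simp only: complex_norm_square of_real_sum)
  then have "(\<Sum>d\<in>D. (cmod (l d))\<^sup>2) = 0" by (simp only: of_real_eq_0_iff)
  then have "\<forall>d\<in>D. (cmod (l d))\<^sup>2 = 0"
    using finD by (subst (asm) sum_nonneg_eq_0_iff) auto
  then show False using l(2) by auto
qed

end

text \<open>
  At a vertex of degree \<open>n\<close> the conditions of \<open>kirchhoff_wave\<close> are \<open>n - 1\<close> equations of continuity and one
  for the flux. They are equivalent to \<open>n\<close> equations, one for each outgoing arc, which say that the
  value at the start of the arc is \<open>2 / n\<close> times the sum of the amplitudes arriving at the vertex.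
  This makes the system square, with rows and columns indexed by the arcs.
\<close>

definition wave_matrix :: "('v, 'e) pre_digraph \<Rightarrow> ('e \<Rightarrow> complex) \<Rightarrow> 'e \<times> bool \<Rightarrow> 'e \<times> bool \<Rightarrow> complex" where
  "wave_matrix G w d d' = of_bool (d' = d) + of_bool (d' = flip d) * w (fst d) -
     of_bool (head (two_way G) d' = tail (two_way G) d) *
       (2 / of_nat (card (out_arcs (two_way G) (tail (two_way G) d)))) * w (fst d')"

context fin_digraph
begin

lemma wave_matrix_mult:
  assumes "d \<in> arcs G2"
  shows "(\<Sum>d'\<in>arcs G2. wave_matrix G w d d' * a d') =
     a d + w (fst d) * a (flip d) -
     2 / of_nat (card (out_arcs G2 (tail G2 d))) *
       (\<Sum>d'\<in>out_arcs G2 (tail G2 d). w (fst d') * a (flip d'))"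
proof -
  let ?D = "arcs G2" and ?v = "tail G2 d"
  let ?c = "2 / of_nat (card (out_arcs G2 ?v)) :: complex"
  have "(\<Sum>d'\<in>out_arcs G2 ?v. w (fst d') * a (flip d')) =
      (\<Sum>d'\<in>?D. of_bool (tail G2 d' = ?v) * (w (fst d') * a (flip d')))"
    by (intro sum.mono_neutral_cong_left finite_arcs_two_way) auto
  also have "\<dots> = (\<Sum>d'\<in>?D. of_bool (head G2 d' = ?v) * (w (fst d') * a d'))"
    by (subst sum_flip[symmetric]) simp
  finally have *: "(\<Sum>d'\<in>out_arcs G2 ?v. w (fst d') * a (flip d')) = \<dots>" .
  have "(\<Sum>d'\<in>?D. wave_matrix G w d d' * a d') =
      (\<Sum>d'\<in>?D. of_bool (d' = d) * a d') + (\<Sum>d'\<in>?D. of_bool (d' = flip d) * (w (fst d) * a d')) -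
      ?c * (\<Sum>d'\<in>?D. of_bool (head G2 d' = ?v) * (w (fst d') * a d'))"
    by (simp add: wave_matrix_def algebra_simps sum.distrib sum_subtractf sum_distrib_left
       )
  also have "(\<Sum>d'\<in>?D. of_bool (d' = d) * a d') = a d"
    using assms finite_arcs_two_way by (simp add: of_bool_def if_distrib[of "\<lambda>x. x * _"] sum.delta cong: if_cong)
  also have "(\<Sum>d'\<in>?D. of_bool (d' = flip d) * (w (fst d) * a d')) = w (fst d) * a (flip d)"
    using assms finite_arcs_two_way by (simp add: of_bool_def if_distrib[of "\<lambda>x. x * _"] sum.delta cong: if_cong)
  finally show ?thesis using * by simp
qed

lemma kirchhoff_wave_iff_wave_matrix:
  "kirchhoff_wave G w a \<longleftrightarrow>
     (\<forall>d\<in>arcs G2. (\<Sum>d'\<in>arcs G2. wave_matrix G w d d' * a d') = 0)"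
proof -
  let ?O = "\<lambda>v. out_arcs G2 v"
  let ?p = "\<lambda>d. a d" and ?q = "\<lambda>d. w (fst d) * a (flip d)"
  have vertex: "(\<exists>c. \<forall>d\<in>?O v. ?p d + ?q d = c) \<and> (\<Sum>d\<in>?O v. ?p d - ?q d) = 0 \<longleftrightarrow>
      (\<forall>d\<in>?O v. ?p d + ?q d - 2 / of_nat (card (?O v)) * (\<Sum>d\<in>?O v. ?q d) = 0)" (is "?L \<longleftrightarrow> ?R") for v
  proof (cases "?O v = {}")
    case False
    then have card: "of_nat (card (?O v)) \<noteq> (0 :: complex)"
      using finite_out_arcs_two_way by simp
    have split: "(\<Sum>d\<in>?O v. ?p d + ?q d) = (\<Sum>d\<in>?O v. ?p d - ?q d) + 2 * (\<Sum>d\<in>?O v. ?q d)"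
      by (simp add: sum.distrib sum_subtractf)
    show ?thesis
    proof
      assume ?L
      then obtain c where c: "\<And>d. d \<in> ?O v \<Longrightarrow> ?p d + ?q d = c" and flux: "(\<Sum>d\<in>?O v. ?p d - ?q d) = 0"
        by blast
      have "of_nat (card (?O v)) * c = 2 * (\<Sum>d\<in>?O v. ?q d)"
        using split flux c by simp
      then show ?R using c card by (simp add: field_simps)
    next
      assume R: ?R
      then have c: "?p d + ?q d = 2 / of_nat (card (?O v)) * (\<Sum>d\<in>?O v. ?q d)" if "d \<in> ?O v" for d
        using that by simp
      then have "(\<Sum>d\<in>?O v. ?p d + ?q d) = 2 * (\<Sum>d\<in>?O v. ?q d)"
        using card by simp
      then have "(\<Sum>d\<in>?O v. ?p d - ?q d) = 0" using split by simp
      with c show ?L by blast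
    qed
  qed simp
  show ?thesis
    unfolding kirchhoff_wave_def vertex
  proof
    assume R: "\<forall>v\<in>verts G. \<forall>d\<in>?O v. ?p d + ?q d - 2 / of_nat (card (?O v)) * (\<Sum>d\<in>?O v. ?q d) = 0"
    show "\<forall>d\<in>arcs G2. (\<Sum>d'\<in>arcs G2. wave_matrix G w d d' * a d') = 0"
    proof
      fix d assume d: "d \<in> arcs G2"
      then have "tail G2 d \<in> verts G" "d \<in> ?O (tail G2 d)"
        using tail_two_way_in_verts[of d] by simp_all
      with R show "(\<Sum>d'\<in>arcs G2. wave_matrix G w d d' * a d') = 0"
        unfolding wave_matrix_mult[OF d] by blast
    qed
  next
    assume L: "\<forall>d\<in>arcs G2. (\<Sum>d'\<in>arcs G2. wave_matrix G w d d' * a d') = 0"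
    show "\<forall>v\<in>verts G. \<forall>d\<in>?O v. ?p d + ?q d - 2 / of_nat (card (?O v)) * (\<Sum>d\<in>?O v. ?q d) = 0"
    proof (intro ballI)
      fix v d assume "d \<in> ?O v"
      then have d: "d \<in> arcs G2" and v: "v = tail G2 d" by simp_all
      show "?p d + ?q d - 2 / of_nat (card (?O v)) * (\<Sum>d\<in>?O v. ?q d) = 0"
        using L d unfolding v wave_matrix_mult[OF d, symmetric] by blast
    qed
  qed
qed

lemma singular_on_wave_matrix_iff:
  "singular_on (arcs G2) (wave_matrix G w) \<longleftrightarrow>
     (\<exists>a. kirchhoff_wave G w a \<and> (\<exists>d\<in>arcs G2. a d \<noteq> 0))"
  unfolding singular_on_def kirchhoff_wave_iff_wave_matrix by blast

lemma kirchhoff_wave_cong: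
  assumes "\<And>e. e \<in> arcs G \<Longrightarrow> w e = w' e"
  shows "kirchhoff_wave G w a \<longleftrightarrow> kirchhoff_wave G w' a"
proof -
  have "wave_matrix G w d d' = wave_matrix G w' d d'"
    if "d \<in> arcs G2" "d' \<in> arcs G2" for d d'
    using assms that by (simp add: wave_matrix_def)
  then show ?thesis unfolding kirchhoff_wave_iff_wave_matrix by simp
qed

end

locale metric_digraph = fin_digraph G for G :: "('v, 'e) pre_digraph" +
  fixes len :: "'e \<Rightarrow> real"
  assumes len_pos: "e \<in> arcs G \<Longrightarrow> 0 < len e"

context metric_digraph
begin

text \<open>
  The matrix with phases \<open>cis (t n * len e) * exp (\<i> z len e)\<close> describes waves of complex frequency
  \<open>t n + z\<close>. For nonreal \<open>z\<close> all phases have modulus less than one, or all have modulus greater than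
  one, so the matrix is regular. This provides the regular point for Hurwitz's theorem, and it shows
  that the singular points found by that theorem are real.
\<close>

lemma kirchhoff_wave_near_phases:
  assumes w: "\<And>e. e \<in> arcs G \<Longrightarrow> cmod (w e) = 1"
    and t: "\<And>e. e \<in> arcs G \<Longrightarrow> (\<lambda>n. cis (t n * len e)) \<longlonglongrightarrow> w e"
    and X: "kirchhoff_wave G w X" "d0 \<in> arcs G2" "X d0 \<noteq> 0"
    and "0 < r"
  shows "\<exists>n k a. \<bar>k - t n\<bar> < r \<and> kirchhoff_wave G (\<lambda>e. cis (k * len e)) a \<and>
     (\<exists>d\<in>arcs G2. a d \<noteq> 0)"
proof -
  let ?D = "arcs G2"
  \<comment> \<open>the value \<open>0\<close> off the graph gives entries that converge for all indices\<close>
  define W where "W n z e = (if e \<in> arcs G then cis (t n * len e) * exp (\<i> * z * of_real (len e)) else 0)" for n z e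
  define W' where "W' z e = (if e \<in> arcs G then w e * exp (\<i> * z * of_real (len e)) else 0)" for z e
  have mod_exp: "cmod (exp (\<i> * z * of_real (len e))) = exp (- Im z * len e)" for z e
    by (simp add: norm_exp_eq_Re)
  have offaxis: "(\<forall>e\<in>arcs G. cmod (exp (\<i> * z * of_real (len e))) < 1) \<or>
      (\<forall>e\<in>arcs G. 1 < cmod (exp (\<i> * z * of_real (len e))))" if "Im z \<noteq> 0" for z
    using that len_pos unfolding mod_exp by (cases "Im z > 0") (auto simp: mult_neg_pos)
  have "\<exists>n. \<exists>z\<in>ball 0 r. singular_on ?D (wave_matrix G (W n z))"
  proof (rule singular_on_near_limit[OF finite_arcs_two_way \<open>0 < r\<close>])
    show "(\<lambda>z. wave_matrix G (W n z) d d') holomorphic_on ball 0 r" for n d d'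
      unfolding wave_matrix_def W_def
      by (cases "fst d \<in> arcs G"; cases "fst d' \<in> arcs G") (auto intro!: holomorphic_intros)
    show "(\<lambda>z. wave_matrix G (W' z) d d') holomorphic_on ball 0 r" for d d'
      unfolding wave_matrix_def W'_def
      by (cases "fst d \<in> arcs G"; cases "fst d' \<in> arcs G") (auto intro!: holomorphic_intros)
    show "uniform_limit K (\<lambda>n z. wave_matrix G (W n z) d d') (\<lambda>z. wave_matrix G (W' z) d d') sequentially"
      if K: "compact K" for K d d'
    proof -
      have lim: "uniform_limit K (\<lambda>n z. W n z e) (\<lambda>z. W' z e) sequentially" for e
      proof (cases "e \<in> arcs G")
        case True
        have "bounded ((\<lambda>z. exp (\<i> * z * of_real (len e))) ` K)"
          using K by (intro compact_imp_bounded compact_continuous_image continuous_intros)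
        moreover have "uniform_limit K (\<lambda>n z. cis (t n * len e)) (\<lambda>z. w e) sequentially"
          using t[OF True] by (auto simp: uniform_limit_iff tendsto_iff elim!: eventually_mono)
        ultimately show ?thesis
          using True unfolding W_def W'_def
          by (auto intro!: uniform_lim_mult uniform_limit_const simp: image_constant_conv)
      qed (simp add: W_def W'_def uniform_limit_const)
      show ?thesis
        unfolding wave_matrix_def
        by (intro uniform_limit_intros bounded_linear.uniform_limit[OF bounded_linear_mult_right] lim)
    qed
    have "kirchhoff_wave G (W' 0) X" using X(1) by (subst kirchhoff_wave_cong[of _ w]) (auto simp: W'_def)
    then show "singular_on ?D (wave_matrix G (W' 0))"
      unfolding singular_on_wave_matrix_iff using X(2,3) by blast
    show "\<i> * of_real (r / 2) \<in> ball 0 r" using \<open>0 < r\<close> by (simp add: norm_mult)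
    show "\<not> singular_on ?D (wave_matrix G (W' (\<i> * of_real (r / 2))))"
    proof -
      let ?z = "\<i> * of_real (r / 2) :: complex"
      have "Im ?z \<noteq> 0" using \<open>0 < r\<close> by simp
      from offaxis[OF this] have "(\<forall>e\<in>arcs G. cmod (W' ?z e) < 1) \<or> (\<forall>e\<in>arcs G. 1 < cmod (W' ?z e))"
        using w by (simp add: W'_def norm_mult)
      then show ?thesis unfolding singular_on_wave_matrix_iff using kirchhoff_wave_eq_0 by blast
    qed
  qed
  then obtain n z a where z: "z \<in> ball 0 r" and a: "kirchhoff_wave G (W n z) a" "\<exists>d\<in>?D. a d \<noteq> 0"
    unfolding singular_on_wave_matrix_iff by blast
  have "Im z = 0"
  proof (rule ccontr)
    assume "Im z \<noteq> 0"
    from offaxis[OF this] have "(\<forall>e\<in>arcs G. cmod (W n z e) < 1) \<or> (\<forall>e\<in>arcs G. 1 < cmod (W n z e))"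
      by (simp add: W_def norm_mult)
    then show False using a kirchhoff_wave_eq_0 by blast
  qed
  then have zr: "z = of_real (Re z)" by (simp add: complex_eq_iff)
  have "kirchhoff_wave G (\<lambda>e. cis ((t n + Re z) * len e)) a"
  proof (subst kirchhoff_wave_cong[of _ "W n z"])
    fix e assume "e \<in> arcs G"
    then show "cis ((t n + Re z) * len e) = W n z e"
      by (simp add: W_def distrib_right cis_mult[symmetric] cis_conv_exp mult.assoc distrib_left exp_add flip: zr)
  qed (rule a(1))
  moreover have "\<bar>(t n + Re z) - t n\<bar> < r"
    using z abs_Re_le_cmod[of z] by simp
  ultimately show ?thesis using a(2) by blast
qed

end

section \<open>Cycles and paths between exterior vertices\<close>

context fin_digraph
begin

lemma fin_digraph_two_way: "fin_digraph G2"
proof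
  show "finite (arcs G2)" by (rule finite_arcs_two_way)
  fix d assume d: "d \<in> arcs G2"
  then show "tail G2 d \<in> verts G2" using tail_two_way_in_verts[of d] by simp
  show "head G2 d \<in> verts G2" using d tail_two_way_in_verts[of "flip d"] by simp
qed simp

end

context metric_digraph
begin

sublocale TW: fin_digraph "two_way G" by (rule fin_digraph_two_way)

lemma awalk_balance:
  assumes "TW.awalk u p w"
  shows "length (filter (\<lambda>d. tail G2 d = v) p) + of_bool (w = v) =
     length (filter (\<lambda>d. head G2 d = v) p) + of_bool (u = v)"
  using assms
proof (induction p arbitrary: u)
  case Nil
  then show ?case by (simp add: TW.awalk_Nil_iff)
next
  case (Cons d p)
  then have d: "u = tail G2 d" and p: "TW.awalk (head G2 d) p w"
    by (auto simp: TW.awalk_Cons_iff)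
  show ?case using Cons.IH[OF p] unfolding d by auto
qed

text \<open>
  The unit current along a walk is divergence-free at vertices other than the two ends, and everywhere
  if the walk is closed.
\<close>

lemma sum_out_arcs_walk:
  fixes c :: complex
  assumes walk: "TW.awalk u p w" and dist: "distinct (map fst p)" and v: "u = w \<or> v \<noteq> u \<and> v \<noteq> w"
  shows "(\<Sum>d\<in>out_arcs G2 v. c * (of_bool (d \<in> set p) - of_bool (flip d \<in> set p))) = 0"
proof -
  let ?O = "out_arcs G2 v"
  have p: "set p \<subseteq> arcs G2" using walk by (auto simp: TW.awalk_def)
  have dp: "distinct p" using dist by (simp add: distinct_map)
  have "(\<Sum>d\<in>?O. of_bool (d \<in> set p) :: complex) = (\<Sum>d | d \<in> set p \<and> tail G2 d = v. 1)"
    using p by (intro sum.mono_neutral_cong_right finite_out_arcs_two_way) auto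
  also have "\<dots> = of_nat (length (filter (\<lambda>d. tail G2 d = v) p))"
    using dp distinct_card[of "filter (\<lambda>d. tail G2 d = v) p"] by simp
  finally have out: "(\<Sum>d\<in>?O. of_bool (d \<in> set p) :: complex) = \<dots>" .
  have "(\<Sum>d\<in>?O. of_bool (flip d \<in> set p) :: complex) =
      (\<Sum>d | d \<in> arcs G2 \<and> head G2 d = v. of_bool (d \<in> set p))"
    by (rule sum.reindex_bij_witness[of _ flip flip]) auto
  also have "\<dots> = (\<Sum>d | d \<in> set p \<and> head G2 d = v. 1)"
    using p by (intro sum.mono_neutral_cong_right) (auto intro: finite_subset[OF _ finite_arcs_two_way])
  also have "\<dots> = of_nat (length (filter (\<lambda>d. head G2 d = v) p))"
    using dp distinct_card[of "filter (\<lambda>d. head G2 d = v) p"] by simp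
  finally have into: "(\<Sum>d\<in>?O. of_bool (flip d \<in> set p) :: complex) = \<dots>" .
  have "length (filter (\<lambda>d. tail G2 d = v) p) = length (filter (\<lambda>d. head G2 d = v) p)"
    using awalk_balance[OF walk, of v] v by auto
  then show ?thesis
    by (simp only: sum_distrib_left[symmetric] sum_subtractf out into) simp
qed

text \<open>
  The phases outside \<open>P\<close> are left free: they are chosen later so that no solution leaves \<open>P\<close>.
\<close>

definition carries_wave :: "'e set \<Rightarrow> bool" where
  "carries_wave P \<longleftrightarrow> (\<exists>w0 X. (\<forall>e\<in>P. cmod (w0 e) = 1) \<and> (\<exists>d\<in>arcs G2. X d \<noteq> 0) \<and>
     (\<forall>w. (\<forall>e\<in>P. w e = w0 e) \<longrightarrow> kirchhoff_wave G w X))"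

text \<open>
  A sine wave running once around the cycle, with a whole number of periods on each edge: it vanishes
  at all vertices, and its derivative continues from one edge to the next.
\<close>

lemma cycle_carries_wave:
  assumes "TW.cycle p" and dist: "distinct (map fst p)"
  shows "carries_wave (fst ` set p)"
proof -
  obtain u where walk: "TW.awalk u p u" and "p \<noteq> []"
    using assms(1) by (auto simp: TW.cycle_def)
  define X :: "'e \<times> bool \<Rightarrow> complex" where "X d = of_bool (d \<in> set p) - of_bool (flip d \<in> set p)" for d
  have not_both: "flip d \<notin> set p" if "d \<in> set p" for d
    using dist that inj_onD[of fst "set p" "flip d" d] by (auto simp: distinct_map)
  have "kirchhoff_wave G w X" if w: "\<forall>e\<in>fst ` set p. w e = 1" for w
    unfolding kirchhoff_wave_def
  proof (intro ballI conjI)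
    fix v
    have w1: "w (fst d) = 1" if "X d \<noteq> 0" for d
      using w that by (auto simp: X_def of_bool_def split: if_splits)
    have q: "w (fst d) * X (flip d) = - X d" for d
      using w1[of d] by (cases "X d = 0") (auto simp: X_def)
    show "\<exists>c. \<forall>d\<in>out_arcs G2 v. X d + w (fst d) * X (flip d) = c"
      by (intro exI[of _ 0]) (simp add: q)
    have "(\<Sum>d\<in>out_arcs G2 v. X d - w (fst d) * X (flip d)) =
        (\<Sum>d\<in>out_arcs G2 v. 2 * (of_bool (d \<in> set p) - of_bool (flip d \<in> set p)))"
      unfolding q by (simp add: X_def)
    also have "\<dots> = 0" by (intro sum_out_arcs_walk[OF walk dist]) simp
    finally show "(\<Sum>d\<in>out_arcs G2 v. X d - w (fst d) * X (flip d)) = 0" .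
  qed
  moreover have "\<exists>d\<in>arcs G2. X d \<noteq> 0"
    using \<open>p \<noteq> []\<close> walk not_both[of "hd p"]
    by (intro bexI[of _ "hd p"]) (auto simp: X_def TW.awalk_def subset_eq)
  ultimately show ?thesis
    unfolding carries_wave_def by (intro exI[of _ "\<lambda>_. 1"] exI[of _ X]) simp
qed

lemma awalk_arcs_ends:
  assumes "TW.awalk u p w" "d \<in> set p"
  shows "tail G2 d \<in> set (TW.awalk_verts u p)" "head G2 d \<in> set (TW.awalk_verts u p)"
  using assms
proof (induction p arbitrary: u)
  case (Cons x p)
  { case 1 then show ?case using Cons.IH(1)[of "head G2 x"] by (auto simp: TW.awalk_Cons_iff) }
  { case 2 then show ?case using Cons.IH(2)[of "head G2 x"]
      by (cases p) (auto simp: TW.awalk_Cons_iff) }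
qed simp_all

lemma apath_distinct_edges:
  assumes "TW.apath u p w"
  shows "distinct (map fst p)"
  using assms
proof (induction p arbitrary: u)
  case (Cons x p)
  then have p: "TW.apath (head G2 x) p w" "u \<notin> set (TW.awalk_verts (head G2 x) p)"
    "u = tail G2 x"
    by (auto simp: TW.apath_Cons_iff)
  have "fst x \<noteq> fst d" if "d \<in> set p" for d
  proof
    assume "fst x = fst d"
    then have "u = tail G2 d \<or> u = head G2 d"
      using p(3) by (auto simp: fst_eq_iff_flip)
    then show False
      using p(2) awalk_arcs_ends[OF TW.awalkI_apath[OF p(1)] that] by auto
  qed
  with Cons.IH[OF p(1)] show ?case by auto
qed simp

lemma apath_arc_into_end:
  assumes "TW.apath u p w" "d \<in> set p"
  shows "tail G2 d \<noteq> w" "head G2 d = w \<Longrightarrow> d = last p"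
  using assms
proof (induction p arbitrary: u)
  case (Cons x p)
  { case 1
    then have p: "TW.apath (head G2 x) p w"
      "tail G2 x \<notin> set (TW.awalk_verts (head G2 x) p)"
      by (auto simp: TW.apath_Cons_iff)
    have "TW.awlast (head G2 x) p = w"
      using TW.awlast_of_awalk[OF TW.awalkI_apath[OF p(1)]] by simp
    moreover have "TW.awalk_verts (head G2 x) p \<noteq> []"
      by (simp add: TW.awalk_verts_conv)
    ultimately have "w \<in> set (TW.awalk_verts (head G2 x) p)"
      by (metis last_in_set)
    with 1 p Cons.IH(1)[OF p(1)] show ?case by auto }
  { case 2
    then have p: "TW.apath (head G2 x) p w"
      by (auto simp: TW.apath_Cons_iff)
    show ?case
    proof (cases "p = []")
      case False
      have "d \<noteq> x"
      proof
        assume "d = x"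
        then have "TW.apath w p w" using p 2 by simp
        then show False using TW.apath_nonempty_ends False by blast
      qed
      with False 2 Cons.IH(2)[OF _ p] show ?thesis by auto
    qed (use 2 in simp) }
qed simp_all

lemma out_arcs_exterior:
  assumes "exterior G v" "d \<in> out_arcs G2 v"
  shows "out_arcs G2 v = {d}"
proof -
  obtain x where x: "out_arcs G2 v = {x}"
    using assms(1) exterior_iff_card card_1_singletonE by blast
  show ?thesis using assms(2) unfolding x by blast
qed

text \<open>
  A cosine wave that is extremal at both exterior ends and vanishes at all interior vertices of the
  path, so that the edges attached there do not feel it. The first and the last edge have length a
  quarter period, hence phase \<open>\<i>\<close>, and the interior edges have a whole number of periods. If the path is a
  single edge, the phase \<open>1\<close> works. At an exterior vertex continuity is void and only the derivative
  has to vanish.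
\<close>

lemma exterior_path_carries_wave:
  assumes path: "TW.apath u p w" and ext: "exterior G u" "exterior G w" and "u \<noteq> w"
  shows "carries_wave (fst ` set p)"
proof -
  have walk: "TW.awalk u p w" using path by (rule TW.awalkI_apath)
  have pne: "p \<noteq> []" using walk \<open>u \<noteq> w\<close> by (auto simp: TW.awalk_Nil_iff)
  have dist: "distinct (map fst p)" using path by (rule apath_distinct_edges)
  let ?a = "hd p" and ?b = "last p"
  have ab: "?a \<in> set p" "?b \<in> set p" using pne by auto
  have pD: "set p \<subseteq> arcs G2" using walk by (auto simp: TW.awalk_def)
  have a_tail: "tail G2 ?a = u" using walk pne by (cases p) (auto simp: TW.awalk_Cons_iff)
  have b_head: "head G2 ?b = w"
    using walk pne by (cases p rule: rev_cases) (auto simp: TW.awalk_append_iff TW.awalk_Cons_iff TW.awalk_Nil_iff)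
  have out_u: "out_arcs G2 u = {?a}"
    using ab pD a_tail by (intro out_arcs_exterior ext) auto
  have out_w: "out_arcs G2 w = {flip ?b}"
    using ab pD b_head by (intro out_arcs_exterior ext) auto
  have not_both: "flip d \<notin> set p" if "d \<in> set p" for d
    using dist that inj_onD[of fst "set p" "flip d" d] by (auto simp: distinct_map)
  have interior: "d \<noteq> ?a \<and> d \<noteq> flip ?b" if "d \<in> out_arcs G2 v" "v \<noteq> u" "v \<noteq> w" for d v
    using that a_tail b_head by auto
  show ?thesis
  proof (cases "?a = ?b")
    case True
    define X :: "'e \<times> bool \<Rightarrow> complex" where "X d = of_bool (d = ?a \<or> d = flip ?a)" for d
    have "kirchhoff_wave G w' X" if w': "\<forall>e\<in>fst ` set p. w' e = 1" for w'
      unfolding kirchhoff_wave_def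
    proof
      fix v
      have wa: "w' (fst ?a) = 1" using w' ab by auto
      consider "v = u" | "v = w" | "v \<noteq> u" "v \<noteq> w" by blast
      then show "(\<exists>c. \<forall>d\<in>out_arcs G2 v. X d + w' (fst d) * X (flip d) = c) \<and>
        (\<Sum>d\<in>out_arcs G2 v. X d - w' (fst d) * X (flip d)) = 0"
      proof cases
        case 1 then show ?thesis by (simp add: out_u X_def wa)
      next
        case 2 then show ?thesis by (simp add: out_w True[symmetric] X_def wa)
      next
        case 3
        have X0: "X d = 0 \<and> X (flip d) = 0" if "d \<in> out_arcs G2 v" for d
          using interior[OF that 3] True by (auto simp: X_def flip_eq_iff)
        then show ?thesis by (auto intro!: sum.neutral)
      qed
    qed
    moreover have "\<exists>d\<in>arcs G2. X d \<noteq> 0"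
      by (rule bexI[of _ ?a]) (use ab pD in \<open>auto simp: X_def\<close>)
    ultimately show ?thesis unfolding carries_wave_def by (intro exI[of _ "\<lambda>_. 1"] exI[of _ X]) simp
  next
    case False
    define w0 :: "'e \<Rightarrow> complex" where "w0 e = (if e = fst ?a \<or> e = fst ?b then \<i> else 1)" for e
    define X where "X d = (if d = ?a then 1 else if d = flip ?b then -1
        else \<i> * (of_bool (d \<in> set p) - of_bool (flip d \<in> set p)))" for d
    have fab: "fst ?a \<noteq> fst ?b" using dist ab False by (auto simp: distinct_map inj_on_def)
    have flips: "flip ?a \<notin> set p" "flip ?b \<notin> set p" "flip ?a \<noteq> flip ?b" "?a \<noteq> flip ?b" "flip ?a \<noteq> ?b"
      using not_both[OF ab(1)] not_both[OF ab(2)] ab False by auto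
    have "kirchhoff_wave G w' X" if w': "\<forall>e\<in>fst ` set p. w' e = w0 e" for w'
      unfolding kirchhoff_wave_def
    proof
      fix v
      have wa: "w' (fst ?a) = \<i>" "w' (fst ?b) = \<i>" using w' ab by (auto simp: w0_def)
      have Xa: "X ?a = 1" "X (flip ?a) = - \<i>" "X ?b = \<i>" "X (flip ?b) = -1"
        using ab flips False by (auto simp: X_def)
      consider "v = u" | "v = w" | "v \<noteq> u" "v \<noteq> w" by blast
      then show "(\<exists>c. \<forall>d\<in>out_arcs G2 v. X d + w' (fst d) * X (flip d) = c) \<and>
        (\<Sum>d\<in>out_arcs G2 v. X d - w' (fst d) * X (flip d)) = 0"
      proof cases
        case 1 then show ?thesis by (simp add: out_u Xa wa)
      next
        case 2 then show ?thesis by (simp add: out_w Xa wa)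
      next
        case 3
        have q: "w' (fst d) * X (flip d) = - X d \<and>
            X d = \<i> * (of_bool (d \<in> set p) - of_bool (flip d \<in> set p))"
          if d: "d \<in> out_arcs G2 v" for d
        proof -
          have d_ab: "d \<noteq> ?a" "d \<noteq> flip ?b" using interior[OF d 3] by auto
          consider "d = flip ?a" | "d = ?b" | "d \<noteq> flip ?a" "d \<noteq> ?b" by blast
          then show ?thesis
          proof cases
            case 1 then show ?thesis using Xa wa flips ab by simp
          next
            case 2 then show ?thesis using Xa wa flips ab by simp
          next
            case 3
            then have "flip d \<noteq> ?a" "flip d \<noteq> flip ?b" by (metis flip_simps(1))+
            with d_ab have X: "X d = \<i> * (of_bool (d \<in> set p) - of_bool (flip d \<in> set p))"
              "X (flip d) = \<i> * (of_bool (flip d \<in> set p) - of_bool (d \<in> set p))"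
              by (simp_all add: X_def)
            show ?thesis
            proof (cases "d \<in> set p \<or> flip d \<in> set p")
              case True
              then have "fst d \<in> fst ` set p" by (metis flip_simps(2) image_eqI)
              moreover have "fst d \<noteq> fst ?a" "fst d \<noteq> fst ?b"
                using d_ab 3 by (auto simp: fst_eq_iff_flip)
              ultimately have "w' (fst d) = 1" using bspec[OF w'] by (simp add: w0_def)
              with X show ?thesis by (simp add: right_diff_distrib)
            qed (use X in simp)
          qed
        qed
        have "(\<Sum>d\<in>out_arcs G2 v. X d - w' (fst d) * X (flip d)) =
            (\<Sum>d\<in>out_arcs G2 v. (2 * \<i>) * (of_bool (d \<in> set p) - of_bool (flip d \<in> set p)))"
        proof (intro sum.cong refl)
          fix d assume d: "d \<in> out_arcs G2 v"
          have "X d - w' (fst d) * X (flip d) = 2 * X d" using conjunct1[OF q[OF d]] by simp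
          also have "\<dots> = 2 * \<i> * (of_bool (d \<in> set p) - of_bool (flip d \<in> set p))"
            unfolding conjunct2[OF q[OF d]] by (simp only: mult.assoc)
          finally show "X d - w' (fst d) * X (flip d) =
              2 * \<i> * (of_bool (d \<in> set p) - of_bool (flip d \<in> set p))" .
        qed
        also have "\<dots> = 0" using 3 by (intro sum_out_arcs_walk[OF walk dist]) auto
        finally have "(\<Sum>d\<in>out_arcs G2 v. X d - w' (fst d) * X (flip d)) = 0" .
        moreover have "\<forall>d\<in>out_arcs G2 v. X d + w' (fst d) * X (flip d) = 0"
          using q by (metis add.right_inverse)
        ultimately show ?thesis by blast
      qed
    qed
    moreover have "\<exists>d\<in>arcs G2. X d \<noteq> 0"
      by (rule bexI[of _ ?a]) (use ab pD in \<open>auto simp: X_def\<close>)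
    ultimately show ?thesis
      unfolding carries_wave_def by (intro exI[of _ w0] exI[of _ X]) (auto simp: w0_def)
  qed
qed

lemma awalk_reverse:
  assumes "TW.awalk u p w"
  shows "TW.awalk w (rev (map flip p)) u"
  using assms
proof (induction p arbitrary: u)
  case Nil
  then show ?case by (auto simp: TW.awalk_Nil_iff)
next
  case (Cons d p)
  then have p: "TW.awalk (head G2 d) p w" and d: "fst d \<in> arcs G" "u = tail G2 d"
    by (auto simp: TW.awalk_Cons_iff)
  have "TW.awalk (head G2 d) [flip d] u"
    using d tail_two_way_in_verts[of d] tail_two_way_in_verts[of "flip d"]
    by (simp add: TW.awalk_Cons_iff TW.awalk_Nil_iff)
  with Cons.IH[OF p] show ?case
    by (simp add: TW.awalk_append_iff TW.awlast_of_awalk[OF Cons.IH[OF p]])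
qed

lemma apath_reverse:
  assumes "TW.apath u p w"
  shows "TW.apath w (rev (map flip p)) u"
proof -
  have walk: "TW.awalk u p w" using assms by (rule TW.awalkI_apath)
  have "TW.awalk_verts w (rev (map flip p)) = rev (TW.awalk_verts u p)"
  proof (cases "p = []")
    case False
    have "TW.awalk_verts u p = tail G2 (hd p) # map (head G2) p"
      using TW.awalk_verts_conv'[of u p w] walk False by (auto simp: TW.awalk_def)
    moreover have "TW.awalk_verts w (rev (map flip p)) = rev (map (head G2) p) @ [tail G2 (hd p)]"
      using False by (simp add: TW.awalk_verts_conv last_map last_rev rev_map list.map_sel(1) o_def)
    ultimately show ?thesis by simp
  qed (use walk in \<open>simp add: TW.awalk_Nil_iff\<close>)
  with assms awalk_reverse[OF walk] show ?thesis by (simp add: TW.apath_def)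
qed

text \<open>
  Otherwise a second arc inside \<open>S\<close> leaves the final vertex \<open>v\<close>. Its head is a new vertex, which
  contradicts the maximality of the path, or a vertex of the path, which closes a cycle.
\<close>

lemma maximal_path_ends_outside:
  assumes path: "TW.apath u p v" and pne: "p \<noteq> []" and pS: "fst ` set p \<subseteq> S"
    and "S \<subseteq> arcs G"
    and step: "\<And>d. fst d \<in> S \<Longrightarrow> \<not> exterior G (tail G2 d) \<Longrightarrow>
        \<exists>d'. tail G2 d' = tail G2 d \<and> d' \<noteq> d \<and> fst d' \<in> S"
    and max: "\<And>u q v. TW.apath u q v \<Longrightarrow> fst ` set q \<subseteq> S \<Longrightarrow> length q \<le> length p"
    and nocyc: "\<And>q. TW.cycle q \<Longrightarrow> distinct (map fst q) \<Longrightarrow> \<not> fst ` set q \<subseteq> S"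
  shows "exterior G v"
proof (rule ccontr)
  assume "\<not> exterior G v"
  have walk: "TW.awalk u p v" using path by (rule TW.awalkI_apath)
  have last: "last p \<in> set p" "head G2 (last p) = v"
    using walk pne by (cases p rule: rev_cases; auto simp: TW.awalk_append_iff TW.awalk_Cons_iff TW.awalk_Nil_iff)+
  moreover have "fst (last p) \<in> S" using last(1) pS by auto
  ultimately have "\<exists>d'. tail G2 d' = v \<and> d' \<noteq> flip (last p) \<and> fst d' \<in> S"
    using step[of "flip (last p)"] \<open>\<not> exterior G v\<close> by (simp del: split_paired_Ex)
  then obtain d' where d': "tail G2 d' = v" "d' \<noteq> flip (last p)" "fst d' \<in> S"
    by blast
  let ?x = "head G2 d'"
  have d'G: "fst d' \<in> arcs G" using d'(3) \<open>S \<subseteq> arcs G\<close> by auto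
  have xG: "?x \<in> verts G" using d'G tail_two_way_in_verts[of "flip d'"] by simp
  show False
  proof (cases "?x \<in> set (TW.awalk_verts u p)")
    case False
    have walk': "TW.awalk u (p @ [d']) ?x"
      using d' d'G xG walk
      by (simp add: TW.awalk_append_iff TW.awlast_of_awalk[OF walk] TW.awalk_Cons_iff TW.awalk_Nil_iff)
    have "TW.awalk_verts u (p @ [d']) = TW.awalk_verts u p @ [?x]"
      using TW.awalk_verts_append[OF walk'] by simp
    then have "TW.apath u (p @ [d']) ?x"
      using path False walk' by (simp add: TW.apath_def)
    from max[OF this] show False using pS d'(3) by simp
  next
    case True
    then obtain q r where qr: "p = q @ r" "TW.awalk u q ?x" "TW.awalk ?x r v"
      using TW.awalk_decomp[OF walk True] by auto
    have "TW.apath ?x r v"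
      using path qr TW.awlast_of_awalk by (auto simp: TW.apath_append_iff)
    then have distr: "distinct (TW.awalk_verts ?x r)" "distinct (map fst r)"
      using apath_distinct_edges by (auto simp: TW.apath_def)
    have cyc: "TW.awalk ?x (r @ [d']) ?x"
      using qr(3) d' d'G xG
      by (simp add: TW.awalk_append_iff TW.awlast_of_awalk[OF qr(3)] TW.awalk_Cons_iff TW.awalk_Nil_iff)
    obtain xs where xs: "TW.awalk_verts ?x r = ?x # xs"
      using qr(3) by (cases r) (auto simp: TW.awalk_Cons_iff)
    have "TW.awalk_verts ?x (r @ [d']) = TW.awalk_verts ?x r @ [?x]"
      using TW.awalk_verts_append[OF cyc] by simp
    with xs distr(1) have "distinct (tl (TW.awalk_verts ?x (r @ [d'])))" by simp
    then have "TW.cycle (r @ [d'])" unfolding TW.cycle_def using cyc by blast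
    moreover have new_edge: "fst d \<noteq> fst d'" if "d \<in> set r" for d
    proof
      assume "fst d = fst d'"
      then have "d' = d \<or> d' = flip d" by (auto simp: fst_eq_iff_flip)
      moreover have "d \<in> set p" using that qr(1) by simp
      ultimately show False
        using apath_arc_into_end[OF path \<open>d \<in> set p\<close>] d'(1,2) by auto
    qed
    have "fst d' \<notin> fst ` set r" using new_edge by (metis imageE)
    then have "distinct (map fst (r @ [d']))" using distr(2) by simp
    ultimately show False
      using nocyc[of "r @ [d']"] pS qr(1) d'(3) by auto
  qed
qed

lemma cycle_or_exterior_path_within:
  assumes "S \<subseteq> arcs G" "S \<noteq> {}"
    and step: "\<And>d. fst d \<in> S \<Longrightarrow> \<not> exterior G (tail G2 d) \<Longrightarrow>
        \<exists>d'. tail G2 d' = tail G2 d \<and> d' \<noteq> d \<and> fst d' \<in> S"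
  obtains p where "fst ` set p \<subseteq> S" "TW.cycle p" "distinct (map fst p)"
  | u p v where "fst ` set p \<subseteq> S" "TW.apath u p v" "exterior G u" "exterior G v" "u \<noteq> v"
proof (cases "\<exists>q. TW.cycle q \<and> distinct (map fst q) \<and> fst ` set q \<subseteq> S")
  case True
  with that(1) show thesis by blast
next
  case nocyc: False
  define Q where "Q = {(u, p, v). TW.apath u p v \<and> fst ` set p \<subseteq> S}"
  have finQ: "finite Q"
    by (rule finite_subset[OF _ TW.apaths_finite_triple]) (auto simp: Q_def)
  obtain e where "e \<in> S" using \<open>S \<noteq> {}\<close> by blast
  let ?d = "(e, True)"
  have eG: "e \<in> arcs G" using \<open>e \<in> S\<close> assms(1) by blast
  have ends: "tail G2 ?d \<in> verts G" "head G2 ?d \<in> verts G"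
    using eG tail_two_way_in_verts[of ?d] tail_two_way_in_verts[of "flip ?d"] by (simp_all del: flip_simps(5))
  have "tail G2 ?d \<noteq> head G2 ?d"
  proof
    assume "tail G2 ?d = head G2 ?d"
    then have "TW.cycle [?d]"
      unfolding TW.cycle_def using eG ends
      by (intro exI[of _ "tail G2 ?d"]) (simp add: TW.awalk_Cons_iff TW.awalk_Nil_iff)
    moreover have "distinct (map fst [?d])" "fst ` set [?d] \<subseteq> S" using \<open>e \<in> S\<close> by simp_all
    ultimately show False using nocyc by blast
  qed
  then have "TW.apath (tail G2 ?d) [?d] (head G2 ?d)"
    using eG ends by (simp add: TW.apath_Cons_iff TW.apath_Nil_iff)
  then have Q1: "(tail G2 ?d, [?d], head G2 ?d) \<in> Q" using \<open>e \<in> S\<close> by (simp add: Q_def)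
  define m where "m = Max ((\<lambda>(u, p, v). length p) ` Q)"
  have "m \<in> (\<lambda>(u, p, v). length p) ` Q"
    unfolding m_def using finQ Q1 by (intro Max_in) auto
  then obtain u p v where upv: "(u, p, v) \<in> Q" "length p = m" by auto
  have max: "length q \<le> length p" if "TW.apath u q v" "fst ` set q \<subseteq> S" for u q v
    unfolding upv(2) m_def using that finQ by (intro Max_ge) (auto simp: Q_def image_iff)
  have path: "TW.apath u p v" and pS: "fst ` set p \<subseteq> S" using upv by (auto simp: Q_def)
  have "length [?d] \<le> length p" using Q1 by (intro max) (auto simp: Q_def)
  then have pne: "p \<noteq> []" by auto
  have rpath: "TW.apath v (rev (map flip p)) u"
    using path by (rule apath_reverse)
  have nocyc': "\<not> fst ` set q \<subseteq> S" if "TW.cycle q" "distinct (map fst q)" for q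
    using nocyc that by blast
  have "exterior G v"
    by (rule maximal_path_ends_outside[OF path pne pS assms(1) step max nocyc'])
  moreover have "exterior G u"
  proof (rule maximal_path_ends_outside[OF rpath _ _ assms(1) step _ nocyc'])
    show "rev (map flip p) \<noteq> []" using pne by simp
    show "fst ` set (rev (map flip p)) \<subseteq> S" using pS by (simp add: image_image)
    show "length q \<le> length (rev (map flip p))" if "TW.apath u q v" "fst ` set q \<subseteq> S" for u q v
      using max[OF that] by simp
  qed
  moreover have "u \<noteq> v" using path pne TW.apath_nonempty_ends by blast
  ultimately show thesis using that(2) path pS by blast
qed

end

section \<open>Eigenfunctions as waves\<close>

text \<open>
  For \<open>h = k\<close> and \<open>h = - k\<close> the function \<open>g + \<i> h f\<close> satisfies a first order equation, so it is a
  multiple of \<open>cis (h x)\<close>. Both functions together determine \<open>f\<close> and \<open>g\<close>.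
\<close>

lemma helmholtz_solution:
  fixes f g :: "real \<Rightarrow> complex"
  assumes "k \<noteq> 0"
    and f: "\<And>x. x \<in> {0..L} \<Longrightarrow> (f has_vector_derivative g x) (at x within {0..L})"
    and g: "\<And>x. x \<in> {0..L} \<Longrightarrow> (g has_vector_derivative - ((k\<^sup>2) *\<^sub>R f x)) (at x within {0..L})"
  obtains A B where "\<And>x. x \<in> {0..L} \<Longrightarrow> f x = A * cis (k * x) + B * cis (k * (L - x))"
    "\<And>x. x \<in> {0..L} \<Longrightarrow> g x = \<i> * k * (A * cis (k * x) - B * cis (k * (L - x)))"
proof -
  have first_integral: "\<exists>c. \<forall>x\<in>{0..L}. g x + \<i> * h * f x = c * cis (h * x)" if "h\<^sup>2 = k\<^sup>2" for h :: real
  proof -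
    have "((\<lambda>x. (g x + \<i> * h * f x) * cis ((- h) * x)) has_vector_derivative 0) (at x within {0..L})"
      if x: "x \<in> {0..L}" for x
    proof -
      have "((\<lambda>x. (g x + \<i> * h * f x) * cis ((- h) * x)) has_vector_derivative
          (g x + \<i> * h * f x) * (\<i> * (- h) * cis ((- h) * x)) +
          (- ((k\<^sup>2) *\<^sub>R f x) + \<i> * h * g x) * cis ((- h) * x)) (at x within {0..L})"
        using has_vector_derivative_cis_mult[of "- h" x "{0..L}"] f[OF x] g[OF x]
        by (intro has_vector_derivative_mult has_vector_derivative_add has_vector_derivative_mult_right) auto
      moreover have "(g x + \<i> * h * f x) * (\<i> * (- h) * cis ((- h) * x)) +
          (- ((k\<^sup>2) *\<^sub>R f x) + \<i> * h * g x) * cis ((- h) * x) = 0"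
        unfolding \<open>h\<^sup>2 = k\<^sup>2\<close>[symmetric]
        by (simp add: algebra_simps scaleR_conv_of_real power2_eq_square)
      ultimately show ?thesis by simp
    qed
    with has_vector_derivative_zero_constant[OF convex_real_interval(5)]
    obtain c where "\<And>x. x \<in> {0..L} \<Longrightarrow> (g x + \<i> * h * f x) * cis ((- h) * x) = c"
      by blast
    then have "\<And>x. x \<in> {0..L} \<Longrightarrow> (g x + \<i> * h * f x) * (cis ((- h) * x) * cis (h * x)) = c * cis (h * x)"
      by (simp add: mult.assoc[symmetric])
    then show ?thesis by (intro exI[of _ c]) (simp add: cis_mult)
  qed
  obtain c1 where c1: "\<And>x. x \<in> {0..L} \<Longrightarrow> g x + \<i> * k * f x = c1 * cis (k * x)"
    using first_integral[of k] by blast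
  obtain c2 where c2: "\<And>x. x \<in> {0..L} \<Longrightarrow> g x + \<i> * of_real (- k) * f x = c2 * cis ((- k) * x)"
    using first_integral[of "- k"] by auto
  define A where "A = c1 / (2 * \<i> * k)"
  define B where "B = - c2 * cis (- (k * L)) / (2 * \<i> * k)"
  have A: "A * (2 * \<i> * k) = c1" using \<open>k \<noteq> 0\<close> by (simp add: A_def)
  have B: "B * cis (k * (L - x)) * (2 * \<i> * k) = - (c2 * cis ((- k) * x))" for x
  proof -
    have "cis (- (k * L)) * cis (k * (L - x)) = cis ((- k) * x)"
      by (simp add: cis_mult algebra_simps)
    then have "- c2 * (cis (- (k * L)) * cis (k * (L - x))) = - (c2 * cis ((- k) * x))" by simp
    then show ?thesis using \<open>k \<noteq> 0\<close> by (simp add: B_def mult.assoc)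
  qed
  show thesis
  proof
    fix x assume x: "x \<in> {0..L}"
    have "(A * cis (k * x) + B * cis (k * (L - x))) * (2 * \<i> * k) =
        A * (2 * \<i> * k) * cis (k * x) + B * cis (k * (L - x)) * (2 * \<i> * k)"
      by (simp add: algebra_simps)
    also have "\<dots> = (g x + \<i> * k * f x) - (g x + \<i> * of_real (- k) * f x)"
      unfolding A B c1[OF x] c2[OF x] by simp
    also have "\<dots> = f x * (2 * \<i> * k)" by (simp add: algebra_simps)
    finally show "f x = A * cis (k * x) + B * cis (k * (L - x))" using \<open>k \<noteq> 0\<close> by simp
    have "\<i> * k * (A * cis (k * x) - B * cis (k * (L - x))) * 2 =
        A * (2 * \<i> * k) * cis (k * x) - B * cis (k * (L - x)) * (2 * \<i> * k)"
      by (simp add: algebra_simps)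
    also have "\<dots> = (g x + \<i> * k * f x) + (g x + \<i> * of_real (- k) * f x)"
      unfolding A B c1[OF x] c2[OF x] by simp
    also have "\<dots> = g x * 2" by (simp add: algebra_simps)
    finally show "g x = \<i> * k * (A * cis (k * x) - B * cis (k * (L - x)))" by simp
  qed
qed

text \<open>
  The second summand is normalised at the final end of the edge, where the wave running backwards
  starts. This makes the two directions interchangeable.
\<close>

definition edge_wave :: "('e \<Rightarrow> real) \<Rightarrow> real \<Rightarrow> ('e \<times> bool \<Rightarrow> complex) \<Rightarrow> 'e \<Rightarrow> real \<Rightarrow> complex" where
  "edge_wave len k a e x = a (e, True) * cis (k * x) + a (e, False) * cis (k * (len e - x))"

text \<open>
  The limiting density of \<open>(cmod (edge_wave len k a e x))\<^sup>2\<close> at high frequency.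
\<close>

definition edge_mass :: "('e \<times> bool \<Rightarrow> complex) \<Rightarrow> 'e \<Rightarrow> real" where
  "edge_mass a e = (cmod (a (e, True)))\<^sup>2 + (cmod (a (e, False)))\<^sup>2"

lemma edge_mass_nonneg: "0 \<le> edge_mass a e"
  by (simp add: edge_mass_def)

lemma edge_mass_eq_0_iff: "edge_mass a e = 0 \<longleftrightarrow> (\<forall>b. a (e, b) = 0)"
  by (auto simp: edge_mass_def add_nonneg_eq_0_iff all_bool_eq)

lemma edge_wave_intensity:
  "(cmod (edge_wave len k a e x))\<^sup>2 = edge_mass a e +
     Re (2 * a (e, True) * cnj (a (e, False)) * cis (- (k * len e)) * cis (2 * k * x))"
proof -
  let ?p = "a (e, True) * cis (k * x)" and ?q = "a (e, False) * cis (k * (len e - x))"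
  have norm_add: "(cmod (p + q))\<^sup>2 = (cmod p)\<^sup>2 + (cmod q)\<^sup>2 + Re (2 * (p * cnj q))" for p q
    unfolding cmod_power2 by (simp add: power2_eq_square algebra_simps)
  have "(cmod (?p + ?q))\<^sup>2 = (cmod ?p)\<^sup>2 + (cmod ?q)\<^sup>2 + Re (2 * (?p * cnj ?q))"
    by (rule norm_add)
  also have "?p * cnj ?q = a (e, True) * cnj (a (e, False)) * (cis (k * x) * cis (- (k * (len e - x))))"
    by (simp add: cis_cnj mult_ac)
  also have "cis (k * x) * cis (- (k * (len e - x))) = cis (- (k * len e)) * cis (2 * k * x)"
    by (simp add: cis_mult algebra_simps)
  finally show ?thesis by (simp add: edge_wave_def edge_mass_def norm_mult mult.assoc)
qed

text \<open>
  The intensity is the sum of the edge mass and of an interference term of frequency \<open>2 k\<close>, to which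
  the Riemann--Lebesgue lemma applies.
\<close>

lemma weighted_intensity_limit:
  assumes f: "integrable lebesgue f" and k: "filterlim k at_top sequentially"
    and a: "\<And>b. (\<lambda>n. a n (e, b)) \<longlonglongrightarrow> l (e, b)"
  shows "(\<lambda>n. LINT x|lebesgue. f x * (cmod (edge_wave len (k n) (a n) e x))\<^sup>2)
           \<longlonglongrightarrow> edge_mass l e * (LINT x|lebesgue. f x)"
proof -
  define c where "c n = 2 * a n (e, True) * cnj (a n (e, False)) * cis (- (k n * len e))" for n
  define J where "J h = (LINT x|lebesgue. f x *\<^sub>R cis (h * x))" for h
  have cm: "(\<lambda>x. cis (h * x)) \<in> borel_measurable lebesgue" for h
    by (rule measurable_completion) (auto intro!: borel_measurable_continuous_onI continuous_intros)
  have int_cis: "integrable lebesgue (\<lambda>x. f x *\<^sub>R cis (h * x))" for h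
    using f cm by (rule_tac Bochner_Integration.integrable_bound[OF f])
      (auto intro!: borel_measurable_scaleR simp: norm_mult)
  have eq: "(LINT x|lebesgue. f x * (cmod (edge_wave len (k n) (a n) e x))\<^sup>2) =
      edge_mass (a n) e * (LINT x|lebesgue. f x) + Re (c n * J (2 * k n))" for n
  proof -
    have "f x * (cmod (edge_wave len (k n) (a n) e x))\<^sup>2 =
        edge_mass (a n) e * f x + Re (c n * (f x *\<^sub>R cis (2 * k n * x)))" for x
      unfolding edge_wave_intensity c_def[symmetric] by (simp add: algebra_simps)
    moreover have "integrable lebesgue (\<lambda>x. edge_mass (a n) e * f x)"
      using f by simp
    moreover have int: "integrable lebesgue (\<lambda>x. c n * (f x *\<^sub>R cis (2 * k n * x)))"
      by (rule integrable_mult_right) (rule int_cis)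
    ultimately have "(LINT x|lebesgue. f x * (cmod (edge_wave len (k n) (a n) e x))\<^sup>2) =
        (LINT x|lebesgue. edge_mass (a n) e * f x) +
        (LINT x|lebesgue. Re (c n * (f x *\<^sub>R cis (2 * k n * x))))"
      by (simp only: Bochner_Integration.integral_add integrable_Re)
    also have "(LINT x|lebesgue. Re (c n * (f x *\<^sub>R cis (2 * k n * x)))) =
        Re (LINT x|lebesgue. c n * (f x *\<^sub>R cis (2 * k n * x)))"
      by (rule integral_Re[OF int])
    also have "(LINT x|lebesgue. c n * (f x *\<^sub>R cis (2 * k n * x))) = c n * J (2 * k n)"
      unfolding J_def by (rule integral_mult_right_zero)
    finally show ?thesis by simp
  qed
  have "filterlim (\<lambda>n. 2 * k n) at_top sequentially"
    by (rule filterlim_tendsto_pos_mult_at_top[OF tendsto_const _ k]) simp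
  from filterlim_compose[OF riemann_lebesgue[OF f] this]
  have J0: "(\<lambda>n. J (2 * k n)) \<longlonglongrightarrow> 0" by (simp add: J_def)
  have "(\<lambda>n. norm (c n)) \<longlonglongrightarrow> norm (2 * l (e, True) * cnj (l (e, False)))"
    by (simp add: c_def norm_mult) (intro tendsto_intros a)
  from tendsto_mult[OF this tendsto_norm_zero[OF J0]] have "(\<lambda>n. norm (c n * J (2 * k n))) \<longlonglongrightarrow> 0"
    by (simp add: norm_mult)
  then have "(\<lambda>n. c n * J (2 * k n)) \<longlonglongrightarrow> 0" by (rule tendsto_norm_zero_cancel)
  from tendsto_Re[OF this] have "(\<lambda>n. Re (c n * J (2 * k n))) \<longlonglongrightarrow> 0" by simp
  moreover have "(\<lambda>n. edge_mass (a n) e) \<longlonglongrightarrow> edge_mass l e"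
    unfolding edge_mass_def by (intro tendsto_intros a)
  ultimately have "(\<lambda>n. edge_mass (a n) e * (LINT x|lebesgue. f x) + Re (c n * J (2 * k n)))
      \<longlonglongrightarrow> edge_mass l e * (LINT x|lebesgue. f x) + 0"
    by (intro tendsto_intros)
  then show ?thesis by (simp add: eq)
qed

context metric_digraph
begin

abbreviation "pt \<equiv> edge_point G len"
abbreviation "topo \<equiv> graph_topology G len"

lemma edge_point_0 [simp]: "pt e 0 = Vertex (tail G e)"
  and edge_point_len: "e \<in> arcs G \<Longrightarrow> pt e (len e) = Vertex (head G e)"
  using len_pos by (force simp: edge_point_def)+

lemma kirchhoff_at_iff_wave:
  fixes f :: "'e \<times> bool \<Rightarrow> complex"
  assumes "h \<noteq> 0"
    and val: "\<And>d. d \<in> arcs G2 \<Longrightarrow> f d = a d + w (fst d) * a (flip d)"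
    and der: "\<And>d. d \<in> arcs G2 \<Longrightarrow> f' d = h * (a d - w (fst d) * a (flip d))"
  shows "(\<forall>v\<in>verts G. kirchhoff_at G v (\<lambda>e. f (e, True)) (\<lambda>e. f' (e, True)) (\<lambda>e. f (e, False)) (\<lambda>e. f' (e, False)))
     \<longleftrightarrow> kirchhoff_wave G w a"
proof -
  have "kirchhoff_at G v (\<lambda>e. f (e, True)) (\<lambda>e. f' (e, True)) (\<lambda>e. f (e, False)) (\<lambda>e. f' (e, False)) \<longleftrightarrow>
      (\<exists>c. \<forall>d\<in>out_arcs G2 v. f d = c) \<and> (\<Sum>d\<in>out_arcs G2 v. f' d) = 0" for v
  proof -
    have "(\<forall>d\<in>out_arcs G2 v. f d = c) \<longleftrightarrow>
        (\<forall>e\<in>out_arcs G v. f (e, True) = c) \<and> (\<forall>e\<in>in_arcs G v. f (e, False) = c)" for c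
      unfolding out_arcs_two_way_eq by blast
    then show ?thesis unfolding kirchhoff_at_def sum_out_arcs_two_way_eq by simp
  qed
  moreover have "(\<forall>d\<in>out_arcs G2 v. f d = c) \<longleftrightarrow>
      (\<forall>d\<in>out_arcs G2 v. a d + w (fst d) * a (flip d) = c)" for v c
    by (intro ball_cong refl) (simp add: val)
  moreover have "(\<Sum>d\<in>out_arcs G2 v. f' d) =
      h * (\<Sum>d\<in>out_arcs G2 v. a d - w (fst d) * a (flip d))" for v
    unfolding sum_distrib_left by (intro sum.cong refl) (simp add: der)
  ultimately show ?thesis
    using \<open>h \<noteq> 0\<close> by (simp add: kirchhoff_wave_def)
qed

lemma laplace_eigen_imp_wave:
  assumes eig: "laplace_eigen G len (k\<^sup>2) u" and "k \<noteq> 0"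
  obtains a where "kirchhoff_wave G (\<lambda>e. cis (k * len e)) a"
    "\<And>e x. e \<in> arcs G \<Longrightarrow> x \<in> {0..len e} \<Longrightarrow> u (pt e x) = edge_wave len k a e x"
proof -
  obtain u' where u': "\<And>e x. e \<in> arcs G \<Longrightarrow> x \<in> {0..len e} \<Longrightarrow>
        ((\<lambda>t. u (pt e t)) has_vector_derivative u' e x) (at x within {0..len e})"
      "\<And>e x. e \<in> arcs G \<Longrightarrow> x \<in> {0..len e} \<Longrightarrow>
        (u' e has_vector_derivative - ((k\<^sup>2) *\<^sub>R u (pt e x))) (at x within {0..len e})"
    and vertex: "\<forall>v\<in>verts G. kirchhoff_at G v
        (\<lambda>e. u (pt e 0)) (\<lambda>e. u' e 0)
        (\<lambda>e. u (pt e (len e))) (\<lambda>e. - u' e (len e))"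
    using eig unfolding laplace_eigen_def by blast
  have "\<forall>e. \<exists>A B. e \<in> arcs G \<longrightarrow> (\<forall>x\<in>{0..len e}.
      u (pt e x) = A * cis (k * x) + B * cis (k * (len e - x)) \<and>
      u' e x = \<i> * k * (A * cis (k * x) - B * cis (k * (len e - x))))"
  proof
    fix e
    show "\<exists>A B. e \<in> arcs G \<longrightarrow> (\<forall>x\<in>{0..len e}.
      u (pt e x) = A * cis (k * x) + B * cis (k * (len e - x)) \<and>
      u' e x = \<i> * k * (A * cis (k * x) - B * cis (k * (len e - x))))"
    proof (cases "e \<in> arcs G")
      case True
      from helmholtz_solution[OF \<open>k \<noteq> 0\<close> u'[OF True]] show ?thesis by metis
    qed simp
  qed
  then obtain A B where AB: "\<And>e x. e \<in> arcs G \<Longrightarrow> x \<in> {0..len e} \<Longrightarrow>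
      u (pt e x) = A e * cis (k * x) + B e * cis (k * (len e - x)) \<and>
      u' e x = \<i> * k * (A e * cis (k * x) - B e * cis (k * (len e - x)))"
    unfolding choice_iff by blast
  define a where "a d = (if snd d then A (fst d) else B (fst d))" for d
  define f where "f d = (if snd d then u (pt (fst d) 0) else u (pt (fst d) (len (fst d))))" for d
  define f' where "f' d = (if snd d then u' (fst d) 0 else - u' (fst d) (len (fst d)))" for d
  have "kirchhoff_wave G (\<lambda>e. cis (k * len e)) a"
  proof (rule kirchhoff_at_iff_wave[where h = "\<i> * k" and f = f and f' = f', THEN iffD1])
    fix d assume "d \<in> arcs G2"
    then have e: "fst d \<in> arcs G" by simp
    have "0 \<in> {0..len (fst d)}" "len (fst d) \<in> {0..len (fst d)}" using len_pos[OF e] by auto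
    note AB[OF e this(1)] AB[OF e this(2)]
    then show "f d = a d + cis (k * len (fst d)) * a (flip d)"
      "f' d = \<i> * k * (a d - cis (k * len (fst d)) * a (flip d))"
      by (auto simp: f_def f'_def a_def algebra_simps)
  qed (use vertex \<open>k \<noteq> 0\<close> in \<open>auto simp: f_def f'_def\<close>)
  moreover have "u (pt e x) = edge_wave len k a e x" if "e \<in> arcs G" "x \<in> {0..len e}" for e x
    using AB[OF that] by (simp add: edge_wave_def a_def)
  ultimately show thesis by (rule that)
qed

text \<open>
  The values that the edge waves prescribe at the vertices are consistent by the continuity part of
  \<open>kirchhoff_wave\<close>, so the waves define a function on the quotient space.
\<close>

lemma wave_imp_laplace_eigen:
  assumes wave: "kirchhoff_wave G (\<lambda>e. cis (k * len e)) a" and "k \<noteq> 0"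
  obtains u where "laplace_eigen G len (k\<^sup>2) u"
    "\<And>e x. e \<in> arcs G \<Longrightarrow> x \<in> {0..len e} \<Longrightarrow> u (pt e x) = edge_wave len k a e x"
proof -
  let ?w = "\<lambda>e. cis (k * len e)"
  have "\<forall>v. \<exists>c. v \<in> verts G \<longrightarrow> (\<forall>d\<in>out_arcs G2 v. a d + ?w (fst d) * a (flip d) = c)"
    using wave by (auto simp: kirchhoff_wave_def)
  from choice[OF this] obtain c where
    c: "\<And>d v. v \<in> verts G \<Longrightarrow> d \<in> out_arcs G2 v \<Longrightarrow> a d + ?w (fst d) * a (flip d) = c v" by blast
  define u where "u p = (case p of Vertex v \<Rightarrow> c v | Inner e x \<Rightarrow> edge_wave len k a e x)" for p
  have u: "u (pt e x) = edge_wave len k a e x" if e: "e \<in> arcs G" and x: "x \<in> {0..len e}" for e x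
  proof -
    have tail: "c (tail G e) = a (e, True) + ?w e * a (e, False)"
      using c[of "tail G e" "(e, True)"] e by (simp add: tail_two_way)
    have head: "c (head G e) = a (e, False) + ?w e * a (e, True)"
      using c[of "head G e" "(e, False)"] e by (simp add: tail_two_way)
    consider "x = 0" | "x = len e" | "0 < x" "x < len e" using x by fastforce
    then show ?thesis
    proof cases
      case 1 then show ?thesis by (simp add: u_def edge_wave_def tail mult.commute)
    next
      case 2 then show ?thesis by (simp add: u_def edge_point_len[OF e] edge_wave_def head mult.commute)
    next
      case 3 then show ?thesis by (simp add: u_def edge_point_def)
    qed
  qed
  define u' where "u' e x = \<i> * k * (a (e, True) * cis (k * x) - a (e, False) * cis (k * (len e - x)))" for e x
  have d1: "((\<lambda>x. cis (k * (L - x))) has_vector_derivative \<i> * (- k) * cis (k * (L - x))) (at x within S)" for L x S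
  proof -
    have "cis (k * (L - y)) = cis (k * L) * cis ((- k) * y)" for y
      by (simp add: cis_mult algebra_simps)
    then show ?thesis
      using has_vector_derivative_mult_right[OF has_vector_derivative_cis_mult[of "- k" x S], of "cis (k * L)"]
      by (simp only: mult_ac)
  qed
  have der: "(edge_wave len k a e has_vector_derivative u' e x) (at x within S)" for e x S
  proof -
    have "((\<lambda>x. a (e, True) * cis (k * x) + a (e, False) * cis (k * (len e - x))) has_vector_derivative
        a (e, True) * (\<i> * k * cis (k * x)) + a (e, False) * (\<i> * (- k) * cis (k * (len e - x)))) (at x within S)"
      by (intro has_vector_derivative_add has_vector_derivative_mult_right has_vector_derivative_cis_mult d1)
    then show ?thesis by (simp add: edge_wave_def[abs_def] u'_def algebra_simps)
  qed
  have der': "(u' e has_vector_derivative - ((k\<^sup>2) *\<^sub>R edge_wave len k a e x)) (at x within S)" for e x S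
  proof -
    have "((\<lambda>x. \<i> * k * (a (e, True) * cis (k * x) - a (e, False) * cis (k * (len e - x)))) has_vector_derivative
        \<i> * k * (a (e, True) * (\<i> * k * cis (k * x)) - a (e, False) * (\<i> * (- k) * cis (k * (len e - x))))) (at x within S)"
      by (intro has_vector_derivative_diff has_vector_derivative_mult_right has_vector_derivative_cis_mult d1)
    then show ?thesis
      by (simp add: edge_wave_def u'_def[abs_def] algebra_simps scaleR_conv_of_real power2_eq_square)
  qed
  have "laplace_eigen G len (k\<^sup>2) u"
    unfolding laplace_eigen_def
  proof (intro exI[of _ u'] conjI ballI)
    fix e x assume e: "e \<in> arcs G" and x: "x \<in> {0..len e}"
    show "((\<lambda>t. u (pt e t)) has_vector_derivative u' e x) (at x within {0..len e})"
      by (rule has_vector_derivative_transform[OF x _ der]) (rule u[OF e])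
    show "(u' e has_vector_derivative - ((k\<^sup>2) *\<^sub>R u (pt e x))) (at x within {0..len e})"
      unfolding u[OF e x] by (rule der')
  next
    define f where "f d = (if snd d then u (pt (fst d) 0) else u (pt (fst d) (len (fst d))))" for d
    define f' where "f' d = (if snd d then u' (fst d) 0 else - u' (fst d) (len (fst d)))" for d
    have "\<forall>v\<in>verts G. kirchhoff_at G v (\<lambda>e. f (e, True)) (\<lambda>e. f' (e, True)) (\<lambda>e. f (e, False)) (\<lambda>e. f' (e, False))"
    proof (rule kirchhoff_at_iff_wave[where h = "\<i> * k" and w = ?w and a = a, THEN iffD2])
      fix d assume "d \<in> arcs G2"
      then have e: "fst d \<in> arcs G" by simp
      have "0 \<in> {0..len (fst d)}" "len (fst d) \<in> {0..len (fst d)}" using len_pos[OF e] by auto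
      note u[OF e this(1)] u[OF e this(2)]
      then show "f d = a d + ?w (fst d) * a (flip d)"
        "f' d = \<i> * k * (a d - ?w (fst d) * a (flip d))"
        by (cases d; cases "snd d"; simp add: f_def f'_def u'_def edge_wave_def algebra_simps)+
    qed (use wave \<open>k \<noteq> 0\<close> in auto)
    then show "kirchhoff_at G v (\<lambda>e. u (pt e 0)) (\<lambda>e. u' e 0)
        (\<lambda>e. u (pt e (len e))) (\<lambda>e. - u' e (len e))" if "v \<in> verts G" for v
      using that by (simp add: f_def f'_def)
  qed
  then show thesis using u by (rule that)
qed

end

section \<open>High-frequency limits of eigenfunctions\<close>

context metric_digraph
begin

lemma edge_point_in_points: "e \<in> arcs G \<Longrightarrow> x \<in> {0..len e} \<Longrightarrow> pt e x \<in> points G len"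
  unfolding points_def closed_edge_def by blast

lemma on_edge_subset: "on_edge G len A e \<subseteq> {0..len e}"
  by (auto simp: on_edge_def)

lemma on_edge_points: "e \<in> arcs G \<Longrightarrow> on_edge G len (points G len) e = {0..len e}"
  using edge_point_in_points by (auto simp: on_edge_def)

lemma topspace_graph_topology: "topspace topo = points G len"
proof -
  have "openin topo (points G len)"
    by (simp add: openin_graph_topology on_edge_points)
  moreover have "topspace topo \<subseteq> points G len"
    using openin_topspace[of topo] unfolding openin_graph_topology by blast
  ultimately show ?thesis using openin_subset by blast
qed

lemma continuous_on_edge:
  assumes "continuous_map topo euclideanreal \<phi>" "e \<in> arcs G"
  shows "continuous_on {0..len e} (\<lambda>x. \<phi> (pt e x))"
proof -
  have "continuous_map (top_of_set {0..len e}) topo (pt e)"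
    unfolding continuous_map_def topspace_graph_topology
  proof (intro conjI allI impI)
    show "pt e \<in> topspace (top_of_set {0..len e}) \<rightarrow> points G len"
      using edge_point_in_points[OF assms(2)] by auto
    fix U assume "openin topo U"
    then show "openin (top_of_set {0..len e}) {x \<in> topspace (top_of_set {0..len e}). pt e x \<in> U}"
      using assms(2) by (simp add: openin_graph_topology on_edge_def)
  qed
  from continuous_map_compose[OF this assms(1)] show ?thesis by (simp add: o_def)
qed

lemma graph_integral_nonneg: "(\<And>p. 0 \<le> f p) \<Longrightarrow> 0 \<le> graph_integral G len A f"
  unfolding graph_integral_def by (intro sum_nonneg) (simp add: set_lebesgue_integral_def)

definition wave_energy :: "real \<Rightarrow> ('e \<times> bool \<Rightarrow> complex) \<Rightarrow> real" where
  "wave_energy k a = (\<Sum>e\<in>arcs G. LINT x:{0..len e}|lebesgue. (cmod (edge_wave len k a e x))\<^sup>2)"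

lemma graph_integral_eq_wave_energy:
  assumes "\<And>e x. e \<in> arcs G \<Longrightarrow> x \<in> {0..len e} \<Longrightarrow> u (pt e x) = edge_wave len k a e x"
  shows "graph_integral G len (points G len) (\<lambda>p. (cmod (u p))\<^sup>2) = wave_energy k a"
  unfolding graph_integral_def wave_energy_def
  using assms unfolding set_lebesgue_integral_def
  by (intro sum.cong refl Bochner_Integration.integral_cong) (auto simp: on_edge_points indicator_def)

lemma edge_wave_scale: "edge_wave len k (\<lambda>d. c * a d) e x = c * edge_wave len k a e x"
  by (simp add: edge_wave_def algebra_simps)

lemma wave_energy_scale: "wave_energy k (\<lambda>d. c * a d) = (cmod c)\<^sup>2 * wave_energy k a"
  by (simp add: wave_energy_def edge_wave_scale norm_mult power_mult_distrib sum_distrib_left)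

lemma kirchhoff_wave_scale: "kirchhoff_wave G w a \<Longrightarrow> kirchhoff_wave G w (\<lambda>d. c * a d)"
  unfolding kirchhoff_wave_iff_wave_matrix
  by (simp add: mult.left_commute[of _ c] sum_distrib_left[symmetric])

lemma weighted_graph_intensity_limit:
  assumes k: "filterlim k at_top sequentially"
    and a: "\<And>d. d \<in> arcs G2 \<Longrightarrow> (\<lambda>n. a n d) \<longlonglongrightarrow> l d"
    and u: "\<And>n e x. e \<in> arcs G \<Longrightarrow> x \<in> {0..len e} \<Longrightarrow> u n (pt e x) = edge_wave len (k n) (a n) e x"
    and \<phi>: "\<And>e. e \<in> arcs G \<Longrightarrow> set_integrable lebesgue (on_edge G len A e) (\<lambda>x. \<phi> (pt e x))"
  shows "(\<lambda>n. graph_integral G len A (\<lambda>p. \<phi> p * (cmod (u n p))\<^sup>2)) \<longlonglongrightarrow>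
    (\<Sum>e\<in>arcs G. edge_mass l e * (LINT x:on_edge G len A e|lebesgue. \<phi> (pt e x)))"
  unfolding graph_integral_def
proof (rule tendsto_sum)
  fix e assume e: "e \<in> arcs G"
  let ?f = "\<lambda>x. indicator (on_edge G len A e) x *\<^sub>R \<phi> (pt e x)"
  have "(LINT x:on_edge G len A e|lebesgue. \<phi> (pt e x) * (cmod (u n (pt e x)))\<^sup>2)
      = (LINT x|lebesgue. ?f x * (cmod (edge_wave len (k n) (a n) e x))\<^sup>2)" for n
    unfolding set_lebesgue_integral_def
    by (intro Bochner_Integration.integral_cong refl) (auto simp: indicator_def on_edge_def u[OF e])
  moreover have "(\<lambda>n. LINT x|lebesgue. ?f x * (cmod (edge_wave len (k n) (a n) e x))\<^sup>2)
      \<longlonglongrightarrow> edge_mass l e * (LINT x|lebesgue. ?f x)"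
    using \<phi>[OF e] e by (intro weighted_intensity_limit k a) (auto simp: set_integrable_def)
  ultimately show "(\<lambda>n. LINT x:on_edge G len A e|lebesgue. \<phi> (pt e x) * (cmod (u n (pt e x)))\<^sup>2)
      \<longlonglongrightarrow> edge_mass l e * (LINT x:on_edge G len A e|lebesgue. \<phi> (pt e x))"
    by (simp add: set_lebesgue_integral_def)
qed

lemma wave_energy_limit:
  assumes k: "filterlim k at_top sequentially"
    and a: "\<And>d. d \<in> arcs G2 \<Longrightarrow> (\<lambda>n. a n d) \<longlonglongrightarrow> l d"
  shows "(\<lambda>n. wave_energy (k n) (a n)) \<longlonglongrightarrow> (\<Sum>e\<in>arcs G. edge_mass l e * len e)"
  unfolding wave_energy_def
proof (rule tendsto_sum)
  fix e assume e: "e \<in> arcs G"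
  have "integrable lebesgue (indicator {0..len e} :: real \<Rightarrow> real)"
    by (intro integrable_real_indicator) (auto simp: emeasure_lborel_Icc_eq)
  from weighted_intensity_limit[OF this k, where e = e and a = a and l = l and len = len]
  show "(\<lambda>n. LINT x:{0..len e}|lebesgue. (cmod (edge_wave len (k n) (a n) e x))\<^sup>2) \<longlonglongrightarrow> edge_mass l e * len e"
    using a e len_pos[OF e] by (simp add: set_lebesgue_integral_def)
qed

lemma total_mass_pos:
  assumes "d \<in> arcs G2" "l d \<noteq> 0"
  shows "0 < (\<Sum>e\<in>arcs G. edge_mass l e * len e)"
proof (rule sum_pos2[OF finite_arcs, of "fst d"])
  show e: "fst d \<in> arcs G" using assms(1) by simp
  have "edge_mass l (fst d) \<noteq> 0" using assms(2) by (metis edge_mass_eq_0_iff prod.collapse)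
  then show "0 < edge_mass l (fst d) * len (fst d)"
    using edge_mass_nonneg[of l "fst d"] len_pos[OF e] by simp
qed (simp add: edge_mass_nonneg len_pos less_imp_le)

text \<open>
  High-frequency eigenfunctions along which the amplitudes converge: the sequences that determine all
  semiclassical limits.
\<close>

definition eigenwave_sequence ::
  "(nat \<Rightarrow> real) \<Rightarrow> (nat \<Rightarrow> 'e \<times> bool \<Rightarrow> complex) \<Rightarrow> (nat \<Rightarrow> ('v, 'e) gpoint \<Rightarrow> complex) \<Rightarrow>
    ('e \<times> bool \<Rightarrow> complex) \<Rightarrow> bool" where
  "eigenwave_sequence k a u l \<longleftrightarrow> filterlim k at_top sequentially \<and>
     (\<forall>n. normalized_eigenfunction G len ((k n)\<^sup>2) (u n)) \<and>
     (\<forall>n. kirchhoff_wave G (\<lambda>e. cis (k n * len e)) (a n)) \<and>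
     (\<forall>n. \<forall>e\<in>arcs G. \<forall>x\<in>{0..len e}. u n (pt e x) = edge_wave len (k n) (a n) e x) \<and>
     (\<forall>d\<in>arcs G2. (\<lambda>n. a n d) \<longlonglongrightarrow> l d)"

lemma eigenwave_sequence_integral:
  assumes "eigenwave_sequence k a u l"
    and "\<And>e. e \<in> arcs G \<Longrightarrow> set_integrable lebesgue (on_edge G len A e) (\<lambda>x. \<phi> (pt e x))"
  shows "(\<lambda>n. graph_integral G len A (\<lambda>p. \<phi> p * (cmod (u n p))\<^sup>2)) \<longlonglongrightarrow>
    (\<Sum>e\<in>arcs G. edge_mass l e * (LINT x:on_edge G len A e|lebesgue. \<phi> (pt e x)))"
  using assms(1) unfolding eigenwave_sequence_def
  by (intro weighted_graph_intensity_limit assms(2)) auto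

lemma eigenwave_sequence_mass:
  assumes "eigenwave_sequence k a u l"
  shows "(\<Sum>e\<in>arcs G. edge_mass l e * len e) = 1"
proof -
  have "(\<lambda>n. wave_energy (k n) (a n)) \<longlonglongrightarrow> (\<Sum>e\<in>arcs G. edge_mass l e * len e)"
    using assms by (intro wave_energy_limit) (auto simp: eigenwave_sequence_def)
  moreover have "wave_energy (k n) (a n) = 1" for n
    using assms graph_integral_eq_wave_energy[of "u n" "k n" "a n"]
    by (simp add: eigenwave_sequence_def normalized_eigenfunction_def)
  ultimately show ?thesis by (simp add: LIMSEQ_const_iff)
qed

text \<open>
  The normalisation of \<open>u\<close> is an integral condition and does not bound the amplitudes at once. So the
  amplitudes are first divided by their Euclidean norm, which gives a convergent subsequence with
  limit \<open>m \<noteq> 0\<close>. The energies of the rescaled waves converge to the positive mass of \<open>m\<close>, so the norms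
  converge too.
\<close>

lemma eigenfunctions_have_eigenwave_subsequence:
  assumes lam: "filterlim lam at_top sequentially"
    and u: "\<And>n. normalized_eigenfunction G len (lam n) (u n)"
  shows "\<exists>r k a l. strict_mono (r :: nat \<Rightarrow> nat) \<and> eigenwave_sequence k a (u \<circ> r) l"
proof -
  let ?D = "arcs G2"
  obtain N where N: "\<And>n. n \<ge> N \<Longrightarrow> 0 < lam n"
    using lam unfolding filterlim_at_top_dense eventually_sequentially by blast
  define k where "k n = sqrt (lam (n + N))" for n
  have k2: "(k n)\<^sup>2 = lam (n + N)" "k n > 0" for n using N[of "n + N"] by (simp_all add: k_def)
  have ktop: "filterlim k at_top sequentially"
    unfolding k_def
    by (rule filterlim_compose[OF sqrt_at_top filterlim_compose[OF lam filterlim_add_const_nat_at_top]])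
  have eig: "laplace_eigen G len ((k n)\<^sup>2) (u (n + N))" for n
    using u[of "n + N"] by (simp add: k2 normalized_eigenfunction_def)
  have "\<forall>n. \<exists>a. kirchhoff_wave G (\<lambda>e. cis (k n * len e)) a \<and>
      (\<forall>e\<in>arcs G. \<forall>x\<in>{0..len e}. u (n + N) (pt e x) = edge_wave len (k n) a e x)"
  proof (rule allI, goal_cases)
    case (1 n)
    show ?case using laplace_eigen_imp_wave[OF eig[of n]] k2(2)[of n] by (metis less_irrefl)
  qed
  from choice[OF this] obtain a where
    wave: "\<And>n. kirchhoff_wave G (\<lambda>e. cis (k n * len e)) (a n)" and
    ua: "\<And>n e x. e \<in> arcs G \<Longrightarrow> x \<in> {0..len e} \<Longrightarrow>
      u (n + N) (pt e x) = edge_wave len (k n) (a n) e x" by blast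
  have energy: "wave_energy (k n) (a n) = 1" for n
    using graph_integral_eq_wave_energy[of "u (n + N)" "k n" "a n", OF ua] u[of "n + N"]
    by (simp add: normalized_eigenfunction_def)
  have "\<exists>d\<in>?D. a n d \<noteq> 0" for n
  proof (rule ccontr)
    assume "\<not> ?thesis"
    then have zero: "\<forall>d\<in>?D. a n d = 0" by blast
    have "a n (e, b) = 0" if "e \<in> arcs G" for e b
      using bspec[OF zero, of "(e, b)"] that by simp
    then have "wave_energy (k n) (a n) = 0"
      by (simp add: wave_energy_def edge_wave_def)
    then show False using energy[of n] by simp
  qed
  from normalized_convergent_subsequence[where a = a, OF finite_arcs_two_way this]
  obtain s :: "nat \<Rightarrow> nat" and c :: "nat \<Rightarrow> real" and m where s: "strict_mono s" and c: "\<And>n. 0 < c n"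
    and m: "\<And>d. d \<in> ?D \<Longrightarrow> (\<lambda>n. of_real (c n) * a (s n) d) \<longlonglongrightarrow> m d" and "\<exists>d\<in>?D. m d \<noteq> 0"
    by blast
  then have Ipos: "0 < (\<Sum>e\<in>arcs G. edge_mass m e * len e)" (is "0 < ?I")
    using total_mass_pos by blast
  have ks: "filterlim (k \<circ> s) at_top sequentially"
    unfolding o_def by (rule filterlim_compose[OF ktop filterlim_subseq[OF s]])
  have "(\<lambda>n. wave_energy ((k \<circ> s) n) (\<lambda>d. of_real (c n) * a (s n) d)) \<longlonglongrightarrow> ?I"
    by (rule wave_energy_limit[OF ks m])
  then have "(\<lambda>n. (c n)\<^sup>2) \<longlonglongrightarrow> ?I"
    by (simp add: wave_energy_scale energy)
  from tendsto_real_sqrt[OF this] have "c \<longlonglongrightarrow> sqrt ?I"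
    using c by (simp add: less_imp_le)
  then have "(\<lambda>n. of_real (1 / c n) * (of_real (c n) * a (s n) d)) \<longlonglongrightarrow> of_real (1 / sqrt ?I) * m d" if "d \<in> ?D" for d
    using Ipos by (intro tendsto_mult m[OF that] tendsto_of_real tendsto_divide tendsto_const) simp_all
  moreover have "of_real (1 / c n) * (of_real (c n) * a (s n) d) = a (s n) d" for n d
    using c[of n] by simp
  ultimately have lim: "(\<lambda>n. a (s n) d) \<longlonglongrightarrow> of_real (1 / sqrt ?I) * m d" if "d \<in> ?D" for d
    using that by simp
  have "strict_mono (\<lambda>n. s n + N)" using s by (simp add: strict_mono_def)
  moreover have "eigenwave_sequence (k \<circ> s) (a \<circ> s) (u \<circ> (\<lambda>n. s n + N)) (\<lambda>d. of_real (1 / sqrt ?I) * m d)"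
    unfolding eigenwave_sequence_def using ks u wave ua lim by (simp add: k2)
  ultimately show ?thesis by blast
qed

lemma waves_give_eigenwave_sequence:
  assumes k: "filterlim k at_top sequentially" "\<And>n. 0 < k n"
    and wave: "\<And>n. kirchhoff_wave G (\<lambda>e. cis (k n * len e)) (a n)"
    and lim: "\<And>d. d \<in> arcs G2 \<Longrightarrow> (\<lambda>n. a n d) \<longlonglongrightarrow> l d"
    and l: "d0 \<in> arcs G2" "l d0 \<noteq> 0"
  shows "\<exists>k' a' u c. eigenwave_sequence k' a' u (\<lambda>d. c * l d)"
proof -
  have Ipos: "0 < (\<Sum>e\<in>arcs G. edge_mass l e * len e)" (is "0 < ?I") using l by (rule total_mass_pos)
  have I: "(\<lambda>n. wave_energy (k n) (a n)) \<longlonglongrightarrow> ?I" by (rule wave_energy_limit[OF k(1) lim])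
  then obtain N where N: "\<And>n. n \<ge> N \<Longrightarrow> 0 < wave_energy (k n) (a n)"
    using order_tendstoD(1)[OF I Ipos] unfolding eventually_sequentially by blast
  define c where "c n = 1 / sqrt (wave_energy (k (n + N)) (a (n + N)))" for n
  define b where "b n d = of_real (c n) * a (n + N) d" for n d
  have energy: "wave_energy (k (n + N)) (b n) = 1" for n
    unfolding b_def wave_energy_scale using N[of "n + N"] by (simp add: c_def norm_divide power_divide)
  have bw: "kirchhoff_wave G (\<lambda>e. cis (k (n + N) * len e)) (b n)" for n
    unfolding b_def by (rule kirchhoff_wave_scale[OF wave])
  have "\<forall>n. \<exists>u. laplace_eigen G len ((k (n + N))\<^sup>2) u \<and>
      (\<forall>e\<in>arcs G. \<forall>x\<in>{0..len e}. u (pt e x) = edge_wave len (k (n + N)) (b n) e x)"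
  proof (rule allI, goal_cases)
    case (1 n)
    show ?case using wave_imp_laplace_eigen[OF bw[of n]] k(2)[of "n + N"] by (metis less_irrefl)
  qed
  from choice[OF this] obtain u where
    eig: "\<And>n. laplace_eigen G len ((k (n + N))\<^sup>2) (u n)" and
    ub: "\<And>n e x. e \<in> arcs G \<Longrightarrow> x \<in> {0..len e} \<Longrightarrow> u n (pt e x) = edge_wave len (k (n + N)) (b n) e x"
    by blast
  have norm: "normalized_eigenfunction G len ((k (n + N))\<^sup>2) (u n)" for n
    using eig[of n] graph_integral_eq_wave_energy[of "u n" "k (n + N)" "b n", OF ub] energy[of n]
    by (simp add: normalized_eigenfunction_def)
  have "c \<longlonglongrightarrow> 1 / sqrt ?I"
    unfolding c_def using Ipos by (intro tendsto_intros LIMSEQ_ignore_initial_segment[OF I]) simp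
  then have "(\<lambda>n. b n d) \<longlonglongrightarrow> of_real (1 / sqrt ?I) * l d" if "d \<in> arcs G2" for d
    unfolding b_def by (intro tendsto_mult tendsto_of_real LIMSEQ_ignore_initial_segment[OF lim[OF that]])
  moreover have "filterlim (\<lambda>n. k (n + N)) at_top sequentially"
    by (rule filterlim_compose[OF k(1) filterlim_add_const_nat_at_top])
  ultimately have "eigenwave_sequence (\<lambda>n. k (n + N)) b u (\<lambda>d. of_real (1 / sqrt ?I) * l d)"
    unfolding eigenwave_sequence_def using norm bw ub by simp
  then show ?thesis by blast
qed

lemma mono_C_at: "mono (C_at G len \<omega>)"
  unfolding C_at_def by (intro monoI Inf_superset_mono) (blast intro: order_trans)

lemma observed_mass_limit:
  assumes seq: "eigenwave_sequence k a u l" and "graph_measurable G len \<omega>"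
  shows "(\<lambda>n. graph_integral G len \<omega> (\<lambda>p. (cmod (u n p))\<^sup>2)) \<longlonglongrightarrow>
    (\<Sum>e\<in>arcs G. edge_mass l e * measure lebesgue (on_edge G len \<omega> e))"
proof -
  have meas: "on_edge G len \<omega> e \<in> sets lebesgue" if "e \<in> arcs G" for e
    using assms(2) that by (simp add: graph_measurable_def)
  have fin: "emeasure lebesgue (on_edge G len \<omega> e) < \<infinity>" for e
  proof -
    have "emeasure lebesgue (on_edge G len \<omega> e) \<le> emeasure lebesgue {0..len e}"
      by (rule emeasure_mono[OF on_edge_subset]) simp
    also have "\<dots> < \<infinity>" by (simp add: emeasure_lborel_Icc_eq)
    finally show ?thesis .
  qed
  have "(LINT x:on_edge G len \<omega> e|lebesgue. (1::real)) = measure lebesgue (on_edge G len \<omega> e)"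
    if "e \<in> arcs G" for e
    using meas[OF that] by (simp add: set_lebesgue_integral_def)
  moreover have "set_integrable lebesgue (on_edge G len \<omega> e) (\<lambda>x. 1 :: real)" if "e \<in> arcs G" for e
    using integrable_real_indicator[OF meas[OF that] fin] by (simp add: set_integrable_def)
  ultimately show ?thesis
    using eigenwave_sequence_integral[OF seq, of \<omega> "\<lambda>_. 1"] by (simp cong: sum.cong)
qed

text \<open>
  If the constant is not positive, then there are normalised eigenfunctions of arbitrarily high
  frequency with arbitrarily small mass on \<open>\<omega>\<close>; a limit of their amplitudes has mass zero there.
\<close>

lemma C_infinity_pos_iff:
  assumes \<omega>: "graph_measurable G len \<omega>"
  shows "C_infinity G len \<omega> > 0 \<longleftrightarrow> (\<forall>k a u l. eigenwave_sequence k a u l \<longrightarrow>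
     0 < (\<Sum>e\<in>arcs G. edge_mass l e * measure lebesgue (on_edge G len \<omega> e)))" (is "?C \<longleftrightarrow> ?R")
proof
  assume ?C
  have "eventually (\<lambda>\<Lambda>. 0 < C_at G len \<omega> \<Lambda>) at_top"
    by (rule order_tendstoD(1)[OF C_at_tendsto \<open>?C\<close>])
  then obtain \<Lambda> where "0 < C_at G len \<omega> \<Lambda>"
    using eventually_happens'[OF trivial_limit_at_top_linorder] by blast
  then obtain \<delta> where \<delta>: "0 < \<delta>" "ereal \<delta> < C_at G len \<omega> \<Lambda>"
    using ereal_dense2 by (metis ereal_less(2))
  show ?R
  proof (intro allI impI)
    fix k a u l assume seq: "eigenwave_sequence k a u l"
    have "filterlim (\<lambda>n. (k n)\<^sup>2) at_top sequentially"
      using seq by (auto simp: eigenwave_sequence_def intro!: filterlim_pow_at_top)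
    then have "eventually (\<lambda>n. \<Lambda> \<le> (k n)\<^sup>2) sequentially" by (simp add: filterlim_at_top)
    then have "eventually (\<lambda>n. \<delta> \<le> graph_integral G len \<omega> (\<lambda>p. (cmod (u n p))\<^sup>2)) sequentially"
    proof eventually_elim
      case (elim n)
      have "normalized_eigenfunction G len ((k n)\<^sup>2) (u n)" using seq by (simp add: eigenwave_sequence_def)
      with elim have "C_at G len \<omega> \<Lambda> \<le> ereal (graph_integral G len \<omega> (\<lambda>p. (cmod (u n p))\<^sup>2))"
        unfolding C_at_def by (intro Inf_lower) blast
      with \<delta>(2) have "ereal \<delta> < ereal (graph_integral G len \<omega> (\<lambda>p. (cmod (u n p))\<^sup>2))"
        by (rule less_le_trans)
      then show ?case by simp
    qed
    from tendsto_lowerbound[OF observed_mass_limit[OF seq \<omega>] this]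
    show "0 < (\<Sum>e\<in>arcs G. edge_mass l e * measure lebesgue (on_edge G len \<omega> e))"
      using \<delta>(1) by simp
  qed
next
  assume R: ?R
  show ?C
  proof (rule ccontr)
    assume "\<not> ?C"
    have "C_at G len \<omega> \<Lambda> \<le> 0" for \<Lambda>
    proof -
      have "C_at G len \<omega> \<Lambda> \<le> C_infinity G len \<omega>"
        by (rule tendsto_lowerbound[OF C_at_tendsto])
           (auto intro!: eventually_mono[OF eventually_ge_at_top[of \<Lambda>]] monoD[OF mono_C_at])
      then show ?thesis using \<open>\<not> ?C\<close> by simp
    qed
    then have "C_at G len \<omega> (real n) < ereal (1 / real (Suc n))" for n
      by (rule le_less_trans) simp
    then have "\<exists>x\<in>{ereal (graph_integral G len \<omega> (\<lambda>p. (cmod (u p))\<^sup>2)) | u lam.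
        real n \<le> lam \<and> normalized_eigenfunction G len lam u}. x < ereal (1 / real (Suc n))" for n
      unfolding C_at_def Inf_less_iff .
    then have "\<exists>lam u. real n \<le> lam \<and> normalized_eigenfunction G len lam u \<and>
        graph_integral G len \<omega> (\<lambda>p. (cmod (u p))\<^sup>2) < 1 / real (Suc n)" for n
      using less_ereal.simps(1) by blast
    then have "\<forall>n. \<exists>lam u. real n \<le> lam \<and> normalized_eigenfunction G len lam u \<and>
        graph_integral G len \<omega> (\<lambda>p. (cmod (u p))\<^sup>2) < 1 / real (Suc n)" ..
    then obtain lam u where lam: "\<And>n. real n \<le> lam n"
      and u: "\<And>n. normalized_eigenfunction G len (lam n) (u n)"
      and small: "\<And>n. graph_integral G len \<omega> (\<lambda>p. (cmod (u n p))\<^sup>2) < 1 / real (Suc n)"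
      unfolding choice_iff by blast
    have "filterlim lam at_top sequentially"
      by (rule filterlim_at_top_mono[OF filterlim_real_sequentially]) (simp add: lam)
    from eigenfunctions_have_eigenwave_subsequence[where u = u, OF this u]
    obtain r k a l where r: "strict_mono (r :: nat \<Rightarrow> nat)" and seq: "eigenwave_sequence k a (u \<circ> r) l"
      by blast
    have "(\<lambda>n. 1 / real (Suc (r n))) \<longlonglongrightarrow> 0"
      using LIMSEQ_subseq_LIMSEQ[OF LIMSEQ_Suc[OF lim_1_over_n] r] by (simp add: o_def)
    then have "(\<lambda>n. graph_integral G len \<omega> (\<lambda>p. (cmod ((u \<circ> r) n p))\<^sup>2)) \<longlonglongrightarrow> 0"
      by (rule tendsto_sandwich[OF _ _ tendsto_const, rotated 2])
         (auto intro!: always_eventually graph_integral_nonneg less_imp_le[OF small] simp del: of_nat_Suc)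
    with observed_mass_limit[OF seq \<omega>]
    have "(\<Sum>e\<in>arcs G. edge_mass l e * measure lebesgue (on_edge G len \<omega> e)) = 0"
      by (rule LIMSEQ_unique)
    with R seq show False by fastforce
  qed
qed

end

section \<open>Semiclassical measures\<close>

context metric_digraph
begin

abbreviation graph_borel :: "('v, 'e) gpoint measure" where
  "graph_borel \<equiv> sigma (points G len) {U. openin topo U}"

lemma graph_opens_subset: "{U. openin topo U} \<subseteq> Pow (points G len)"
  by (auto simp: openin_graph_topology)

lemma space_graph_borel: "space graph_borel = points G len"
  and sets_graph_borel: "sets graph_borel = sigma_sets (points G len) {U. openin topo U}"
  using graph_opens_subset by simp_all

lemma continuous_map_graph_measurable:
  assumes "continuous_map topo euclideanreal \<phi>"
    and \<mu>: "space \<mu> = points G len" "sets \<mu> = sigma_sets (points G len) {U. openin topo U}"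
  shows "\<phi> \<in> borel_measurable \<mu>"
proof (rule borel_measurableI)
  fix S :: "real set" assume "open S"
  then have "openin topo {p \<in> points G len. \<phi> p \<in> S}"
    using assms(1) by (auto simp: continuous_map_def topspace_graph_topology)
  moreover have "\<phi> -` S \<inter> space \<mu> = {p \<in> points G len. \<phi> p \<in> S}" using \<mu>(1) by auto
  ultimately show "\<phi> -` S \<inter> space \<mu> \<in> sets \<mu>" unfolding \<mu>(2) by auto
qed

lemma continuous_map_graphI:
  assumes "\<And>e. e \<in> arcs G \<Longrightarrow> continuous_on {0..len e} (\<lambda>x. \<phi> (pt e x))"
  shows "continuous_map topo euclideanreal \<phi>"
  unfolding continuous_map_def topspace_graph_topology openin_graph_topology
proof (intro conjI allI impI ballI)
  fix U :: "real set" and e assume U: "openin euclideanreal U" and e: "e \<in> arcs G"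
  have "on_edge G len {p \<in> points G len. \<phi> p \<in> U} e = {0..len e} \<inter> (\<lambda>x. \<phi> (pt e x)) -` U"
    using edge_point_in_points[OF e] by (auto simp: on_edge_def)
  then show "openin (top_of_set {0..len e}) (on_edge G len {p \<in> points G len. \<phi> p \<in> U} e)"
    using continuous_openin_preimage_gen[OF assms[OF e]] U by simp
qed auto

text \<open>
  Linear interpolation of the vertex values \<open>g\<close>, plus a correction \<open>h\<close> on the edges. For \<open>h\<close> vanishing
  at both ends of every edge this is a continuous function on the metric graph, and all test
  functions below are of this form.
\<close>

definition interpolate :: "('v \<Rightarrow> real) \<Rightarrow> ('e \<Rightarrow> real \<Rightarrow> real) \<Rightarrow> ('v, 'e) gpoint \<Rightarrow> real" where
  "interpolate g h p = (case p of Vertex v \<Rightarrow> g v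
     | Inner e x \<Rightarrow> g (tail G e) * (1 - x / len e) + g (head G e) * (x / len e) + h e x)"

lemma interpolate_edge_point:
  assumes e: "e \<in> arcs G" and x: "x \<in> {0..len e}" and h: "h e 0 = 0" "h e (len e) = 0"
  shows "interpolate g h (pt e x) =
    g (tail G e) * (1 - x / len e) + g (head G e) * (x / len e) + h e x"
proof -
  consider "x = 0" | "x = len e" | "0 < x" "x < len e" using x by fastforce
  then show ?thesis
    using h len_pos[OF e] edge_point_len[OF e] by cases (auto simp: interpolate_def edge_point_def)
qed

lemma continuous_map_interpolate:
  assumes "\<And>e. e \<in> arcs G \<Longrightarrow> continuous_on {0..len e} (h e) \<and> h e 0 = 0 \<and> h e (len e) = 0"
  shows "continuous_map topo euclideanreal (interpolate g h)"
proof (rule continuous_map_graphI)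
  fix e assume e: "e \<in> arcs G"
  have "continuous_on {0..len e} (\<lambda>x. g (tail G e) * (1 - x / len e) + g (head G e) * (x / len e) + h e x)"
    using assms[OF e] len_pos[OF e] by (intro continuous_intros) auto
  then show "continuous_on {0..len e} (\<lambda>x. interpolate g h (pt e x))"
    using assms[OF e] interpolate_edge_point[OF e]
    by (subst continuous_on_cong[OF refl]) auto
qed

definition edge_union :: "'e set \<Rightarrow> ('v, 'e) gpoint set" where
  "edge_union S = (\<Union>e\<in>S. closed_edge G len e)"

lemma Inner_in_edge_union:
  assumes "S \<subseteq> arcs G" "0 < x" "x < len e"
  shows "Inner e x \<in> edge_union S \<longleftrightarrow> e \<in> S"
  using assms by (force simp: edge_union_def closed_edge_def edge_point_def split: if_splits)

lemma closed_edge_subset_edge_union: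
  assumes "S \<subseteq> arcs G" "e \<in> arcs G"
  shows "closed_edge G len e \<subseteq> edge_union S \<longleftrightarrow> e \<in> S"
proof
  assume sub: "closed_edge G len e \<subseteq> edge_union S"
  have mid: "0 < len e / 2" "len e / 2 < len e" using len_pos[OF assms(2)] by auto
  then have "pt e (len e / 2) = Inner e (len e / 2)" by (simp add: edge_point_def)
  then have "Inner e (len e / 2) \<in> closed_edge G len e"
    using mid unfolding closed_edge_def by (metis atLeastAtMost_iff image_eqI less_imp_le)
  with sub show "e \<in> S" using Inner_in_edge_union[OF assms(1) mid] by blast
qed (auto simp: edge_union_def)

lemma length_on_edge_union:
  assumes "S \<subseteq> arcs G"
  shows "length_on G len \<omega> (edge_union S) = (\<Sum>e\<in>S. measure lebesgue (on_edge G len \<omega> e))"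
proof -
  have "{e \<in> arcs G. closed_edge G len e \<subseteq> edge_union S} = S"
    using assms closed_edge_subset_edge_union[OF assms] by auto
  then show ?thesis by (simp add: length_on_def)
qed

text \<open>
  The measure \<open>\<Sum>e. c e dx\<close> on the edges, characterised by its integrals of continuous functions. This
  is the information that weak convergence provides.
\<close>

definition has_edge_densities :: "('v, 'e) gpoint measure \<Rightarrow> ('e \<Rightarrow> real) \<Rightarrow> bool" where
  "has_edge_densities \<mu> c \<longleftrightarrow> space \<mu> = points G len \<and>
     sets \<mu> = sigma_sets (points G len) {U. openin topo U} \<and> finite_measure \<mu> \<and>
     (\<forall>\<phi>. continuous_map topo euclideanreal \<phi> \<longrightarrow>
        (LINT p|\<mu>. \<phi> p) = (\<Sum>e\<in>arcs G. c e * (LINT x:{0..len e}|lebesgue. \<phi> (pt e x))))"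

text \<open>
  There is a continuous function that is positive exactly off the edges with nonzero density. Its
  integral is zero, so the complement of these edges, which is open, is a null set.
\<close>

lemma measure_support_subset:
  assumes \<mu>: "has_edge_densities \<mu> c"
  shows "measure_support G len \<mu> \<subseteq> edge_union {e \<in> arcs G. c e \<noteq> 0}"
proof -
  let ?S = "{e \<in> arcs G. c e \<noteq> 0}"
  interpret finite_measure \<mu> using \<mu> by (simp add: has_edge_densities_def)
  note sp = \<mu>[unfolded has_edge_densities_def, THEN conjunct1]
    and st = \<mu>[unfolded has_edge_densities_def, THEN conjunct2, THEN conjunct1]
  define g where "g v = (of_bool (Vertex v \<notin> edge_union ?S) :: real)" for v
  \<comment> \<open>\<open>g\<close> detects vertices outside the edges of \<open>?S\<close>, isolated ones included, and \<open>h\<close> the interiors of the other edges\<close>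
  define h where "h e x = of_bool (e \<notin> ?S) * (x * (len e - x))" for e x
  \<comment> \<open>truncation makes the test function integrable for any finite measure\<close>
  define \<phi> where "\<phi> p = min 1 (interpolate g h p)" for p
  have \<phi>e: "\<phi> (pt e x) =
      min 1 (g (tail G e) * (1 - x / len e) + g (head G e) * (x / len e) + h e x)"
    if "e \<in> arcs G" "x \<in> {0..len e}" for e x
    using interpolate_edge_point[OF that, of h g] by (simp add: \<phi>_def h_def)
  have cont0: "continuous_map topo euclideanreal (interpolate g h)"
    by (rule continuous_map_interpolate) (auto simp: h_def intro!: continuous_intros)
  have cont: "continuous_map topo euclideanreal \<phi>"
    unfolding \<phi>_def by (intro continuous_map_real_min cont0) simp
  have ends: "Vertex (tail G e) \<in> edge_union ?S" "Vertex (head G e) \<in> edge_union ?S" if "e \<in> ?S" for e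
  proof -
    have e: "e \<in> arcs G" using that by simp
    have "Vertex (tail G e) \<in> closed_edge G len e" "Vertex (head G e) \<in> closed_edge G len e"
      unfolding closed_edge_def using len_pos[OF e] edge_point_len[OF e]
      by (force intro: image_eqI[of _ _ 0], force intro: image_eqI[of _ _ "len e"])
    then show "Vertex (tail G e) \<in> edge_union ?S" "Vertex (head G e) \<in> edge_union ?S"
      using that by (auto simp: edge_union_def)
  qed
  have zero: "\<phi> (pt e x) = 0" if "e \<in> ?S" "x \<in> {0..len e}" for e x
    using \<phi>e[of e x] that ends[OF that(1)] by (simp add: g_def h_def)
  have zero': "\<phi> p = 0" if "p \<in> edge_union ?S" for p
    using that zero by (auto simp: edge_union_def closed_edge_def)
  have nonneg: "0 \<le> \<phi> p" if "p \<in> points G len" for p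
  proof -
    have "0 \<le> \<phi> (pt e x)" if "e \<in> arcs G" "x \<in> {0..len e}" for e x
      using \<phi>e[OF that] that len_pos[OF that(1)] by (auto simp: g_def h_def)
    moreover have "0 \<le> \<phi> (Vertex v)" for v by (simp add: \<phi>_def interpolate_def g_def)
    ultimately show ?thesis using that by (auto simp: points_def closed_edge_def)
  qed
  have pos: "\<phi> p > 0" if p: "p \<in> points G len" "p \<notin> edge_union ?S" for p
  proof (cases p)
    case (Vertex v)
    then show ?thesis using p by (simp add: \<phi>_def interpolate_def g_def)
  next
    case (Inner e x)
    then obtain d y where "d \<in> arcs G" "y \<in> {0..len d}" "pt d y = Inner e x"
      using p(1) by (auto simp: points_def closed_edge_def)
    then have e: "e \<in> arcs G" "0 < x" "x < len e" by (auto simp: edge_point_def split: if_splits)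
    then have "e \<notin> ?S" using p(2) Inner Inner_in_edge_union[of ?S x e] by auto
    then have "0 < h e x" using e by (simp add: h_def)
    moreover have "0 \<le> g (tail G e) * (1 - x / len e) + g (head G e) * (x / len e)"
      using e by (auto simp: g_def)
    ultimately show ?thesis using Inner by (simp add: \<phi>_def interpolate_def)
  qed
  have "(LINT p|\<mu>. \<phi> p) = (\<Sum>e\<in>arcs G. c e * (LINT x:{0..len e}|lebesgue. \<phi> (pt e x)))"
    using \<mu> cont unfolding has_edge_densities_def by blast
  also have "\<dots> = 0"
  proof (rule sum.neutral, rule ballI)
    fix e assume e: "e \<in> arcs G"
    show "c e * (LINT x:{0..len e}|lebesgue. \<phi> (pt e x)) = 0"
    proof (cases "c e = 0")
      case False
      then have "(LINT x:{0..len e}|lebesgue. \<phi> (pt e x)) = (LINT x:{0..len e}|lebesgue. 0)"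
        using e zero[of e] unfolding set_lebesgue_integral_def
        by (intro Bochner_Integration.integral_cong refl) (auto simp: indicator_def)
      then show ?thesis by simp
    qed simp
  qed
  finally have int0: "(LINT p|\<mu>. \<phi> p) = 0" .
  have "integrable \<mu> \<phi>"
  proof (rule integrable_const_bound[where B = 1])
    show "AE p in \<mu>. norm (\<phi> p) \<le> 1"
    proof (rule AE_I2)
      fix p assume "p \<in> space \<mu>"
      then show "norm (\<phi> p) \<le> 1" using nonneg[of p] by (simp add: sp \<phi>_def)
    qed
  qed (rule continuous_map_graph_measurable[OF cont sp st])
  then have AE0: "AE p in \<mu>. \<phi> p = 0"
    using int0 nonneg by (subst integral_nonneg_eq_0_iff_AE[symmetric]) (auto simp: sp)
  let ?U = "points G len - edge_union ?S"
  have U_eq: "?U = {p \<in> points G len. \<phi> p \<in> {0<..}}" using pos zero' by fastforce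
  have U_open: "openin topo ?U"
    unfolding U_eq using cont open_greaterThan[of "0 :: real"]
    by (simp only: continuous_map_def topspace_graph_topology open_openin)
  have "AE p in \<mu>. p \<notin> ?U"
    using AE0 by eventually_elim (use pos in force)
  moreover have "?U \<in> sets \<mu>" using U_open unfolding st by auto
  ultimately have "measure \<mu> ?U = 0"
    by (subst (asm) AE_iff_measurable[of ?U]) (auto simp: sp measure_def)
  then show ?thesis
    using U_open by (auto simp: measure_support_def)
qed

text \<open>
  A neighbourhood of a point on an edge with nonzero density contains an interval of that edge, hence
  the set where a continuous bump on the interval is positive. The integral of the bump is positive.
\<close>

lemma edge_union_subset_measure_support:
  assumes \<mu>: "has_edge_densities \<mu> c" and c: "\<And>e. e \<in> arcs G \<Longrightarrow> 0 \<le> c e"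
  shows "edge_union {e \<in> arcs G. c e \<noteq> 0} \<subseteq> measure_support G len \<mu>"
proof
  interpret finite_measure \<mu> using \<mu> by (simp add: has_edge_densities_def)
  note sp = \<mu>[unfolded has_edge_densities_def, THEN conjunct1]
    and st = \<mu>[unfolded has_edge_densities_def, THEN conjunct2, THEN conjunct1]
  fix p assume "p \<in> edge_union {e \<in> arcs G. c e \<noteq> 0}"
  then obtain e x where e: "e \<in> arcs G" "c e \<noteq> 0" and x: "x \<in> {0..len e}" "p = pt e x"
    by (auto simp: edge_union_def closed_edge_def)
  have "measure \<mu> U > 0" if U: "openin topo U" "p \<in> U" for U
  proof (rule ccontr)
    assume "\<not> measure \<mu> U > 0"
    then have U0: "measure \<mu> U = 0" using measure_nonneg[of \<mu> U] by linarith
    have "openin (top_of_set {0..len e}) (on_edge G len U e)"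
      using U(1) e(1) by (simp add: openin_graph_topology)
    then obtain T where T: "open T" "on_edge G len U e = {0..len e} \<inter> T"
      unfolding openin_open by auto
    have "x \<in> T" using T(2) x U(2) by (auto simp: on_edge_def)
    then obtain r where r: "0 < r" "ball x r \<subseteq> T" using T(1) open_contains_ball by blast
    define y z where "y = max 0 (x - r)" and "z = min (len e) (x + r)"
    have yz: "0 \<le> y" "y < z" "z \<le> len e" using x(1) r(1) len_pos[OF e(1)] by (auto simp: y_def z_def)
    have inU: "Inner e t \<in> U" if "y < t" "t < z" for t
    proof -
      have "t \<in> ball x r" using that by (auto simp: y_def z_def dist_real_def)
      then have "t \<in> on_edge G len U e" using T(2) r(2) that yz by auto
      then show ?thesis using that yz by (auto simp: on_edge_def edge_point_def split: if_splits)
    qed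
    \<comment> \<open>a bump on the part of \<open>e\<close> between \<open>y\<close> and \<open>z\<close>\<close>
    define h where "h d t = of_bool (d = e) * max 0 ((t - y) * (z - t))" for d t
    have h_pos: "h d t \<noteq> 0 \<Longrightarrow> d = e \<and> y < t \<and> t < z" for d t
    proof
      assume nz: "h d t \<noteq> 0"
      then have "max 0 ((t - y) * (z - t)) \<noteq> 0" by (auto simp: h_def)
      then have "0 < (t - y) * (z - t)" by linarith
      then show "y < t \<and> t < z" using yz(2) by (auto simp: zero_less_mult_iff)
      show "d = e" using nz by (simp add: h_def)
    qed
    have h_nonneg: "0 \<le> h d t" for d t by (simp add: h_def)
    have h0: "h d 0 = 0" "h d (len d) = 0" for d
      using h_pos[of d 0] h_pos[of d "len d"] yz by force+
    let ?\<phi> = "interpolate (\<lambda>_. 0) h"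
    have cont: "continuous_map topo euclideanreal ?\<phi>"
      using h0 by (intro continuous_map_interpolate) (auto simp: h_def intro!: continuous_intros)
    have \<phi>e: "?\<phi> (pt d t) = h d t" if "d \<in> arcs G" "t \<in> {0..len d}" for d t
      using interpolate_edge_point[OF that, of h "\<lambda>_. 0"] h0 by simp
    have off: "?\<phi> q = 0" if "q \<notin> U" for q
      using that inU h_pos by (cases q) (auto simp: interpolate_def)
    have "U \<in> sets \<mu>" unfolding st using U(1) by auto
    then have "AE q in \<mu>. q \<notin> U"
      using U0 U(1) by (subst AE_iff_measurable[of U]) (auto simp: sp emeasure_eq_measure openin_graph_topology)
    then have "AE q in \<mu>. ?\<phi> q = 0" by eventually_elim (rule off)
    then have "0 = (LINT q|\<mu>. ?\<phi> q)" by (simp add: integral_eq_zero_AE)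
    also have "\<dots> = (\<Sum>d\<in>arcs G. c d * (LINT t:{0..len d}|lebesgue. ?\<phi> (pt d t)))"
      using \<mu> cont unfolding has_edge_densities_def by blast
    also have "\<dots> = (\<Sum>d\<in>arcs G. c d * (LINT t:{0..len d}|lebesgue. h d t))"
      unfolding set_lebesgue_integral_def
      by (intro sum.cong refl arg_cong[of _ _ "\<lambda>s. _ * s"] Bochner_Integration.integral_cong)
         (auto simp: indicator_def \<phi>e)
    finally have "(\<Sum>d\<in>arcs G. c d * (LINT t:{0..len d}|lebesgue. h d t)) = 0" by simp
    moreover have "0 \<le> (LINT t:{0..len d}|lebesgue. h d t)" for d
      unfolding set_lebesgue_integral_def by (simp add: h_nonneg)
    ultimately have "c e * (LINT t:{0..len e}|lebesgue. h e t) = 0"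
      using c e(1) by (subst (asm) sum_nonneg_eq_0_iff) auto
    then have "(LINT t|lebesgue. indicator {0..len e} t *\<^sub>R h e t) = 0"
      using e(2) by (simp add: set_lebesgue_integral_def)
    moreover have "integrable lebesgue (\<lambda>t. indicator {0..len e} t *\<^sub>R h e t)"
    proof -
      have "continuous_on {0..len e} (h e)" by (auto simp: h_def intro!: continuous_intros)
      from absolutely_integrable_continuous_real[OF this] show ?thesis by (simp add: set_integrable_def)
    qed
    ultimately have "AE t in lebesgue. indicator {0..len e} t *\<^sub>R h e t = 0"
      by (subst integral_nonneg_eq_0_iff_AE[symmetric]) (auto simp: h_nonneg)
    then have "AE t in lebesgue. t \<notin> {y<..<z}"
      by eventually_elim (use yz in \<open>auto simp: h_def indicator_def split: if_splits\<close>)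
    then have "emeasure lebesgue {y<..<z} = 0"
      by (subst (asm) AE_iff_measurable[of "{y<..<z}"]) auto
    then show False using yz by simp
  qed
  moreover have "p \<in> points G len" using edge_point_in_points[OF e(1) x(1)] x(2) by simp
  ultimately show "p \<in> measure_support G len \<mu>" by (simp add: measure_support_def)
qed

lemma edge_point_measurable:
  assumes e: "e \<in> arcs G"
  shows "pt e \<in> measurable borel graph_borel"
proof (rule measurable_measure_of[OF graph_opens_subset])
  have "Vertex (tail G e) \<in> points G len" "Vertex (head G e) \<in> points G len"
    using e by (auto simp: points_def)
  then show "pt e \<in> space borel \<rightarrow> points G len"
    using edge_point_in_points[OF e] by (auto simp: edge_point_def) (metis atLeastAtMost_iff edge_point_def less_imp_le not_le)
  fix U assume "U \<in> {U. openin topo U}"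
  then have "openin (top_of_set {0..len e}) (on_edge G len U e)"
    using e by (simp add: openin_graph_topology)
  then obtain T where T: "open T" "on_edge G len U e = {0..len e} \<inter> T"
    unfolding openin_open by auto
  have "pt e -` U \<inter> space borel = ({0..len e} \<inter> T) \<union>
      (if Vertex (tail G e) \<in> U then {..0} else {}) \<union> (if Vertex (head G e) \<in> U then {len e..} else {})"
    unfolding T(2)[symmetric] using len_pos[OF e] by (auto simp: on_edge_def edge_point_def split: if_splits)
  also have "\<dots> \<in> sets borel" using T(1) by auto
  finally show "pt e -` U \<inter> space borel \<in> sets borel" .
qed

text \<open>
  The disjoint union of the edges is a subset of the product of the finite set of edges with the real
  line. The measure is the image, under the gluing map, of the product measure with density \<open>c\<close> on
  this subset.
\<close>

lemma exists_measure_with_edge_densities: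
  assumes c: "\<And>e. e \<in> arcs G \<Longrightarrow> 0 \<le> c e"
  shows "\<exists>\<mu>. has_edge_densities \<mu> c"
proof -
  interpret C: sigma_finite_measure "count_space (arcs G)"
    by (rule sigma_finite_measure_count_space_finite) simp
  interpret P: pair_sigma_finite "count_space (arcs G)" lborel ..
  let ?P = "count_space (arcs G) \<Otimes>\<^sub>M lborel"
  define w :: "'e \<times> real \<Rightarrow> real" where "w z = c (fst z) * indicator {0..len (fst z)} (snd z)" for z
  define q where "q z = pt (fst z) (snd z)" for z
  have cnt: "countable (arcs G)" by (simp add: countable_finite)
  have w_meas: "w \<in> borel_measurable ?P"
    unfolding w_def by (rule measurable_pair_measure_countable1[OF cnt]) simp
  have q_meas: "q \<in> measurable ?P graph_borel"
    unfolding q_def by (rule measurable_pair_measure_countable1[OF cnt]) (simp add: edge_point_measurable)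
  have w_nonneg: "AE z in ?P. 0 \<le> w z"
    by (rule AE_I2) (auto simp: w_def space_pair_measure c)
  define \<mu> where "\<mu> = distr (density ?P w) graph_borel q"
  have q_meas': "q \<in> measurable (density ?P w) graph_borel" using q_meas by simp
  have main: "integrable \<mu> \<phi> \<and> (LINT p|\<mu>. \<phi> p) =
      (\<Sum>e\<in>arcs G. c e * (LINT x:{0..len e}|lebesgue. \<phi> (pt e x)))"
    if cont: "continuous_map topo euclideanreal \<phi>" for \<phi>
  proof -
    have \<phi>_meas: "\<phi> \<in> borel_measurable graph_borel"
      by (rule continuous_map_graph_measurable[OF cont space_graph_borel sets_graph_borel])
    have \<phi>q: "(\<lambda>z. \<phi> (q z)) \<in> borel_measurable ?P"
      by (rule measurable_compose[OF q_meas \<phi>_meas])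
    let ?F = "\<lambda>z. w z *\<^sub>R \<phi> (q z)"
    have F_meas: "?F \<in> borel_measurable ?P" using w_meas \<phi>q by simp
    have edge: "integrable lborel (\<lambda>x. indicator {0..len e} x *\<^sub>R \<phi> (pt e x))" if "e \<in> arcs G" for e
      by (rule borel_integrable_compact[OF compact_Icc continuous_on_edge[OF cont that]])
    have F: "?F (e, x) = c e * (indicator {0..len e} x *\<^sub>R \<phi> (pt e x))" for e x
      by (simp add: w_def q_def)
    have F_int: "integrable ?P ?F"
    proof (rule P.Fubini_integrable[OF F_meas])
      show "integrable (count_space (arcs G)) (\<lambda>e. \<integral>x. norm (?F (e, x)) \<partial>lborel)"
        by (rule integrable_count_space) simp
      show "AE e in count_space (arcs G). integrable lborel (\<lambda>x. ?F (e, x))"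
        unfolding F using edge by (intro AE_I2) simp
    qed
    have "(LINT z|?P. ?F z) = (LINT e|count_space (arcs G). (LINT x|lborel. ?F (e, x)))"
      by (rule P.integral_fst'[OF F_int, symmetric])
    also have "\<dots> = (\<Sum>e\<in>arcs G. LINT x|lborel. ?F (e, x))"
      by (rule lebesgue_integral_count_space_finite) simp
    also have "\<dots> = (\<Sum>e\<in>arcs G. c e * (LINT x:{0..len e}|lebesgue. \<phi> (pt e x)))"
    proof (rule sum.cong[OF refl])
      fix e assume "e \<in> arcs G"
      then have "(LINT x:{0..len e}|lebesgue. \<phi> (pt e x)) =
          (LINT x|lborel. indicator {0..len e} x *\<^sub>R \<phi> (pt e x))"
        unfolding set_lebesgue_integral_def
        by (intro integral_completion) (use edge in auto)
      then show "(LINT x|lborel. ?F (e, x)) = c e * (LINT x:{0..len e}|lebesgue. \<phi> (pt e x))"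
        unfolding F by (simp only: integral_mult_right_zero)
    qed
    finally have int: "(LINT z|?P. ?F z) = \<dots>" .
    have "integrable \<mu> \<phi>"
      unfolding \<mu>_def integrable_distr_eq[OF q_meas' \<phi>_meas] integrable_density[OF \<phi>q w_meas w_nonneg]
      by (rule F_int)
    moreover have "(LINT p|\<mu>. \<phi> p) = (LINT z|?P. ?F z)"
      unfolding \<mu>_def integral_distr[OF q_meas' \<phi>_meas] integral_density[OF \<phi>q w_meas w_nonneg] ..
    ultimately show ?thesis using int by simp
  qed
  have sp: "space \<mu> = points G len" unfolding \<mu>_def using space_graph_borel by simp
  have "finite_measure \<mu>"
  proof
    have "integrable \<mu> (\<lambda>_. 1 :: real)" using main[of "\<lambda>_. 1"] by simp
    then show "emeasure \<mu> (space \<mu>) \<noteq> \<infinity>" by (simp add: integrable_iff_bounded)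
  qed
  moreover have "sets \<mu> = sigma_sets (points G len) {U. openin topo U}"
    unfolding \<mu>_def using sets_graph_borel by simp
  ultimately have "has_edge_densities \<mu> c" unfolding has_edge_densities_def using sp main by blast
  then show ?thesis by blast
qed

text \<open>
  The sets of edges whose unions are the supports of semiclassical measures, without reference to
  measures.
\<close>

definition limit_edges :: "'e set \<Rightarrow> bool" where
  "limit_edges S \<longleftrightarrow> (\<exists>k a u l. eigenwave_sequence k a u l \<and> S = {e \<in> arcs G. edge_mass l e \<noteq> 0})"

lemma measure_support_eq:
  assumes "has_edge_densities \<mu> (edge_mass l)"
  shows "measure_support G len \<mu> = edge_union {e \<in> arcs G. edge_mass l e \<noteq> 0}"
  using measure_support_subset[OF assms] edge_union_subset_measure_support[OF assms edge_mass_nonneg] by blast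

lemma continuous_map_edge_integrable:
  assumes "continuous_map topo euclideanreal \<phi>" "e \<in> arcs G"
  shows "set_integrable lebesgue (on_edge G len (points G len) e) (\<lambda>x. \<phi> (pt e x))"
  using absolutely_integrable_continuous_real[OF continuous_on_edge[OF assms]]
  by (simp add: on_edge_points[OF assms(2)])

lemma semiclassical_measure_support:
  assumes "semiclassical_measure G len \<mu>"
  obtains S where "limit_edges S" "measure_support G len \<mu> = edge_union S"
proof -
  obtain lam u where lam: "filterlim lam at_top sequentially"
    and u: "\<And>n. normalized_eigenfunction G len (lam n) (u n)"
    and weak: "\<And>\<phi>. continuous_map topo euclideanreal \<phi> \<Longrightarrow>
           (\<lambda>n. graph_integral G len (points G len) (\<lambda>p. \<phi> p * (cmod (u n p))\<^sup>2)) \<longlonglongrightarrow> (LINT p|\<mu>. \<phi> p)"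
    using assms unfolding semiclassical_measure_def by blast
  from eigenfunctions_have_eigenwave_subsequence[where u = u, OF lam u]
  obtain r k a l where r: "strict_mono (r :: nat \<Rightarrow> nat)" and seq: "eigenwave_sequence k a (u \<circ> r) l"
    by blast
  have "(LINT p|\<mu>. \<phi> p) = (\<Sum>e\<in>arcs G. edge_mass l e * (LINT x:{0..len e}|lebesgue. \<phi> (pt e x)))"
    if cont: "continuous_map topo euclideanreal \<phi>" for \<phi>
  proof (rule LIMSEQ_unique)
    show "(\<lambda>n. graph_integral G len (points G len) (\<lambda>p. \<phi> p * (cmod ((u \<circ> r) n p))\<^sup>2)) \<longlonglongrightarrow> (LINT p|\<mu>. \<phi> p)"
      using LIMSEQ_subseq_LIMSEQ[OF weak[OF cont] r] by (simp add: o_def)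
    show "(\<lambda>n. graph_integral G len (points G len) (\<lambda>p. \<phi> p * (cmod ((u \<circ> r) n p))\<^sup>2)) \<longlonglongrightarrow>
        (\<Sum>e\<in>arcs G. edge_mass l e * (LINT x:{0..len e}|lebesgue. \<phi> (pt e x)))"
      using eigenwave_sequence_integral[OF seq continuous_map_edge_integrable[OF cont]]
      by (simp add: on_edge_points cong: sum.cong)
  qed
  then have "has_edge_densities \<mu> (edge_mass l)"
    using assms unfolding semiclassical_measure_def has_edge_densities_def by blast
  from measure_support_eq[OF this] show thesis
    using that seq unfolding limit_edges_def by blast
qed

lemma limit_edges_semiclassical:
  assumes "limit_edges S"
  obtains \<mu> where "semiclassical_measure G len \<mu>" "measure_support G len \<mu> = edge_union S"
proof -
  obtain k a u l where seq: "eigenwave_sequence k a u l" and S: "S = {e \<in> arcs G. edge_mass l e \<noteq> 0}"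
    using assms unfolding limit_edges_def by blast
  obtain \<mu> where \<mu>: "has_edge_densities \<mu> (edge_mass l)"
    using exists_measure_with_edge_densities[where c = "edge_mass l", OF edge_mass_nonneg] by blast
  have "(\<lambda>n. graph_integral G len (points G len) (\<lambda>p. \<phi> p * (cmod (u n p))\<^sup>2)) \<longlonglongrightarrow> (LINT p|\<mu>. \<phi> p)"
    if cont: "continuous_map topo euclideanreal \<phi>" for \<phi>
  proof -
    have "(LINT p|\<mu>. \<phi> p) = (\<Sum>e\<in>arcs G. edge_mass l e * (LINT x:{0..len e}|lebesgue. \<phi> (pt e x)))"
      using \<mu> cont unfolding has_edge_densities_def by blast
    then show ?thesis
      using eigenwave_sequence_integral[OF seq continuous_map_edge_integrable[OF cont]]
      by (simp add: on_edge_points cong: sum.cong)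
  qed
  moreover have "filterlim (\<lambda>n. (k n)\<^sup>2) at_top sequentially"
    using seq by (auto simp: eigenwave_sequence_def intro!: filterlim_pow_at_top)
  moreover have "normalized_eigenfunction G len ((k n)\<^sup>2) (u n)" for n
    using seq by (simp add: eigenwave_sequence_def)
  ultimately have "semiclassical_measure G len \<mu>"
    using \<mu> unfolding semiclassical_measure_def has_edge_densities_def
    by (intro conjI exI[of _ "\<lambda>n. (k n)\<^sup>2"] exI[of _ u]) auto
  then show thesis using that measure_support_eq[OF \<mu>] S by blast
qed

end

section \<open>Observability from cycles and exterior paths\<close>

context metric_digraph
begin

lemma limit_wave:
  assumes "eigenwave_sequence k a u l"
  obtains w where "\<And>e. e \<in> arcs G \<Longrightarrow> cmod (w e) = 1" "kirchhoff_wave G w l"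
proof -
  have "cmod (cis (k n * len e)) \<le> 1" for n e by simp
  from pointwise_convergent_subsequence[where b = "\<lambda>n e. cis (k n * len e)" and B = 1, OF finite_arcs this]
  obtain r w where r: "strict_mono (r :: nat \<Rightarrow> nat)"
    and w: "\<And>e. e \<in> arcs G \<Longrightarrow> (\<lambda>n. cis (k (r n) * len e)) \<longlonglongrightarrow> w e" by blast
  have "cmod (w e) = 1" if "e \<in> arcs G" for e
    using tendsto_norm[OF w[OF that]] by (simp add: LIMSEQ_const_iff)
  moreover have "kirchhoff_wave G w l"
  proof (rule kirchhoff_wave_limit[where w = "\<lambda>n e. cis (k (r n) * len e)" and a = "a \<circ> r"])
    show "(\<lambda>n. (a \<circ> r) n d) \<longlonglongrightarrow> l d" if "d \<in> arcs G2" for d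
      using assms that LIMSEQ_subseq_LIMSEQ[OF _ r, of "\<lambda>n. a n d"]
      by (simp add: eigenwave_sequence_def o_def)
  qed (use assms w in \<open>auto simp: eigenwave_sequence_def\<close>)
  ultimately show thesis by (rule that)
qed

lemma carrier_set_eq_edge_union: "carrier_set G len p = edge_union (fst ` set p)"
  by (simp add: carrier_set_def edge_union_def)

lemma limit_edges_subset: "limit_edges S \<Longrightarrow> S \<subseteq> arcs G"
  by (auto simp: limit_edges_def)

lemma cycle_or_exterior_path_in_limit_edges:
  assumes "limit_edges S"
  obtains P where "P \<subseteq> S" "is_simple_cycle G len (edge_union P) \<or> is_exterior_path G len (edge_union P)"
proof -
  obtain k a u l where seq: "eigenwave_sequence k a u l" and S: "S = {e \<in> arcs G. edge_mass l e \<noteq> 0}"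
    using assms unfolding limit_edges_def by blast
  obtain w where w: "\<And>e. e \<in> arcs G \<Longrightarrow> cmod (w e) = 1" and wave: "kirchhoff_wave G w l"
    using limit_wave[OF seq] by blast
  have in_S: "fst d \<in> S \<longleftrightarrow> d \<in> arcs G2 \<and> (l d \<noteq> 0 \<or> l (flip d) \<noteq> 0)" for d
    by (cases d; cases "snd d") (auto simp: S edge_mass_eq_0_iff all_bool_eq)
  have "S \<noteq> {}"
  proof
    assume "S = {}"
    then have "(\<Sum>e\<in>arcs G. edge_mass l e * len e) = 0" by (intro sum.neutral) (auto simp: S)
    then show False using eigenwave_sequence_mass[OF seq] by simp
  qed
  have step: "\<exists>d'. tail G2 d' = tail G2 d \<and> d' \<noteq> d \<and> fst d' \<in> S"
    if d: "fst d \<in> S" "\<not> exterior G (tail G2 d)" for d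
  proof -
    have w0: "w e \<noteq> 0" if "e \<in> arcs G" for e using w[OF that] by auto
    obtain d' where "d' \<in> out_arcs G2 (tail G2 d)" "d' \<noteq> d" "l d' \<noteq> 0 \<or> l (flip d') \<noteq> 0"
      using kirchhoff_wave_no_dead_end[OF wave w0 _ _ refl d(2)] d(1) unfolding in_S by blast
    then show ?thesis unfolding in_S by (intro exI[of _ d']) simp
  qed
  show thesis
  proof (rule cycle_or_exterior_path_within[OF limit_edges_subset[OF assms] \<open>S \<noteq> {}\<close> step])
    fix p assume p: "fst ` set p \<subseteq> S" "TW.cycle p" "distinct (map fst p)"
    then have "is_simple_cycle G len (edge_union (fst ` set p))"
      unfolding is_simple_cycle_def carrier_set_eq_edge_union by blast
    with p(1) that show thesis by blast
  next
    fix u p v assume p: "fst ` set p \<subseteq> S" "TW.apath u p v" "exterior G u" "exterior G v" "u \<noteq> v"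
    then have "is_exterior_path G len (edge_union (fst ` set p))"
      unfolding is_exterior_path_def carrier_set_eq_edge_union by blast
    with p(1) that show thesis by blast
  qed
qed

text \<open>
  The wave carried by \<open>P\<close> serves to show that eigenfunctions exist at frequencies \<open>k j\<close> whose phases
  converge to \<open>w\<close>. The limit \<open>m\<close> of their amplitudes need not be that wave, but it is some solution for
  \<open>w\<close>, so it is confined to \<open>P\<close>.
\<close>

lemma carries_wave_imp_limit_edges:
  assumes indep: "rationally_independent (arcs G) len" and P: "carries_wave P"
  obtains S where "limit_edges S" "S \<subseteq> P"
proof -
  let ?D = "arcs G2"
  obtain w0 X where w0: "\<forall>e\<in>P. cmod (w0 e) = 1" and X: "\<exists>d\<in>?D. X d \<noteq> 0"
    and wX: "\<And>w. \<forall>e\<in>P. w e = w0 e \<Longrightarrow> kirchhoff_wave G w X"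
    using P unfolding carries_wave_def by blast
  have "\<exists>w. (\<forall>e. cmod (w e) = 1) \<and> (\<forall>e\<in>P. w e = w0 e) \<and>
     (\<forall>a. kirchhoff_wave G w a \<longrightarrow> (\<forall>d\<in>?D. fst d \<notin> P \<longrightarrow> a d = 0))"
    using w0 by (intro exists_phases_confining_waves) (rule bspec)
  then obtain w where w1: "\<forall>e. cmod (w e) = 1" and wP: "\<forall>e\<in>P. w e = w0 e"
    and confined: "\<forall>a. kirchhoff_wave G w a \<longrightarrow> (\<forall>d\<in>?D. fst d \<notin> P \<longrightarrow> a d = 0)"
    by (elim exE conjE)
  note w = w1[rule_format] wP
  obtain t where t: "filterlim t at_top sequentially"
    and tw: "\<And>e. e \<in> arcs G \<Longrightarrow> (\<lambda>n. cis (t n * len e)) \<longlonglongrightarrow> w e"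
    using kronecker_recurrent_phases[where w = w, OF finite_arcs indep w(1)] by blast
  \<comment> \<open>the margin \<open>1\<close> in the bound for \<open>t n\<close> absorbs the shift from \<open>t n\<close> to \<open>k\<close>\<close>
  have "\<exists>n k a. j \<le> n \<and> real j + 1 \<le> t n \<and> \<bar>k - t n\<bar> < 1 / real (Suc j) \<and>
      kirchhoff_wave G (\<lambda>e. cis (k * len e)) a \<and> (\<exists>d\<in>?D. a d \<noteq> 0)" for j
  proof -
    obtain N where N: "\<And>n. n \<ge> N \<Longrightarrow> real j + 1 \<le> t n"
      using t unfolding filterlim_at_top eventually_sequentially by blast
    obtain d0 where d0: "d0 \<in> ?D" "X d0 \<noteq> 0" using X by blast
    have "\<exists>n k a. \<bar>k - t (n + (N + j))\<bar> < 1 / real (Suc j) \<and>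
        kirchhoff_wave G (\<lambda>e. cis (k * len e)) a \<and> (\<exists>d\<in>?D. a d \<noteq> 0)"
      using kirchhoff_wave_near_phases[where w = w, OF w(1) LIMSEQ_ignore_initial_segment[OF tw] wX[OF w(2)] d0,
          of "1 / real (Suc j)" "N + j"] by simp
    then obtain n k a where "\<bar>k - t (n + (N + j))\<bar> < 1 / real (Suc j)"
        "kirchhoff_wave G (\<lambda>e. cis (k * len e)) a" "\<exists>d\<in>?D. a d \<noteq> 0" by blast
    then show ?thesis using N[of "n + (N + j)"]
      by (intro exI[of _ "n + (N + j)"] exI[of _ k] exI[of _ a]) simp
  qed
  then have "\<forall>j. \<exists>n k a. j \<le> n \<and> real j + 1 \<le> t n \<and> \<bar>k - t n\<bar> < 1 / real (Suc j) \<and>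
      kirchhoff_wave G (\<lambda>e. cis (k * len e)) a \<and> (\<exists>d\<in>?D. a d \<noteq> 0)" ..
  then obtain n k a where n: "\<And>j. j \<le> n j" and tn: "\<And>j. real j + 1 \<le> t (n j)"
    and k: "\<And>j. \<bar>k j - t (n j)\<bar> < 1 / real (Suc j)"
    and wave: "\<And>j. kirchhoff_wave G (\<lambda>e. cis (k j * len e)) (a j)" and nz: "\<And>j. \<exists>d\<in>?D. a j d \<noteq> 0"
    unfolding choice_iff by blast
  have k_ge: "real j < k j" for j
  proof -
    have "1 / real (Suc j) \<le> 1" by simp
    then show ?thesis using k[of j] tn[of j] by linarith
  qed
  then have kpos: "0 < k j" for j by (rule le_less_trans[rotated]) simp
  have ktop: "filterlim k at_top sequentially"
    by (rule filterlim_at_top_mono[OF filterlim_real_sequentially]) (simp add: k_ge less_imp_le)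
  have n_top: "filterlim n at_top sequentially"
    by (rule filterlim_at_top_mono[OF filterlim_ident]) (simp add: n)
  have phases: "(\<lambda>j. cis (k j * len e)) \<longlonglongrightarrow> w e" if e: "e \<in> arcs G" for e
  proof -
    have "(\<lambda>j. k j - t (n j)) \<longlonglongrightarrow> 0"
      by (rule Lim_null_comparison[OF _ LIMSEQ_Suc[OF lim_1_over_n]])
         (use k in \<open>auto intro!: always_eventually less_imp_le simp del: of_nat_Suc\<close>)
    then have "(\<lambda>j. cis ((k j - t (n j)) * len e)) \<longlonglongrightarrow> cis (0 * len e)"
      by (intro tendsto_intros)
    from tendsto_mult[OF filterlim_compose[OF tw[OF e] n_top] this]
    show ?thesis by (simp add: cis_mult left_diff_distrib)
  qed
  from normalized_convergent_subsequence[where a = a, OF finite_arcs_two_way nz]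
  obtain s :: "nat \<Rightarrow> nat" and c :: "nat \<Rightarrow> real" and m where s: "strict_mono s"
    and m: "\<And>d. d \<in> ?D \<Longrightarrow> (\<lambda>j. of_real (c j) * a (s j) d) \<longlonglongrightarrow> m d" and "\<exists>d\<in>?D. m d \<noteq> 0"
    by blast
  then obtain d0 where d0: "d0 \<in> ?D" "m d0 \<noteq> 0" by blast
  have wave': "kirchhoff_wave G (\<lambda>e. cis (k (s j) * len e)) (\<lambda>d. of_real (c j) * a (s j) d)" for j
    by (rule kirchhoff_wave_scale[OF wave])
  have wave_m: "kirchhoff_wave G w m"
    by (rule kirchhoff_wave_limit[OF wave' _ m])
       (use LIMSEQ_subseq_LIMSEQ[OF phases s] in \<open>simp_all add: o_def\<close>)
  have "\<forall>d\<in>?D. fst d \<notin> P \<longrightarrow> m d = 0" by (rule mp[OF spec[OF confined] wave_m])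
  then have m0: "m (e, b) = 0" if "e \<in> arcs G" "e \<notin> P" for e b
    using that by (auto dest: bspec[of _ _ "(e, b)"])
  obtain k' a' u b where seq: "eigenwave_sequence k' a' u (\<lambda>d. b * m d)"
    using waves_give_eigenwave_sequence[OF filterlim_compose[OF ktop filterlim_subseq[OF s]] kpos wave' m d0]
    by blast
  have "limit_edges {e \<in> arcs G. edge_mass (\<lambda>d. b * m d) e \<noteq> 0}"
    unfolding limit_edges_def using seq by blast
  moreover have "{e \<in> arcs G. edge_mass (\<lambda>d. b * m d) e \<noteq> 0} \<subseteq> P"
    using m0 by (auto simp: edge_mass_eq_0_iff)
  ultimately show thesis by (rule that)
qed

lemma limit_edges_in_cycle_or_exterior_path:
  assumes indep: "rationally_independent (arcs G) len"
    and P: "is_simple_cycle G len P \<or> is_exterior_path G len P"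
  obtains S E where "limit_edges S" "S \<subseteq> E" "E \<subseteq> arcs G" "P = edge_union E"
proof -
  have "\<exists>E. E \<subseteq> arcs G \<and> carries_wave E \<and> P = edge_union E"
    using P
  proof
    assume "is_simple_cycle G len P"
    then obtain p where p: "TW.cycle p" "distinct (map fst p)" "P = carrier_set G len p"
      unfolding is_simple_cycle_def by blast
    then have "fst ` set p \<subseteq> arcs G" by (auto simp: TW.cycle_def TW.awalk_def)
    with p show ?thesis using cycle_carries_wave[OF p(1,2)] carrier_set_eq_edge_union by blast
  next
    assume "is_exterior_path G len P"
    then obtain u p v where p: "exterior G u" "exterior G v" "u \<noteq> v" "TW.apath u p v" "P = carrier_set G len p"
      unfolding is_exterior_path_def by blast
    then have "fst ` set p \<subseteq> arcs G" by (auto simp: TW.apath_def TW.awalk_def)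
    with p show ?thesis using exterior_path_carries_wave[OF p(4,1,2,3)] carrier_set_eq_edge_union by blast
  qed
  then obtain E where E: "E \<subseteq> arcs G" "carries_wave E" "P = edge_union E" by blast
  obtain S where "limit_edges S" "S \<subseteq> E" using carries_wave_imp_limit_edges[OF indep E(2)] by blast
  with E(1,3) show thesis by (intro that)
qed

lemma edge_union_mono_iff:
  assumes "S \<subseteq> arcs G" "T \<subseteq> arcs G"
  shows "edge_union S \<subseteq> edge_union T \<longleftrightarrow> S \<subseteq> T"
proof
  assume sub: "edge_union S \<subseteq> edge_union T"
  show "S \<subseteq> T"
  proof
    fix e assume "e \<in> S"
    then have "closed_edge G len e \<subseteq> edge_union S" by (auto simp: edge_union_def)
    with sub have "closed_edge G len e \<subseteq> edge_union T" by blast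
    then show "e \<in> T" using \<open>e \<in> S\<close> assms closed_edge_subset_edge_union[OF assms(2)] by blast
  qed
qed (auto simp: edge_union_def)

lemma primitive_support_limit_edges:
  assumes "primitive_support G len P"
  obtains S where "limit_edges S" "P = edge_union S"
proof -
  obtain \<mu> where \<mu>: "semiclassical_measure G len \<mu>" "P = measure_support G len \<mu>"
    using assms unfolding primitive_support_def by blast
  obtain S where "limit_edges S" "measure_support G len \<mu> = edge_union S"
    using semiclassical_measure_support[OF \<mu>(1)] by blast
  with \<mu>(2) show thesis by (intro that) simp_all
qed

text \<open>
  A graph has finitely many sets of edges, so among those in \<open>limit_edges\<close> inside \<open>S\<close> there is a minimal
  one, and inclusion of sets of edges is the same as inclusion of their unions.
\<close>

lemma limit_edges_contains_primitive_support:
  assumes "limit_edges S"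
  obtains T where "T \<subseteq> S" "primitive_support G len (edge_union T)"
proof -
  define C where "C = {T. limit_edges T \<and> T \<subseteq> S}"
  have "finite C"
    by (rule finite_subset[of _ "Pow (arcs G)"]) (use limit_edges_subset in \<open>auto simp: C_def\<close>)
  moreover have "C \<noteq> {}" using assms by (auto simp: C_def)
  ultimately obtain T where T: "T \<in> C" and min: "\<And>R. R \<in> C \<Longrightarrow> R \<subseteq> T \<Longrightarrow> R = T"
    using finite_has_minimal[of C] by metis
  have lT: "limit_edges T" "T \<subseteq> S" using T by (auto simp: C_def)
  obtain \<mu> where \<mu>: "semiclassical_measure G len \<mu>" "measure_support G len \<mu> = edge_union T"
    using limit_edges_semiclassical[OF lT(1)] by blast
  have "measure_support G len \<nu> = edge_union T"
    if \<nu>: "semiclassical_measure G len \<nu>" "measure_support G len \<nu> \<subseteq> edge_union T" for \<nu>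
  proof -
    obtain R where R: "limit_edges R" "measure_support G len \<nu> = edge_union R"
      using semiclassical_measure_support[OF \<nu>(1)] by blast
    have "R \<subseteq> T"
      using \<nu>(2) R edge_union_mono_iff[OF limit_edges_subset[OF R(1)] limit_edges_subset[OF lT(1)]] by simp
    then have "R = T" using R(1) lT(2) by (intro min) (auto simp: C_def)
    then show ?thesis using R(2) by simp
  qed
  then have "primitive_support G len (edge_union T)"
    unfolding primitive_support_def by (intro exI[of _ \<mu>]) (simp add: \<mu>)
  with lT(2) show thesis by (rule that)
qed

lemma length_on_pos_iff:
  assumes "S \<subseteq> arcs G"
  shows "0 < length_on G len \<omega> (edge_union S) \<longleftrightarrow> (\<exists>e\<in>S. 0 < measure lebesgue (on_edge G len \<omega> e))"
proof -
  have "finite S" by (rule finite_subset[OF assms finite_arcs])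
  then have "(\<Sum>e\<in>S. measure lebesgue (on_edge G len \<omega> e)) = 0 \<longleftrightarrow>
      (\<forall>e\<in>S. measure lebesgue (on_edge G len \<omega> e) = 0)"
    by (intro sum_nonneg_eq_0_iff) auto
  then show ?thesis
    unfolding length_on_edge_union[OF assms] by (simp add: less_le sum_nonneg)
qed

lemma length_on_mono:
  assumes "S \<subseteq> T" "T \<subseteq> arcs G" "0 < length_on G len \<omega> (edge_union S)"
  shows "0 < length_on G len \<omega> (edge_union T)"
proof -
  have "S \<subseteq> arcs G" using assms by blast
  from length_on_pos_iff[OF this] assms(3) obtain e where "e \<in> S" "0 < measure lebesgue (on_edge G len \<omega> e)"
    by blast
  with assms(1) show ?thesis unfolding length_on_pos_iff[OF assms(2)] by blast
qed

lemma C_infinity_pos_iff_limit_edges: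
  assumes "graph_measurable G len \<omega>"
  shows "C_infinity G len \<omega> > 0 \<longleftrightarrow> (\<forall>S. limit_edges S \<longrightarrow> 0 < length_on G len \<omega> (edge_union S))"
proof -
  have eq: "0 < (\<Sum>e\<in>arcs G. edge_mass l e * measure lebesgue (on_edge G len \<omega> e)) \<longleftrightarrow>
      0 < length_on G len \<omega> (edge_union {e \<in> arcs G. edge_mass l e \<noteq> 0})" for l
  proof -
    have "(\<Sum>e\<in>arcs G. edge_mass l e * measure lebesgue (on_edge G len \<omega> e)) = 0 \<longleftrightarrow>
        (\<forall>e\<in>arcs G. edge_mass l e * measure lebesgue (on_edge G len \<omega> e) = 0)"
      by (rule sum_nonneg_eq_0_iff) (auto simp: edge_mass_nonneg)
    moreover have "0 \<le> (\<Sum>e\<in>arcs G. edge_mass l e * measure lebesgue (on_edge G len \<omega> e))"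
      by (intro sum_nonneg) (simp add: edge_mass_nonneg)
    moreover have "0 < length_on G len \<omega> (edge_union {e \<in> arcs G. edge_mass l e \<noteq> 0}) \<longleftrightarrow>
        (\<exists>e\<in>arcs G. edge_mass l e \<noteq> 0 \<and> measure lebesgue (on_edge G len \<omega> e) \<noteq> 0)"
      by (subst length_on_pos_iff) (auto simp: less_le)
    ultimately show ?thesis by (auto simp: less_le)
  qed
  show ?thesis unfolding C_infinity_pos_iff[OF assms] limit_edges_def eq by blast
qed

theorem C_infinity_pos_iff_primitive_supports:
  assumes "graph_measurable G len \<omega>"
  shows "C_infinity G len \<omega> > 0 \<longleftrightarrow> (\<forall>P. primitive_support G len P \<longrightarrow> length_on G len \<omega> P > 0)"
  unfolding C_infinity_pos_iff_limit_edges[OF assms]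
proof (intro iffI allI impI)
  fix P assume "\<forall>S. limit_edges S \<longrightarrow> 0 < length_on G len \<omega> (edge_union S)" "primitive_support G len P"
  then show "length_on G len \<omega> P > 0" by (elim primitive_support_limit_edges) blast
next
  fix S assume prim: "\<forall>P. primitive_support G len P \<longrightarrow> length_on G len \<omega> P > 0" and S: "limit_edges S"
  obtain T where T: "T \<subseteq> S" "primitive_support G len (edge_union T)"
    using limit_edges_contains_primitive_support[OF S] by blast
  show "0 < length_on G len \<omega> (edge_union S)"
    using prim T(2) by (intro length_on_mono[OF T(1) limit_edges_subset[OF S]]) blast
qed

theorem C_infinity_pos_iff_cycles_and_exterior_paths:
  assumes "graph_measurable G len \<omega>" and indep: "rationally_independent (arcs G) len"
  shows "C_infinity G len \<omega> > 0 \<longleftrightarrow>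
    (\<forall>P. is_simple_cycle G len P \<or> is_exterior_path G len P \<longrightarrow> length_on G len \<omega> P > 0)"
  unfolding C_infinity_pos_iff_limit_edges[OF assms(1)]
proof (intro iffI allI impI)
  fix P assume lim: "\<forall>S. limit_edges S \<longrightarrow> 0 < length_on G len \<omega> (edge_union S)"
    and P: "is_simple_cycle G len P \<or> is_exterior_path G len P"
  obtain S E where S: "limit_edges S" "S \<subseteq> E" "E \<subseteq> arcs G" and P_eq: "P = edge_union E"
    using limit_edges_in_cycle_or_exterior_path[OF indep P] by blast
  show "length_on G len \<omega> P > 0"
    unfolding P_eq using lim S(1) by (intro length_on_mono[OF S(2,3)]) blast
next
  fix S assume P: "\<forall>P. is_simple_cycle G len P \<or> is_exterior_path G len P \<longrightarrow> length_on G len \<omega> P > 0"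
    and S: "limit_edges S"
  obtain Q where Q: "Q \<subseteq> S" "is_simple_cycle G len (edge_union Q) \<or> is_exterior_path G len (edge_union Q)"
    using cycle_or_exterior_path_in_limit_edges[OF S] by blast
  show "0 < length_on G len \<omega> (edge_union S)"
    using P Q(2) by (intro length_on_mono[OF Q(1) limit_edges_subset[OF S]]) blast
qed

end

theorem corollary3p1:
  fixes G :: "('v, 'e) pre_digraph" and len :: "'e \<Rightarrow> real" and \<omega> :: "('v, 'e) gpoint set"
  assumes "fin_digraph G"
    and "len \<in> generic_class G"
    and "graph_measurable G len \<omega>"
  shows "(C_infinity G len \<omega> > 0 \<longleftrightarrow>
            (\<forall>P. primitive_support G len P \<longrightarrow> length_on G len \<omega> P > 0)) \<and>
         (C_infinity G len \<omega> > 0 \<longleftrightarrow>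
            (\<forall>P. is_simple_cycle G len P \<or> is_exterior_path G len P \<longrightarrow> length_on G len \<omega> P > 0))"
proof -
  interpret fin_digraph G by (rule assms(1))
  interpret metric_digraph G len
    by unfold_locales (use assms(2) in \<open>simp add: generic_class_def\<close>)
  have "rationally_independent (arcs G) len" using assms(2) by (simp add: generic_class_def)
  then show ?thesis
    using C_infinity_pos_iff_primitive_supports[OF assms(3)]
      C_infinity_pos_iff_cycles_and_exterior_paths[OF assms(3)] by blast
qed

end
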